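(* Let $d\ge1$ be an integer. For each of the four settings (I), (I* ), (II), (II* ), with associated $q\in\{1,2,4\}$, there exists an objective function $\bar F$ (on some $d$-dimensional $\Theta$) satisfying (A1) and the requirements of the setting, with $\inf\bar F=\bar F(\mu^* )$ for some $\mu^*\in\mathcal{M}_+(\Theta)$, such that for any distance-generating function $\eta$ satisfying (A2) and any $f_0$ with $\eta'(f_0)\in L^\infty(\tau)$, the function $$\psi(\alpha)=\inf_{f\in L^1(\tau)}\Big\{F(f)-\inf F+\alpha\,D_{\bar\eta}(f,f_0)\Big\}$$ satisfies $$\psi(\alpha)\gtrsim\inf_{\epsilon>0}\Big\{\epsilon^q+\alpha\,\epsilon^d\,\eta(\epsilon^{-d})\Big\},$$ i.e. there exist $c>0$ and $\alpha_0>0$ (independent of $\alpha$) such that $\psi(\alpha)\ge c\inf_{\epsilon>0}\{\epsilon^q+\alpha\epsilon^d\eta(\epsilon^{-d})\}$ for all $\alpha\in\,]0,\alpha_0]$.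
   Context: $\Theta$ is a compact $d$-dimensional Riemannian manifold without boundary, with geodesic distance $\mathrm{dist}$, and $\tau$ is the probability measure on $\Theta$ proportional to the volume measure. $\mathcal{M}(\Theta)$ (resp. $\mathcal{M}_+(\Theta)$, $\mathcal{P}(\Theta)$) is the set of finite signed (resp. finite nonnegative, probability) Borel measures on $\Theta$, and $\|\mu\|$ is the total variation norm. $\iota_C$ is the convex indicator of $C$. Objective: $\bar F=\bar G+\bar H:\mathcal{M}(\Theta)\to\mathbb{R}\cup\{+\infty\}$ with $\bar G(\mu)=R\big(\int\Phi\,\mathrm{d}\mu\big)$, under (A1): $\Phi\in\mathcal{C}^0(\Theta;\mathcal{F})$ where $\mathcal{F}$ is a Hilbert space; $R:\mathcal{F}\to\mathbb{R}$ is convex and differentiable with Lipschitz gradient $\nabla R$; $\bar H$ is a sum of functions from the list $\iota_{\mathcal{P}(\Theta)}$, $\iota_{\mathcal{M}_+(\Theta)}$, $\mu\mapsto\lambda\|\mu\|$, $\iota_{\{\mu:\lambda\|\mu\|\le1\}}$ (with $\lambda\ge0$), and $\bar H$ is not identically $+\infty$. For $f\in L^1(\tau)$: $F(f)=\bar F(f\tau)$, and $\inf F=\inf_{L^1(\tau)}F$. The differential of $\bar G$ at $\mu$ is represented by the function $\bar G'[\mu](\theta)=\langle\nabla R(\int\Phi\,\mathrm{d}\mu),\Phi(\theta)\rangle_{\mathcal{F}}$ on $\Theta$. Settings ($\mu^*$ denotes the minimizer of $\bar F$ under consideration): (I): $\Phi$ Lipschitz, $\bar G'[\mu^*]$ arbitrary;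 $q=1$. (I* ): $\Phi$ Lipschitz and $\bar G'[\mu^*]=0$; $q=2$. (II): $\nabla_\theta\Phi$ Lipschitz (i.e. $\Phi$ is $\mathcal{C}^1$ with Lipschitz derivative), $\bar G'[\mu^*]$ arbitrary; $q=2$. (II* ): $\nabla_\theta\Phi$ Lipschitz and $\bar G'[\mu^*]=0$; $q=4$. (A2): $\eta:\mathbb{R}\to[0,\infty]$ is strictly convex (on its domain), lower semicontinuous, continuously differentiable in $\operatorname{int}(\operatorname{dom}\eta)$, with $\eta'(\operatorname{int}(\operatorname{dom}\eta))=\mathbb{R}$, and for any $c>0$, $\eta(cx)\asymp\eta(x)$ as $x\to+\infty$ (each side is bounded by a constant times the other for $x$ large). Moreover either $(\mathrm{A2})_+$: $\operatorname{dom}\eta=[0,+\infty[$ and $\eta(1)=\eta'(1)=0$; or $(\mathrm{A2})_\pm$: $\operatorname{dom}\eta=\mathbb{R}$, $\eta$ is even and $\eta(0)=\eta'(0)=0$. Divergences: $D_\eta(a,b)=\eta(a)-\eta(b)-\eta'(b)(a-b)$ and $D_{\bar\eta}(f,g)=\int_\Theta D_\eta(f(\theta),g(\theta))\,\mathrm{d}\tau(\theta)\in[0,+\infty]$. The condition $\eta'(f_0)\in L^\infty(\tau)$ includes that $f_0\in\operatorname{int}(\operatorname{dom}\eta)$ almost everywhere. *)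

theory Defs
  imports "HOL-Analysis.Analysis"
begin

subsection \<open>The separable Hilbert space of square-summable sequences\<close>

text \<open>
  The feature space F of the objective is existentially quantified, but HOL has no quantifier
  over types. For continuous \<Phi> on a compact space, the closed span V of the image of \<Phi> is
  separable, hence embeds isometrically into the space below; replacing R by its restriction to V
  precomposed with the orthogonal projection onto V changes neither G nor its differential. Taking
  F to be this type is therefore no restriction (nor a specialization).
\<close>

typedef ell2 = "{x :: nat \<Rightarrow> real. summable (\<lambda>n. (x n)\<^sup>2)}"
  morphisms ell2_nth Abs_ell2
  by (rule exI[of _ "\<lambda>_. 0"]) simp

lemma ell2_summable_sq: "summable (\<lambda>n. (ell2_nth x n)\<^sup>2)"
  using ell2_nth by auto

lemma ell2_nth_Abs: "summable (\<lambda>n. (f n)\<^sup>2) \<Longrightarrow> ell2_nth (Abs_ell2 f) = f"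
  by (simp add: Abs_ell2_inverse)

lemma ell2_eqI: "(\<And>n. ell2_nth x n = ell2_nth y n) \<Longrightarrow> x = y"
  by (metis ell2_nth_inject ext)

lemma ell2_summable_mult: "summable (\<lambda>n. ell2_nth x n * ell2_nth y n)"
proof (rule summable_comparison_test')
  show "summable (\<lambda>n. (ell2_nth x n)\<^sup>2 + (ell2_nth y n)\<^sup>2)"
    by (intro summable_add ell2_summable_sq)
  show "norm (ell2_nth x n * ell2_nth y n) \<le> (ell2_nth x n)\<^sup>2 + (ell2_nth y n)\<^sup>2" for n
  proof -
    have "2 * (\<bar>ell2_nth x n\<bar> * \<bar>ell2_nth y n\<bar>) \<le> (ell2_nth x n)\<^sup>2 + (ell2_nth y n)\<^sup>2"
      using sum_squares_bound[of "\<bar>ell2_nth x n\<bar>" "\<bar>ell2_nth y n\<bar>"] by (simp add: mult.assoc)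
    moreover have "0 \<le> \<bar>ell2_nth x n\<bar> * \<bar>ell2_nth y n\<bar>" by simp
    ultimately show ?thesis unfolding real_norm_def abs_mult by linarith
  qed
qed

lemma summable_sq_lincomb:
  fixes f g :: "nat \<Rightarrow> real"
  assumes "summable (\<lambda>n. (f n)\<^sup>2)" "summable (\<lambda>n. (g n)\<^sup>2)"
  shows "summable (\<lambda>n. (a * f n + b * g n)\<^sup>2)"
proof -
  have "summable (\<lambda>n. f n * g n)"
    using ell2_summable_mult[of "Abs_ell2 f" "Abs_ell2 g"] assms by (simp add: ell2_nth_Abs)
  hence "summable (\<lambda>n. a\<^sup>2 * (f n)\<^sup>2 + b\<^sup>2 * (g n)\<^sup>2 + 2 * a * b * (f n * g n))"
    by (intro summable_add summable_mult assms)
  thus ?thesis by (simp add: power2_sum power_mult_distrib algebra_simps)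
qed

instantiation ell2 :: real_vector
begin

definition "0 = Abs_ell2 (\<lambda>_. 0)"
definition "x + y = Abs_ell2 (\<lambda>n. ell2_nth x n + ell2_nth y n)"
definition "- x = Abs_ell2 (\<lambda>n. - ell2_nth x n)"
definition "x - y = Abs_ell2 (\<lambda>n. ell2_nth x n - ell2_nth y n)"
definition "a *\<^sub>R x = Abs_ell2 (\<lambda>n. a * ell2_nth x n)"

lemma ell2_nth_zero [simp]: "ell2_nth 0 n = 0"
  by (simp add: zero_ell2_def ell2_nth_Abs)

lemma ell2_nth_add [simp]: "ell2_nth (x + y) n = ell2_nth x n + ell2_nth y n"
  using summable_sq_lincomb[OF ell2_summable_sq ell2_summable_sq, of 1 x 1 y]
  by (simp add: plus_ell2_def ell2_nth_Abs)

lemma ell2_nth_uminus [simp]: "ell2_nth (- x) n = - ell2_nth x n"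
  by (simp add: uminus_ell2_def ell2_nth_Abs ell2_summable_sq)

lemma ell2_nth_diff [simp]: "ell2_nth (x - y) n = ell2_nth x n - ell2_nth y n"
  using summable_sq_lincomb[OF ell2_summable_sq ell2_summable_sq, of 1 x "-1" y]
  by (simp add: minus_ell2_def ell2_nth_Abs)

lemma ell2_nth_scaleR [simp]: "ell2_nth (a *\<^sub>R x) n = a * ell2_nth x n"
  using summable_sq_lincomb[OF ell2_summable_sq ell2_summable_sq, of a x 0 x]
  by (simp add: scaleR_ell2_def ell2_nth_Abs)

instance
  by standard (auto intro!: ell2_eqI simp: algebra_simps)

end

instantiation ell2 :: real_inner
begin

definition "inner x y = (\<Sum>n. ell2_nth x n * ell2_nth y n)"
definition "norm x = sqrt (inner x (x :: ell2))"
definition "sgn x = x /\<^sub>R norm (x :: ell2)"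
definition "dist x y = norm (x - y :: ell2)"
definition "(uniformity :: (ell2 \<times> ell2) filter) = (INF e\<in>{0<..}. principal {(x, y). dist x y < e})"
definition "open (U :: ell2 set) \<longleftrightarrow> (\<forall>x\<in>U. eventually (\<lambda>(x', y). x' = x \<longrightarrow> y \<in> U) uniformity)"

instance
proof
  fix x y z :: ell2 and r :: real
  show "inner x y = inner y x"
    by (simp add: inner_ell2_def mult.commute)
  show "inner (x + y) z = inner x z + inner y z"
    by (simp add: inner_ell2_def distrib_right suminf_add ell2_summable_mult)
  show "inner (r *\<^sub>R x) y = r * inner x y"
    by (simp add: inner_ell2_def mult.assoc suminf_mult ell2_summable_mult)
  show "0 \<le> inner x x"
    by (simp add: inner_ell2_def suminf_nonneg ell2_summable_mult)
  show "inner x x = 0 \<longleftrightarrow> x = 0"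
    using suminf_eq_zero_iff[OF ell2_summable_mult, of x x]
    by (auto simp: inner_ell2_def intro!: ell2_eqI)
qed (simp_all add: norm_ell2_def sgn_ell2_def dist_ell2_def uniformity_ell2_def open_ell2_def)

end

lemma ell2_norm_sq: "(norm x)\<^sup>2 = (\<Sum>n. (ell2_nth x n)\<^sup>2)"
  using power2_norm_eq_inner[of x] by (simp add: inner_ell2_def power2_eq_square)

lemma ell2_sum_le_norm_sq: "(\<Sum>n<k. (ell2_nth x n)\<^sup>2) \<le> (norm x)\<^sup>2"
  unfolding ell2_norm_sq by (rule sum_le_suminf[OF ell2_summable_sq]) auto

lemma ell2_abs_nth_le_norm: "\<bar>ell2_nth x n\<bar> \<le> norm x"
proof -
  have "(ell2_nth x n)\<^sup>2 \<le> (\<Sum>i<Suc n. (ell2_nth x i)\<^sup>2)"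
    by (simp add: sum_nonneg)
  also have "\<dots> \<le> (norm x)\<^sup>2" by (rule ell2_sum_le_norm_sq)
  finally show ?thesis by (simp add: abs_le_square_iff[symmetric])
qed

instance ell2 :: banach
proof
  fix X :: "nat \<Rightarrow> ell2"
  assume C: "Cauchy X"
  have "Cauchy (\<lambda>m. ell2_nth (X m) n)" for n
  proof (rule metric_CauchyI)
    fix e :: real assume "e > 0"
    then obtain M where "\<And>i j. i \<ge> M \<Longrightarrow> j \<ge> M \<Longrightarrow> dist (X i) (X j) < e"
      using metric_CauchyD[OF C] by blast
    moreover have "dist (ell2_nth (X i) n) (ell2_nth (X j) n) \<le> dist (X i) (X j)" for i j
      using ell2_abs_nth_le_norm[of "X i - X j" n] by (simp add: dist_norm)
    ultimately show "\<exists>M. \<forall>i\<ge>M. \<forall>j\<ge>M. dist (ell2_nth (X i) n) (ell2_nth (X j) n) < e"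
      by (meson order_le_less_trans)
  qed
  hence "\<forall>n. \<exists>l. (\<lambda>m. ell2_nth (X m) n) \<longlonglongrightarrow> l"
    by (simp add: Cauchy_convergent_iff convergent_def)
  then obtain y where y: "\<And>n. (\<lambda>m. ell2_nth (X m) n) \<longlonglongrightarrow> y n"
    using choice by metis
  have tail: "\<exists>N. \<forall>i\<ge>N. \<forall>k. (\<Sum>n<k. (ell2_nth (X i) n - y n)\<^sup>2) \<le> e\<^sup>2" if e: "e > 0" for e :: real
  proof -
    obtain N where N: "\<And>i j. i \<ge> N \<Longrightarrow> j \<ge> N \<Longrightarrow> dist (X i) (X j) < e"
      using metric_CauchyD[OF C e] by blast
    have "(\<Sum>n<k. (ell2_nth (X i) n - y n)\<^sup>2) \<le> e\<^sup>2" if i: "i \<ge> N" for i k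
    proof (rule LIMSEQ_le_const2)
      show "(\<lambda>j. \<Sum>n<k. (ell2_nth (X i) n - ell2_nth (X j) n)\<^sup>2)
              \<longlonglongrightarrow> (\<Sum>n<k. (ell2_nth (X i) n - y n)\<^sup>2)"
        by (intro tendsto_sum tendsto_power tendsto_diff tendsto_const y)
      have "(\<Sum>n<k. (ell2_nth (X i) n - ell2_nth (X j) n)\<^sup>2) \<le> e\<^sup>2" if "j \<ge> N" for j
      proof -
        have "(\<Sum>n<k. (ell2_nth (X i) n - ell2_nth (X j) n)\<^sup>2) \<le> (norm (X i - X j))\<^sup>2"
          using ell2_sum_le_norm_sq[where x = "X i - X j" and k = k] by simp
        also have "\<dots> \<le> e\<^sup>2"
          using N[OF i that] by (intro power_mono) (auto simp: dist_norm)
        finally show ?thesis .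
      qed
      thus "\<exists>N. \<forall>j\<ge>N. (\<Sum>n<k. (ell2_nth (X i) n - ell2_nth (X j) n)\<^sup>2) \<le> e\<^sup>2" by blast
    qed
    thus ?thesis by blast
  qed
  have diff_summable: "summable (\<lambda>n. (ell2_nth (X i) n - y n)\<^sup>2)"
    if "\<forall>k. (\<Sum>n<k. (ell2_nth (X i) n - y n)\<^sup>2) \<le> e\<^sup>2" for i e
    using that by (intro summableI_nonneg_bounded[where x = "e\<^sup>2"]) auto
  obtain i0 where "\<forall>k. (\<Sum>n<k. (ell2_nth (X i0) n - y n)\<^sup>2) \<le> 1\<^sup>2"
    using tail[of 1] by auto
  from summable_sq_lincomb[OF ell2_summable_sq diff_summable[OF this], of 1 "X i0" "-1"]
  have ysum: "summable (\<lambda>n. (y n)\<^sup>2)" by simp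
  have "X \<longlonglongrightarrow> Abs_ell2 y"
  proof (rule metric_LIMSEQ_I)
    fix e :: real assume e: "e > 0"
    obtain N where N: "\<forall>i\<ge>N. \<forall>k. (\<Sum>n<k. (ell2_nth (X i) n - y n)\<^sup>2) \<le> (e/2)\<^sup>2"
      using tail[of "e/2"] e by auto
    have "dist (X i) (Abs_ell2 y) < e" if "i \<ge> N" for i
    proof -
      have "(norm (X i - Abs_ell2 y))\<^sup>2 \<le> (e/2)\<^sup>2"
        unfolding ell2_norm_sq using N that diff_summable[of i "e/2"]
        by (intro suminf_le_const) (auto simp: ell2_nth_Abs[OF ysum])
      hence "norm (X i - Abs_ell2 y) \<le> e/2"
        using e by (simp add: power2_le_iff_abs_le)
      thus ?thesis using e by (simp add: dist_norm)
    qed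
    thus "\<exists>N. \<forall>i\<ge>N. dist (X i) (Abs_ell2 y) < e" by blast
  qed
  thus "convergent X" by (auto simp: convergent_def)
qed

definition ell2_of_list :: "rat list \<Rightarrow> ell2" where
  "ell2_of_list r = Abs_ell2 (\<lambda>n. if n < length r then of_rat (r ! n) else 0)"

lemma ell2_dense:
  assumes "e > 0"
  shows "\<exists>r. dist x (ell2_of_list r) < e"
proof -
  have "(\<lambda>k. \<Sum>n<k. (ell2_nth x n)\<^sup>2) \<longlonglongrightarrow> (\<Sum>n. (ell2_nth x n)\<^sup>2)"
    by (rule summable_LIMSEQ[OF ell2_summable_sq])
  moreover have "(\<Sum>n. (ell2_nth x n)\<^sup>2) - (e/2)\<^sup>2 < (\<Sum>n. (ell2_nth x n)\<^sup>2)"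
    using assms by simp
  ultimately have "eventually (\<lambda>k. (\<Sum>n. (ell2_nth x n)\<^sup>2) - (e/2)\<^sup>2 < (\<Sum>n<k. (ell2_nth x n)\<^sup>2))
      sequentially"
    by (rule order_tendstoD(1))
  then obtain k where k: "(\<Sum>n. (ell2_nth x n)\<^sup>2) - (e/2)\<^sup>2 < (\<Sum>n<k. (ell2_nth x n)\<^sup>2)"
    by (auto simp: eventually_sequentially)
  define \<delta> where "\<delta> = e / (2 * (real k + 1))"
  have \<delta>: "\<delta> > 0" using assms by (simp add: \<delta>_def)
  have "\<exists>q::rat. \<bar>ell2_nth x n - of_rat q\<bar> < \<delta>" for n
  proof -
    obtain q where "ell2_nth x n < of_rat q" "of_rat q < ell2_nth x n + \<delta>"
      using of_rat_dense[of "ell2_nth x n" "ell2_nth x n + \<delta>"] \<delta> by auto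
    thus ?thesis by (intro exI[of _ q]) auto
  qed
  then obtain q where q: "\<And>n. \<bar>ell2_nth x n - of_rat (q n)\<bar> < \<delta>" by metis
  define r where "r = map q [0..<k]"
  define f where "f = (\<lambda>n. if n < length r then of_rat (r ! n) else (0::real))"
  have fsum: "summable (\<lambda>n. (f n)\<^sup>2)"
    by (rule summable_finite[of "{..<k}"]) (auto simp: f_def r_def)
  have nth: "ell2_nth (ell2_of_list r) = f"
    unfolding ell2_of_list_def f_def[symmetric] by (rule ell2_nth_Abs[OF fsum])
  have f: "f n = (if n < k then of_rat (q n) else 0)" for n by (simp add: f_def r_def)
  let ?d = "\<lambda>n. (ell2_nth x n - f n)\<^sup>2"
  have dsum: "summable ?d"
    using ell2_summable_sq[of "x - ell2_of_list r"] by (simp add: nth)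
  have "(norm (x - ell2_of_list r))\<^sup>2 = suminf ?d"
    by (simp add: ell2_norm_sq nth)
  also have "\<dots> = (\<Sum>n. ?d (n + k)) + (\<Sum>n<k. ?d n)"
    by (rule suminf_split_initial_segment[OF dsum])
  also have "(\<Sum>n. ?d (n + k)) = (\<Sum>n. (ell2_nth x (n + k))\<^sup>2)" by (simp add: f)
  also have "\<dots> = (\<Sum>n. (ell2_nth x n)\<^sup>2) - (\<Sum>n<k. (ell2_nth x n)\<^sup>2)"
    by (rule suminf_minus_initial_segment[OF ell2_summable_sq])
  also have "\<dots> + (\<Sum>n<k. ?d n) < (e/2)\<^sup>2 + (e/2)\<^sup>2"
  proof -
    have "(\<Sum>n<k. ?d n) \<le> (\<Sum>n<k. \<delta>\<^sup>2)"
    proof (rule sum_mono)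
      fix n assume "n \<in> {..<k}"
      thus "?d n \<le> \<delta>\<^sup>2"
        using q[of n] \<delta> by (auto simp: f abs_le_square_iff[symmetric])
    qed
    also have "\<dots> = real k * \<delta>\<^sup>2" by simp
    also have "\<dots> \<le> (real k + 1)\<^sup>2 * \<delta>\<^sup>2"
      by (intro mult_right_mono) (auto simp: power2_eq_square algebra_simps)
    also have "\<dots> = (e/2)\<^sup>2"
    proof -
      have "(real k + 1) * \<delta> = e / 2"
        unfolding \<delta>_def by (simp add: divide_simps)
      thus ?thesis by (metis power_mult_distrib)
    qed
    finally show ?thesis using k by linarith
  qed
  also have "\<dots> < e\<^sup>2" using assms by (simp add: power2_eq_square)
  finally have "norm (x - ell2_of_list r) < e"
    using assms by (simp add: power2_less_imp_less)
  thus ?thesis by (auto simp: dist_norm)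
qed

instance ell2 :: second_countable_topology
proof
  define B where "B = (\<lambda>(r, n). ball (ell2_of_list r) (1 / real (Suc n))) ` (UNIV :: (rat list \<times> nat) set)"
  have "topological_basis B"
  proof (rule topological_basisI)
    show "open b" if "b \<in> B" for b using that by (auto simp: B_def)
    fix U :: "ell2 set" and x assume "open U" "x \<in> U"
    then obtain e where e: "e > 0" "ball x e \<subseteq> U" by (auto simp: open_contains_ball)
    obtain n where n: "1 / real (Suc n) < e / 2"
      using nat_approx_posE[of "e/2"] e(1) by auto
    obtain r where r: "dist x (ell2_of_list r) < 1 / real (Suc n)"
      using ell2_dense[of "1 / real (Suc n)" x] by auto
    have "ball (ell2_of_list r) (1 / real (Suc n)) \<subseteq> ball x e"
    proof
      fix z assume "z \<in> ball (ell2_of_list r) (1 / real (Suc n))"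
      hence "dist (ell2_of_list r) z < 1 / real (Suc n)" by simp
      thus "z \<in> ball x e"
        using dist_triangle[of x z "ell2_of_list r"] r n unfolding mem_ball by linarith
    qed
    thus "\<exists>b\<in>B. x \<in> b \<and> b \<subseteq> U"
      using r e(2) by (intro bexI[of _ "ball (ell2_of_list r) (1 / real (Suc n))"])
        (auto simp: B_def dist_commute)
  qed
  moreover have "countable B" by (auto simp: B_def)
  ultimately show "\<exists>B :: ell2 set set. countable B \<and> open = generate_topology B"
    using topological_basis_imp_subbasis by blast
qed


subsection \<open>Compact Riemannian manifolds\<close>

primrec Ck_on :: "nat \<Rightarrow> 'a::euclidean_space set \<Rightarrow> ('a \<Rightarrow> 'b::real_normed_vector) \<Rightarrow> bool" where
  "Ck_on 0 S f \<longleftrightarrow> continuous_on S f"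
| "Ck_on (Suc k) S f \<longleftrightarrow>
     (\<exists>f'. (\<forall>x\<in>S. (f has_derivative f' x) (at x)) \<and> (\<forall>v. Ck_on k S (\<lambda>x. f' x v)))"

definition smooth_on :: "'a::euclidean_space set \<Rightarrow> ('a \<Rightarrow> 'b::real_normed_vector) \<Rightarrow> bool" where
  "smooth_on S f \<longleftrightarrow> (\<forall>k. Ck_on k S f)"

text \<open>
  A chart is a pair of its domain U and its coordinate map, the values of the latter outside U
  being irrelevant. The metric assigns to a chart and a point of its domain the Gram matrix of the
  coordinate basis of the tangent space. The dimension of the manifold is \<open>CARD('n)\<close>, which ranges
  over all integers \<open>\<ge> 1\<close>.
\<close>

type_synonym ('p, 'n) chart = "'p set \<times> ('p \<Rightarrow> real ^ 'n)"

record ('p, 'n::finite) riemannian =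
  man_top :: "'p topology"
  charts :: "('p, 'n) chart set"
  metric :: "('p, 'n) chart \<Rightarrow> 'p \<Rightarrow> real ^ 'n ^ 'n"

definition smooth_atlas :: "'p topology \<Rightarrow> ('p, 'n::finite) chart set \<Rightarrow> bool" where
  "smooth_atlas X \<A> \<longleftrightarrow>
     (\<Union>(U, \<phi>)\<in>\<A>. U) = topspace X \<and>
     (\<forall>(U, \<phi>)\<in>\<A>. openin X U \<and> open (\<phi> ` U) \<and>
        homeomorphic_map (subtopology X U) (top_of_set (\<phi> ` U)) \<phi>) \<and>
     (\<forall>(U, \<phi>)\<in>\<A>. \<forall>(V, \<psi>)\<in>\<A>. smooth_on (\<phi> ` (U \<inter> V)) (\<psi> \<circ> inv_into U \<phi>))"

definition riemannian_metric ::
  "('p, 'n::finite) chart set \<Rightarrow> (('p, 'n) chart \<Rightarrow> 'p \<Rightarrow> real ^ 'n ^ 'n) \<Rightarrow> bool" where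
  "riemannian_metric \<A> g \<longleftrightarrow>
     (\<forall>(U, \<phi>)\<in>\<A>. \<forall>p\<in>U. transpose (g (U, \<phi>) p) = g (U, \<phi>) p \<and>
        (\<forall>v. v \<noteq> 0 \<longrightarrow> v \<bullet> (g (U, \<phi>) p *v v) > 0)) \<and>
     (\<forall>(U, \<phi>)\<in>\<A>. \<forall>i j. smooth_on (\<phi> ` U) (\<lambda>x. g (U, \<phi>) (inv_into U \<phi> x) $ i $ j)) \<and>
     (\<forall>(U, \<phi>)\<in>\<A>. \<forall>(V, \<psi>)\<in>\<A>. \<forall>p\<in>U \<inter> V.
        (let J = jacobian (\<psi> \<circ> inv_into U \<phi>) (at (\<phi> p))
         in g (U, \<phi>) p = transpose J ** g (V, \<psi>) p ** J))"

text \<open>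
  Absence of boundary is built into the charts, whose images are open in \<open>real ^ 'n\<close>. Connectedness
  makes the geodesic distance finite.
\<close>

definition compact_riemannian_manifold :: "('p, 'n::finite) riemannian \<Rightarrow> bool" where
  "compact_riemannian_manifold \<Theta> \<longleftrightarrow>
     topspace (man_top \<Theta>) \<noteq> {} \<and> Hausdorff_space (man_top \<Theta>) \<and> second_countable (man_top \<Theta>) \<and>
     compact_space (man_top \<Theta>) \<and> connected_space (man_top \<Theta>) \<and>
     smooth_atlas (man_top \<Theta>) (charts \<Theta>) \<and> riemannian_metric (charts \<Theta>) (metric \<Theta>)"

definition piecewise_C1_curve :: "('p, 'n::finite) riemannian \<Rightarrow> (real \<Rightarrow> 'p) \<Rightarrow> bool" where
  "piecewise_C1_curve \<Theta> \<gamma> \<longleftrightarrow>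
     continuous_map (top_of_set {0..1}) (man_top \<Theta>) \<gamma> \<and>
     (\<forall>(U, \<phi>)\<in>charts \<Theta>. \<forall>a b. 0 \<le> a \<longrightarrow> a \<le> b \<longrightarrow> b \<le> 1 \<longrightarrow> \<gamma> ` {a..b} \<subseteq> U \<longrightarrow>
        (\<phi> \<circ> \<gamma>) piecewise_C1_differentiable_on {a..b})"

text \<open>The speed does not depend on the chart, by the compatibility condition on the metric.\<close>

definition speed :: "('p, 'n::finite) riemannian \<Rightarrow> (real \<Rightarrow> 'p) \<Rightarrow> real \<Rightarrow> real" where
  "speed \<Theta> \<gamma> t =
     (let c = (SOME c. c \<in> charts \<Theta> \<and> \<gamma> t \<in> fst c); v = vector_derivative (snd c \<circ> \<gamma>) (at t)
      in sqrt (v \<bullet> (metric \<Theta> c (\<gamma> t) *v v)))"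

definition curve_length :: "('p, 'n::finite) riemannian \<Rightarrow> (real \<Rightarrow> 'p) \<Rightarrow> ennreal" where
  "curve_length \<Theta> \<gamma> = (\<integral>\<^sup>+ t. ennreal (speed \<Theta> \<gamma> t) * indicator {0..1} t \<partial>lborel)"

definition geodesic_dist :: "('p, 'n::finite) riemannian \<Rightarrow> 'p \<Rightarrow> 'p \<Rightarrow> real" where
  "geodesic_dist \<Theta> x y =
     enn2real (INF \<gamma> \<in> {\<gamma>. piecewise_C1_curve \<Theta> \<gamma> \<and> \<gamma> 0 = x \<and> \<gamma> 1 = y}. curve_length \<Theta> \<gamma>)"

definition manifold_borel :: "('p, 'n::finite) riemannian \<Rightarrow> 'p measure" where
  "manifold_borel \<Theta> = sigma (topspace (man_top \<Theta>)) {U. openin (man_top \<Theta>) U}"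

definition is_volume_measure :: "('p, 'n::finite) riemannian \<Rightarrow> 'p measure \<Rightarrow> bool" where
  "is_volume_measure \<Theta> V \<longleftrightarrow>
     space V = topspace (man_top \<Theta>) \<and> sets V = sets (manifold_borel \<Theta>) \<and>
     (\<forall>(U, \<phi>)\<in>charts \<Theta>. \<forall>B\<in>sets (manifold_borel \<Theta>). B \<subseteq> U \<longrightarrow>
        emeasure V B =
          (\<integral>\<^sup>+ x. ennreal (sqrt (det (metric \<Theta> (U, \<phi>) (inv_into U \<phi> x)))) * indicator (\<phi> ` B) x
             \<partial>lborel))"

definition volume_measure :: "('p, 'n::finite) riemannian \<Rightarrow> 'p measure" where
  "volume_measure \<Theta> = (THE V. is_volume_measure \<Theta> V)"

definition tau :: "('p, 'n::finite) riemannian \<Rightarrow> 'p measure" where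
  "tau \<Theta> = uniform_measure (volume_measure \<Theta>) (space (volume_measure \<Theta>))"


subsection \<open>Finite signed measures\<close>

text \<open>
  A signed measure is a countably additive real-valued set function on the Borel sets; its values
  on other sets are irrelevant. Taking the constantly empty sequence shows that it vanishes
  on the empty set.
\<close>

definition signed_measures :: "('p, 'n::finite) riemannian \<Rightarrow> ('p set \<Rightarrow> real) set" where
  "signed_measures \<Theta> = {\<mu>. \<forall>A :: nat \<Rightarrow> 'p set. range A \<subseteq> sets (manifold_borel \<Theta>) \<longrightarrow>
     disjoint_family A \<longrightarrow> (\<lambda>i. \<mu> (A i)) sums \<mu> (\<Union>i. A i)}"

definition nonneg_measures :: "('p, 'n::finite) riemannian \<Rightarrow> ('p set \<Rightarrow> real) set" where
  "nonneg_measures \<Theta> = {\<mu> \<in> signed_measures \<Theta>. \<forall>A\<in>sets (manifold_borel \<Theta>). 0 \<le> \<mu> A}"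

definition prob_measures :: "('p, 'n::finite) riemannian \<Rightarrow> ('p set \<Rightarrow> real) set" where
  "prob_measures \<Theta> = {\<mu> \<in> nonneg_measures \<Theta>. \<mu> (topspace (man_top \<Theta>)) = 1}"

definition tv_norm :: "('p, 'n::finite) riemannian \<Rightarrow> ('p set \<Rightarrow> real) \<Rightarrow> ereal" where
  "tv_norm \<Theta> \<mu> =
     (SUP P \<in> {P. finite P \<and> partition_on (topspace (man_top \<Theta>)) P \<and> P \<subseteq> sets (manifold_borel \<Theta>)}.
        ereal (\<Sum>A\<in>P. \<bar>\<mu> A\<bar>))"

text \<open>
  The upper variation, i.e. the positive part of the Jordan decomposition; the negative part of
  \<open>\<mu>\<close> is the upper variation of \<open>- \<mu>\<close>. Negative values of \<open>\<mu> B\<close> are sent to 0 by \<open>ennreal\<close>, which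
  does not change the supremum because the empty set is among the sets B.
\<close>

definition upper_variation :: "('p, 'n::finite) riemannian \<Rightarrow> ('p set \<Rightarrow> real) \<Rightarrow> 'p measure" where
  "upper_variation \<Theta> \<mu> =
     measure_of (topspace (man_top \<Theta>)) (sets (manifold_borel \<Theta>))
       (\<lambda>A. SUP B \<in> {B \<in> sets (manifold_borel \<Theta>). B \<subseteq> A}. ennreal (\<mu> B))"

definition signed_integral ::
  "('p, 'n::finite) riemannian \<Rightarrow> ('p set \<Rightarrow> real) \<Rightarrow>
     ('p \<Rightarrow> 'h::{banach, second_countable_topology}) \<Rightarrow> 'h" where
  "signed_integral \<Theta> \<mu> f =
     integral\<^sup>L (upper_variation \<Theta> \<mu>) f - integral\<^sup>L (upper_variation \<Theta> (\<lambda>A. - \<mu> A)) f"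

definition density_measure :: "('p, 'n::finite) riemannian \<Rightarrow> ('p \<Rightarrow> real) \<Rightarrow> 'p set \<Rightarrow> real" where
  "density_measure \<Theta> f A = (LINT \<theta>:A|tau \<Theta>. f \<theta>)"


subsection \<open>Objective functions\<close>

definition convex_indicator :: "'a set \<Rightarrow> 'a \<Rightarrow> ereal" where
  "convex_indicator C x = (if x \<in> C then 0 else \<infinity>)"

definition basic_regularizers ::
  "('p, 'n::finite) riemannian \<Rightarrow> (('p set \<Rightarrow> real) \<Rightarrow> ereal) set" where
  "basic_regularizers \<Theta> =
     {convex_indicator (prob_measures \<Theta>), convex_indicator (nonneg_measures \<Theta>)} \<union>
     {\<lambda>\<mu>. ereal l * tv_norm \<Theta> \<mu> | l. 0 \<le> l} \<union>
     {convex_indicator {\<mu> \<in> signed_measures \<Theta>. ereal l * tv_norm \<Theta> \<mu> \<le> 1} | l. 0 \<le> l}"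

definition gradient :: "('h::real_inner \<Rightarrow> real) \<Rightarrow> 'h \<Rightarrow> 'h" where
  "gradient R x = (THE D. GDERIV R x :> D)"

definition assumption_A1 ::
  "('p, 'n::finite) riemannian \<Rightarrow> ('p \<Rightarrow> 'h::{real_inner, banach}) \<Rightarrow> ('h \<Rightarrow> real) \<Rightarrow>
     (('p set \<Rightarrow> real) \<Rightarrow> ereal) \<Rightarrow> bool" where
  "assumption_A1 \<Theta> \<Phi> R H \<longleftrightarrow>
     continuous_map (man_top \<Theta>) euclidean \<Phi> \<and>
     convex_on UNIV R \<and> (\<forall>x. \<exists>D. GDERIV R x :> D) \<and> (\<exists>L. L-lipschitz_on UNIV (gradient R)) \<and>
     (\<exists>hs. set hs \<subseteq> basic_regularizers \<Theta> \<and> H = (\<lambda>\<mu>. \<Sum>h\<leftarrow>hs. h \<mu>)) \<and>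
     (\<exists>\<mu>\<in>signed_measures \<Theta>. H \<mu> \<noteq> \<infinity>)"

definition smooth_part ::
  "('p, 'n::finite) riemannian \<Rightarrow> ('p \<Rightarrow> 'h::{real_inner, banach, second_countable_topology}) \<Rightarrow>
     ('h \<Rightarrow> real) \<Rightarrow> ('p set \<Rightarrow> real) \<Rightarrow> real" where
  "smooth_part \<Theta> \<Phi> R \<mu> = R (signed_integral \<Theta> \<mu> \<Phi>)"

definition smooth_part_diff ::
  "('p, 'n::finite) riemannian \<Rightarrow> ('p \<Rightarrow> 'h::{real_inner, banach, second_countable_topology}) \<Rightarrow>
     ('h \<Rightarrow> real) \<Rightarrow> ('p set \<Rightarrow> real) \<Rightarrow> 'p \<Rightarrow> real" where
  "smooth_part_diff \<Theta> \<Phi> R \<mu> \<theta> = gradient R (signed_integral \<Theta> \<mu> \<Phi>) \<bullet> \<Phi> \<theta>"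

definition objective ::
  "('p, 'n::finite) riemannian \<Rightarrow> ('p \<Rightarrow> 'h::{real_inner, banach, second_countable_topology}) \<Rightarrow>
     ('h \<Rightarrow> real) \<Rightarrow> (('p set \<Rightarrow> real) \<Rightarrow> ereal) \<Rightarrow> ('p set \<Rightarrow> real) \<Rightarrow> ereal" where
  "objective \<Theta> \<Phi> R H \<mu> = ereal (smooth_part \<Theta> \<Phi> R \<mu>) + H \<mu>"


subsection \<open>The four settings\<close>

datatype setting = Setting_I | Setting_I_star | Setting_II | Setting_II_star

primrec rate_exponent :: "setting \<Rightarrow> nat" where
  "rate_exponent Setting_I = 1"
| "rate_exponent Setting_I_star = 2"
| "rate_exponent Setting_II = 2"
| "rate_exponent Setting_II_star = 4"

definition lipschitz_map ::
  "('p, 'n::finite) riemannian \<Rightarrow> ('p \<Rightarrow> 'h::real_normed_vector) \<Rightarrow> bool" where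
  "lipschitz_map \<Theta> \<Phi> \<longleftrightarrow>
     (\<exists>L. \<forall>x\<in>topspace (man_top \<Theta>). \<forall>y\<in>topspace (man_top \<Theta>).
        norm (\<Phi> x - \<Phi> y) \<le> L * geodesic_dist \<Theta> x y)"

text \<open>
  Derivatives at different points of the manifold are compared in charts, where their Lipschitz
  continuity is required on compact subsets of the image: neither the charts nor their transition
  maps need have bounded distortion on their whole domain. As the manifold is compact, it is covered
  by finitely many such compact subsets.
\<close>

definition lipschitz_derivative ::
  "('p, 'n::finite) riemannian \<Rightarrow> ('p \<Rightarrow> 'h::real_normed_vector) \<Rightarrow> bool" where
  "lipschitz_derivative \<Theta> \<Phi> \<longleftrightarrow>
     (\<forall>(U, \<phi>)\<in>charts \<Theta>. \<exists>D :: real ^ 'n \<Rightarrow> (real ^ 'n) \<Rightarrow>\<^sub>L 'h.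
        (\<forall>x\<in>\<phi> ` U. ((\<Phi> \<circ> inv_into U \<phi>) has_derivative blinfun_apply (D x)) (at x)) \<and>
        (\<forall>K. compact K \<longrightarrow> K \<subseteq> \<phi> ` U \<longrightarrow> (\<exists>L. L-lipschitz_on K D)))"

definition setting_holds ::
  "setting \<Rightarrow> ('p, 'n::finite) riemannian \<Rightarrow>
     ('p \<Rightarrow> 'h::{real_inner, banach, second_countable_topology}) \<Rightarrow> ('h \<Rightarrow> real) \<Rightarrow>
     ('p set \<Rightarrow> real) \<Rightarrow> bool" where
  "setting_holds s \<Theta> \<Phi> R \<mu>s \<longleftrightarrow>
     (case s of
        Setting_I \<Rightarrow> lipschitz_map \<Theta> \<Phi>
      | Setting_I_star \<Rightarrow> lipschitz_map \<Theta> \<Phi> \<and>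
          (\<forall>\<theta>\<in>topspace (man_top \<Theta>). smooth_part_diff \<Theta> \<Phi> R \<mu>s \<theta> = 0)
      | Setting_II \<Rightarrow> lipschitz_derivative \<Theta> \<Phi>
      | Setting_II_star \<Rightarrow> lipschitz_derivative \<Theta> \<Phi> \<and>
          (\<forall>\<theta>\<in>topspace (man_top \<Theta>). smooth_part_diff \<Theta> \<Phi> R \<mu>s \<theta> = 0))"


subsection \<open>Distance-generating functions and divergences\<close>

definition eff_dom :: "(real \<Rightarrow> ereal) \<Rightarrow> real set" where
  "eff_dom \<eta> = {x. \<eta> x < \<infinity>}"

text \<open>Only meaningful in the interior of the effective domain.\<close>

definition eta_deriv :: "(real \<Rightarrow> ereal) \<Rightarrow> real \<Rightarrow> real" where
  "eta_deriv \<eta> = deriv (\<lambda>x. real_of_ereal (\<eta> x))"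

definition assumption_A2 :: "(real \<Rightarrow> ereal) \<Rightarrow> bool" where
  "assumption_A2 \<eta> \<longleftrightarrow>
     (\<forall>x. 0 \<le> \<eta> x) \<and>
     (\<forall>x\<in>eff_dom \<eta>. \<forall>y\<in>eff_dom \<eta>. \<forall>t. x \<noteq> y \<longrightarrow> 0 < t \<longrightarrow> t < 1 \<longrightarrow>
        \<eta> ((1 - t) * x + t * y) < ereal (1 - t) * \<eta> x + ereal t * \<eta> y) \<and>
     (\<forall>x. \<eta> x \<le> Liminf (at x) \<eta>) \<and>
     (\<forall>x\<in>interior (eff_dom \<eta>). (\<lambda>x. real_of_ereal (\<eta> x)) differentiable (at x)) \<and>
     continuous_on (interior (eff_dom \<eta>)) (eta_deriv \<eta>) \<and>
     eta_deriv \<eta> ` interior (eff_dom \<eta>) = UNIV \<and>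
     (\<forall>c>0. \<exists>C>0. eventually (\<lambda>x. \<eta> (c * x) \<le> ereal C * \<eta> x \<and> \<eta> x \<le> ereal C * \<eta> (c * x)) at_top) \<and>
     (eff_dom \<eta> = {0..} \<and> \<eta> 1 = 0 \<and> eta_deriv \<eta> 1 = 0 \<or>
      eff_dom \<eta> = UNIV \<and> (\<forall>x. \<eta> (- x) = \<eta> x) \<and> \<eta> 0 = 0 \<and> eta_deriv \<eta> 0 = 0)"

definition bregman :: "(real \<Rightarrow> ereal) \<Rightarrow> real \<Rightarrow> real \<Rightarrow> ereal" where
  "bregman \<eta> a b = \<eta> a - \<eta> b - ereal (eta_deriv \<eta> b * (a - b))"

definition bregman_int ::
  "('p, 'n::finite) riemannian \<Rightarrow> (real \<Rightarrow> ereal) \<Rightarrow> ('p \<Rightarrow> real) \<Rightarrow> ('p \<Rightarrow> real) \<Rightarrow> ennreal" where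
  "bregman_int \<Theta> \<eta> f g = (\<integral>\<^sup>+ \<theta>. e2ennreal (bregman \<eta> (f \<theta>) (g \<theta>)) \<partial>tau \<Theta>)"

definition admissible_init ::
  "('p, 'n::finite) riemannian \<Rightarrow> (real \<Rightarrow> ereal) \<Rightarrow> ('p \<Rightarrow> real) \<Rightarrow> bool" where
  "admissible_init \<Theta> \<eta> f0 \<longleftrightarrow>
     f0 \<in> borel_measurable (tau \<Theta>) \<and>
     (AE \<theta> in tau \<Theta>. f0 \<theta> \<in> interior (eff_dom \<eta>)) \<and>
     (\<exists>B. AE \<theta> in tau \<Theta>. \<bar>eta_deriv \<eta> (f0 \<theta>)\<bar> \<le> B)"

definition psi ::
  "('p, 'n::finite) riemannian \<Rightarrow> (('p set \<Rightarrow> real) \<Rightarrow> ereal) \<Rightarrow> (real \<Rightarrow> ereal) \<Rightarrow> ('p \<Rightarrow> real) \<Rightarrow>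
     real \<Rightarrow> ereal" where
  "psi \<Theta> Fbar \<eta> f0 \<alpha> =
     (INF f \<in> {f. integrable (tau \<Theta>) f}.
        Fbar (density_measure \<Theta> f) - (INF g \<in> {g. integrable (tau \<Theta>) g}. Fbar (density_measure \<Theta> g))
          + ereal \<alpha> * enn2ereal (bregman_int \<Theta> \<eta> f f0))"

text \<open>
  The points of the manifold in the final statement are elements of \<open>complex ^ 'n\<close>. This type
  only supplies the underlying set: topology, charts and metric are part of the record, and every
  connected manifold of dimension \<open>CARD('n)\<close> has the cardinality of the continuum, so that its
  structure can be transported to this type.
\<close>

end

theory Submission
  imports Defs
begin

text \<open>
  The manifold is the flat torus, embedded in \<open>complex ^ 'n\<close> and covered by the winding map, and
  \<open>\<mu>s\<close> is the Dirac mass at the point \<open>1\<close>. With \<open>\<delta> z = norm (z - 1)\<close>, the objective is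
  \<open>(\<integral> \<delta> ^ k d\<mu>) ^ m\<close> on probability measures and infinite elsewhere; the four settings are the four
  choices of \<open>k, m \<in> {1, 2}\<close>, because \<open>\<delta>\<close> is Lipschitz, \<open>\<delta>\<^sup>2\<close> is smooth and the square has
  vanishing derivative at the minimum, and \<open>q = k m\<close>. If a probability density \<open>f\<close> has objective
  value \<open>t ^ m\<close> and \<open>\<epsilon> ^ k = 2 t\<close>, then by Markov's inequality half of its mass sits where
  \<open>\<delta> < \<epsilon>\<close>, a set of measure at most \<open>(2 \<epsilon>) ^ d\<close>. Integrating the tangent of \<open>\<eta>\<close> at
  \<open>1 / (2 (2 \<epsilon>) ^ d)\<close> over that set bounds the divergence from below by a multiple of
  \<open>\<epsilon> ^ d \<eta> (\<epsilon> ^ (- d))\<close>, the bounded terms coming from \<open>f0\<close> being absorbed by the superlinear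
  growth of \<open>\<eta>\<close>.
\<close>

subsection \<open>The flat torus\<close>

text \<open>No integrable density attains the infimum, which belongs to a Dirac mass: a small
  objective value forces concentration, and concentration is paid for in divergence. The probability
  constraint makes the relevant densities nonnegative with mass 1, so that only values of
  \<open>\<eta>\<close> on the nonnegative half line are needed for them and both alternatives of
  \<open>assumption_A2\<close> are treated at once. The tangent argument works only for small
  \<open>\<epsilon>\<close>: the terms coming from \<open>f0\<close> are at most affine in the
  tangent point and are dominated once this point is large. For large \<open>\<epsilon>\<close> the
  divergence is discarded; \<open>\<epsilon> ^ q\<close> alone exceeds a multiple of the bracket at
  a fixed radius, uniformly in \<open>\<alpha> \<le> 1\<close>, whence the threshold 1 for
  \<open>\<alpha>\<close>. The factor \<open>2 * 2 ^ d\<close> lost in the argument of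
  \<open>\<eta>\<close> is recovered because \<open>\<eta> (c * x)\<close> is comparable to
  \<open>\<eta> x\<close>. On the geometric side, the volume and the speed of a curve are given by a
  description and by a choice of chart. Both have to be identified first, and both identifications
  rest on integer translations relating the lifts of a point under the winding map.\<close>

definition torus :: "(complex ^ 'n::finite) set" where
  "torus = {z. \<forall>i. norm (z $ i) = 1}"

definition wind :: "real ^ 'n::finite \<Rightarrow> complex ^ 'n" where
  "wind x = (\<chi> i. cis (2 * pi * x $ i))"

text \<open>Half side 1/4 keeps all angles within \<open>pi / 2\<close> of those of the centre. The
  image under \<open>wind\<close> is then cut out by the open condition \<open>0 < Re\<close> in
  \<open>patch\<close>, which stays away from the branch cut of the \<open>Arg\<close> used in
  \<open>coord\<close>.\<close>

definition cube :: "real ^ 'n::finite \<Rightarrow> (real ^ 'n) set" where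
  "cube a = {x. \<forall>i. \<bar>x $ i - a $ i\<bar> < 1 / 4}"

definition patch :: "real ^ 'n::finite \<Rightarrow> (complex ^ 'n) set" where
  "patch a = {z \<in> torus. \<forall>i. 0 < Re (z $ i * cis (- (2 * pi * a $ i)))}"

definition coord :: "real ^ 'n::finite \<Rightarrow> complex ^ 'n \<Rightarrow> real ^ 'n" where
  "coord a z = (\<chi> i. a $ i + Arg (z $ i * cis (- (2 * pi * a $ i))) / (2 * pi))"

text \<open>With the identity metric in the coordinates inverse to \<open>wind\<close>, each circle
  has length 1 instead of \<open>2 * pi\<close>. The volume is thus already a probability measure,
  and normalising it in \<open>tau\<close> changes nothing.\<close>

definition flat_torus :: "(complex ^ 'n::finite, 'n) riemannian" where
  "flat_torus = \<lparr>man_top = top_of_set torus, charts = range (\<lambda>a. (patch a, coord a)),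
     metric = (\<lambda>_ _. mat 1)\<rparr>"

lemma flat_torus_simps [simp]:
  "man_top flat_torus = top_of_set torus"
  "charts flat_torus = range (\<lambda>a. (patch a, coord a))"
  "metric flat_torus = (\<lambda>_ _. mat 1)"
  by (simp_all add: flat_torus_def)

lemma wind_in_torus [simp]: "wind x \<in> torus"
  by (simp add: wind_def torus_def)

lemma continuous_on_wind [continuous_intros]:
  "continuous_on S f \<Longrightarrow> continuous_on S (\<lambda>x. wind (f x))"
  unfolding wind_def cis_conv_exp by (intro continuous_intros) auto

lemma wind_eq_imp_Ints:
  assumes "wind x = wind y"
  shows "y $ i - x $ i \<in> \<int>"
proof -
  have "cis (2 * pi * x $ i) = cis (2 * pi * y $ i)"
    using assms by (simp add: wind_def vec_eq_iff)
  then have "sin (2 * pi * y $ i) = sin (2 * pi * x $ i) \<and> cos (2 * pi * y $ i) = cos (2 * pi * x $ i)"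
    by (simp add: complex_eq_iff)
  then obtain n :: int where "2 * pi * y $ i = 2 * pi * x $ i + 2 * pi * n"
    unfolding sin_cos_eq_iff by blast
  then have "2 * pi * (y $ i - x $ i) = 2 * pi * n"
    by (simp add: algebra_simps)
  then show ?thesis by simp
qed

lemma wind_add_Ints:
  assumes "\<And>i. k $ i \<in> \<int>"
  shows "wind (x + k) = wind x"
proof -
  have "cis (2 * pi * (x $ i + k $ i)) = cis (2 * pi * x $ i)" for i
  proof -
    have "cis (2 * pi * k $ i) = 1" using assms[of i] by (simp add: cis_multiple_2pi)
    then show ?thesis by (simp add: distrib_left flip: cis_mult)
  qed
  then show ?thesis by (simp add: wind_def)
qed

lemma cube_angle:
  assumes "x \<in> cube a"
  shows "\<bar>2 * pi * x $ i - 2 * pi * a $ i\<bar> < pi / 2"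
proof -
  have "\<bar>x $ i - a $ i\<bar> < 1 / 4" using assms by (simp add: cube_def)
  then have "2 * pi * \<bar>x $ i - a $ i\<bar> < 2 * pi * (1 / 4)"
    by (intro mult_strict_left_mono) auto
  moreover have "\<bar>2 * pi * x $ i - 2 * pi * a $ i\<bar> = 2 * pi * \<bar>x $ i - a $ i\<bar>"
    by (metis abs_mult abs_of_pos pi_gt_zero right_diff_distrib zero_less_mult_iff zero_less_numeral)
  ultimately show ?thesis by simp
qed

lemma wind_in_patch:
  assumes "x \<in> cube a"
  shows "wind x \<in> patch a"
proof -
  have "0 < cos (2 * pi * x $ i - 2 * pi * a $ i)" for i
    using cube_angle[OF assms, of i] by (intro cos_gt_zero_pi) linarith+
  then show ?thesis
    using wind_in_torus[of x] by (simp add: patch_def wind_def cis_mult flip: cos_diff)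
qed

lemma coord_wind:
  assumes "x \<in> cube a"
  shows "coord a (wind x) = x"
proof -
  have "Arg (cis (2 * pi * x $ i - 2 * pi * a $ i)) = 2 * pi * x $ i - 2 * pi * a $ i" for i
    using cube_angle[OF assms, of i] pi_gt_zero
    by (intro Arg_cis) (unfold greaterThanAtMost_iff, linarith)
  then show ?thesis
    by (simp add: vec_eq_iff coord_def wind_def cis_mult diff_divide_distrib)
qed

lemma coord_in_cube: "z \<in> patch a \<Longrightarrow> coord a z \<in> cube a"
proof -
  assume z: "z \<in> patch a"
  have "\<bar>Arg (z $ i * cis (- (2 * pi * a $ i)))\<bar> < pi / 2" for i
    using z by (subst Arg_Re_pos) (auto simp: patch_def)
  then have "\<bar>Arg (z $ i * cis (- (2 * pi * a $ i))) / (2 * pi)\<bar> < 1 / 4" for i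
    by (simp add: divide_simps mult.commute)
  then show ?thesis
    by (simp add: cube_def coord_def)
qed

lemma wind_coord: "z \<in> patch a \<Longrightarrow> wind (coord a z) = z"
proof -
  assume z: "z \<in> patch a"
  have "cis (2 * pi * coord a z $ i) = z $ i" for i
  proof -
    let ?w = "z $ i * cis (- (2 * pi * a $ i))"
    have n: "norm (z $ i) = 1" using z by (simp add: patch_def torus_def)
    then have n': "norm ?w = 1" by (simp add: norm_mult)
    then have "?w \<noteq> 0" by (metis norm_zero zero_neq_one)
    then have c: "cis (Arg ?w) = ?w"
      using n' by (simp add: cis_Arg sgn_eq)
    have "cis (2 * pi * coord a z $ i) = cis (2 * pi * a $ i) * cis (Arg ?w)"
      by (simp add: coord_def cis_mult distrib_left)
    also have "\<dots> = z $ i"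
      by (simp add: c mult.left_commute cis_mult)
    finally show ?thesis .
  qed
  then show ?thesis by (simp add: wind_def vec_eq_iff)
qed

lemma image_coord_patch: "coord a ` patch a = cube a"
proof
  show "cube a \<subseteq> coord a ` patch a"
    using wind_in_patch coord_wind by (metis image_eqI subsetI)
qed (use coord_in_cube in blast)

lemma inj_on_coord: "inj_on (coord a) (patch a)"
  by (metis wind_coord inj_onI)

lemma inv_into_coord: "x \<in> cube a \<Longrightarrow> inv_into (patch a) (coord a) x = wind x"
  using inv_into_f_f[OF inj_on_coord wind_in_patch, of x a] by (simp add: coord_wind)

lemma open_cube: "open (cube a)"
proof -
  have "cube a = box (a - (\<chi> i. 1/4)) (a + (\<chi> i. 1/4))"
  proof (rule set_eqI)
    fix x
    have "\<bar>x $ i - a $ i\<bar> < 1 / 4 \<longleftrightarrow> a $ i - 1 / 4 < x $ i \<and> x $ i < a $ i + 1 / 4" for i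
      by linarith
    then show "x \<in> cube a \<longleftrightarrow> x \<in> box (a - (\<chi> i. 1/4)) (a + (\<chi> i. 1/4))"
      by (simp add: cube_def mem_box_cart)
  qed
  then show ?thesis by (metis open_box)
qed

lemma center_in_cube [simp]: "a \<in> cube a"
  by (simp add: cube_def)

lemma continuous_on_coord: "continuous_on (patch a) (coord a)"
  unfolding coord_def
proof (intro continuous_intros)
  fix i z assume "z \<in> patch a"
  then have "0 < Re (z $ i * cis (- (2 * pi * a $ i)))" by (simp add: patch_def)
  then show "z $ i * cis (- (2 * pi * a $ i)) \<notin> \<real>\<^sub>\<le>\<^sub>0"
    using complex_nonpos_Reals_iff by force
qed auto

lemma openin_patch:
  fixes a :: "real ^ 'n::finite"
  shows "openin (top_of_set torus) (patch a)"
proof -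
  have "open {z :: complex ^ 'n. \<forall>i. 0 < Re (z $ i * cis (- (2 * pi * a $ i)))}"
    unfolding Collect_all_eq
    by (intro open_INT ballI finite_class.finite_UNIV open_Collect_less continuous_intros)
  moreover have "patch a = torus \<inter> {z. \<forall>i. 0 < Re (z $ i * cis (- (2 * pi * a $ i)))}"
    by (auto simp: patch_def)
  ultimately show ?thesis by (auto simp: openin_open)
qed

lemma torus_eq_wind: "torus = range wind"
proof
  show "torus \<subseteq> range wind"
  proof
    fix z :: "complex ^ 'n" assume "z \<in> torus"
    then have n: "norm (z $ i) = 1" for i by (simp add: torus_def)
    then have nz: "z $ i \<noteq> 0" for i by (metis norm_zero zero_neq_one)
    have "wind (\<chi> i. Arg (z $ i) / (2 * pi)) = z"
      using n nz by (simp add: wind_def vec_eq_iff cis_Arg sgn_eq)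
    then show "z \<in> range wind" by (metis rangeI)
  qed
qed auto

lemma patch_subset_torus: "patch a \<subseteq> torus"
  by (auto simp: patch_def)

lemma Union_patch: "(\<Union>a. patch a) = torus"
proof
  show "torus \<subseteq> (\<Union>a. patch a)"
    unfolding torus_eq_wind using wind_in_patch[OF center_in_cube] by auto
qed (use patch_subset_torus in blast)

lemma homeomorphic_map_coord:
  "homeomorphic_map (top_of_set (patch a)) (top_of_set (cube a)) (coord a)"
proof -
  have "homeomorphic_maps (top_of_set (patch a)) (top_of_set (cube a)) (coord a) wind"
    unfolding homeomorphic_maps_def
    using continuous_on_coord[of a] coord_in_cube[of _ a] wind_in_patch[of _ a] coord_wind[of _ a]
      wind_coord[of _ a]
    by (simp add: continuous_on_wind image_subset_iff Pi_iff)
  then show ?thesis unfolding homeomorphic_map_maps by blast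
qed

text \<open>Since the charts are cubes of side 1/2, differences of coordinates in two charts are integers
  confined to an interval of length less than 1 around a fixed one; so each transition map is a
  single translation.\<close>

lemma transition_translation:
  assumes "x \<in> cube a" "wind x \<in> patch b" "y \<in> cube a" "wind y \<in> patch b"
  shows "coord b (wind x) - x = coord b (wind y) - y"
proof -
  have "coord b (wind x) $ i - x $ i = coord b (wind y) $ i - y $ i" for i
  proof -
    define m where "m = (coord b (wind x) $ i - x $ i) - (coord b (wind y) $ i - y $ i)"
    have "m \<in> \<int>" unfolding m_def
      using assms by (intro Ints_diff wind_eq_imp_Ints) (simp_all add: wind_coord)
    moreover have "\<bar>m\<bar> < 1"
    proof -
      have "\<bar>x $ i - a $ i\<bar> < 1/4" "\<bar>y $ i - a $ i\<bar> < 1/4"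
        using assms by (simp_all add: cube_def)
      moreover have "\<bar>coord b (wind x) $ i - b $ i\<bar> < 1/4" "\<bar>coord b (wind y) $ i - b $ i\<bar> < 1/4"
        using coord_in_cube[OF assms(2)] coord_in_cube[OF assms(4)] by (simp_all add: cube_def)
      ultimately show ?thesis unfolding m_def by linarith
    qed
    ultimately have "m = 0" by (metis Ints_nonzero_abs_less1)
    then show ?thesis by (simp add: m_def)
  qed
  then show ?thesis by (simp add: vec_eq_iff)
qed

lemma coord_Int_patch: "coord a ` (patch a \<inter> patch b) = {x \<in> cube a. wind x \<in> patch b}"
proof
  show "coord a ` (patch a \<inter> patch b) \<subseteq> {x \<in> cube a. wind x \<in> patch b}"
    by (auto simp: coord_in_cube wind_coord)
  show "{x \<in> cube a. wind x \<in> patch b} \<subseteq> coord a ` (patch a \<inter> patch b)"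
  proof
    fix x assume "x \<in> {x \<in> cube a. wind x \<in> patch b}"
    then have "x = coord a (wind x)" "wind x \<in> patch a \<inter> patch b"
      by (simp_all add: coord_wind wind_in_patch)
    then show "x \<in> coord a ` (patch a \<inter> patch b)" by (rule image_eqI)
  qed
qed

lemma open_overlap: "open {x \<in> cube a. wind x \<in> patch b}"
proof -
  obtain T where T: "open T" "patch b = torus \<inter> T"
    using openin_patch[of b] by (auto simp: openin_open)
  have "{x \<in> cube a. wind x \<in> patch b} = cube a \<inter> wind -` T"
    by (auto simp: T(2))
  moreover have "open (wind -` T)"
    by (rule open_vimage[OF T(1)]) (intro continuous_intros)
  ultimately show ?thesis using open_cube by auto
qed

lemma transition_eq:
  assumes "y \<in> cube a" "wind y \<in> patch b" "x \<in> coord a ` (patch a \<inter> patch b)"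
  shows "(coord b \<circ> inv_into (patch a) (coord a)) x = x + (coord b (wind y) - y)"
proof -
  have x: "x \<in> cube a" "wind x \<in> patch b" using assms(3) by (auto simp: coord_Int_patch)
  have "coord b (wind x) = x + (coord b (wind y) - y)"
    unfolding transition_translation[OF x assms(1,2), symmetric] by simp
  then show ?thesis using x(1) by (simp add: inv_into_coord)
qed

section \<open>Smoothness of the atlas and the manifold axioms\<close>

lemma Ck_on_const: "Ck_on k S (\<lambda>_. c)"
proof (induction k arbitrary: c)
  case (Suc k)
  show ?case unfolding Ck_on.simps
    by (rule exI[of _ "\<lambda>_ _. 0"]) (use Suc in auto)
qed auto

lemma smooth_on_const: "smooth_on S (\<lambda>_. c)"
  by (simp add: smooth_on_def Ck_on_const)

lemma has_derivative_transition:
  assumes "x \<in> cube a" "wind x \<in> patch b"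
  shows "((coord b \<circ> inv_into (patch a) (coord a)) has_derivative (\<lambda>v. v)) (at x)"
proof (rule has_derivative_transform_within_open)
  show "((\<lambda>y. y + (coord b (wind x) - x)) has_derivative (\<lambda>v. v)) (at x)"
    by (auto intro!: derivative_eq_intros)
  show "open (coord a ` (patch a \<inter> patch b))" by (simp add: coord_Int_patch open_overlap)
  show "x \<in> coord a ` (patch a \<inter> patch b)" using assms by (simp add: coord_Int_patch)
qed (rule transition_eq[OF assms, symmetric])

lemma smooth_on_transition:
  "smooth_on (coord a ` (patch a \<inter> patch b)) (coord b \<circ> inv_into (patch a) (coord a))"
proof -
  have "Ck_on k (coord a ` (patch a \<inter> patch b)) (coord b \<circ> inv_into (patch a) (coord a))" for k
  proof (cases k)
    case 0
    have "continuous (at x) (coord b \<circ> inv_into (patch a) (coord a))"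
      if "x \<in> coord a ` (patch a \<inter> patch b)" for x
      using that has_derivative_transition[of x a b] has_derivative_continuous by (auto simp: coord_Int_patch)
    then show ?thesis unfolding 0 Ck_on.simps by (intro continuous_at_imp_continuous_on) blast
  next
    \<comment> \<open>One derivative suffices: it is the constant identity, so the higher levels are
      instances of \<open>Ck_on_const\<close>.\<close>
    case (Suc j)
    then show ?thesis using has_derivative_transition[of _ a b]
      by (auto intro!: exI[of _ "\<lambda>_ v. v"] Ck_on_const simp: coord_Int_patch)
  qed
  then show ?thesis by (simp add: smooth_on_def)
qed

text \<open>This makes the constant metric \<open>mat 1\<close> compatible across all pairs of
  charts.\<close>

lemma jacobian_transition:
  assumes "p \<in> patch a \<inter> patch b"
  shows "jacobian (coord b \<circ> inv_into (patch a) (coord a)) (at (coord a p)) = mat 1"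
proof -
  have "coord a p \<in> cube a" "wind (coord a p) \<in> patch b"
    using assms by (auto simp: coord_in_cube wind_coord)
  from frechet_derivative_at[OF has_derivative_transition[OF this]] show ?thesis
  proof -
    assume "(\<lambda>v. v) = frechet_derivative (coord b \<circ> inv_into (patch a) (coord a)) (at (coord a p))"
    from this[symmetric] show ?thesis
      unfolding jacobian_def by (simp only:) (simp add: matrix_def mat_def axis_def vec_eq_iff)
  qed
qed

lemma compact_torus: "compact (torus :: (complex ^ 'n::finite) set)"
proof -
  have "closed (torus :: (complex ^ 'n) set)"
    unfolding torus_def by (intro closed_Collect_all closed_Collect_eq continuous_intros)
  moreover have "norm z \<le> CARD('n)" if "z \<in> torus" for z :: "complex ^ 'n"
  proof -
    have "norm z \<le> (\<Sum>i\<in>UNIV. norm (z $ i))"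
      unfolding norm_vec_def by (rule L2_set_le_sum) simp
    then show ?thesis using that by (simp add: torus_def)
  qed
  ultimately show ?thesis
    unfolding compact_eq_bounded_closed bounded_iff by blast
qed

lemma compact_riemannian_flat_torus:
  "compact_riemannian_manifold (flat_torus :: (complex ^ 'n::finite, 'n) riemannian)"
  unfolding compact_riemannian_manifold_def
proof (intro conjI)
  show "topspace (man_top (flat_torus :: (complex ^ 'n, 'n) riemannian)) \<noteq> {}"
    unfolding flat_torus_simps topspace_euclidean_subtopology using wind_in_torus by blast
  show "Hausdorff_space (man_top (flat_torus :: (complex ^ 'n, 'n) riemannian))"
    by (simp add: Hausdorff_space_subtopology Hausdorff_space_euclidean)
  have "second_countable (euclidean :: (complex ^ 'n) topology)"
  proof -
    obtain \<B> :: "(complex ^ 'n) set set" where "countable \<B>" "\<And>C. C \<in> \<B> \<Longrightarrow> open C"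
       "\<And>S. open S \<Longrightarrow> \<exists>U. U \<subseteq> \<B> \<and> S = \<Union>U"
      by (rule univ_second_countable) blast
    then show ?thesis unfolding second_countable_def
      by (intro exI[of _ \<B>]) (simp, blast)
  qed
  then show "second_countable (man_top (flat_torus :: (complex ^ 'n, 'n) riemannian))"
    by (simp add: second_countable_subtopology)
  show "compact_space (man_top (flat_torus :: (complex ^ 'n, 'n) riemannian))"
    using compact_torus compactin_euclidean_iff compact_space_subtopology by fastforce
  have "connected (torus :: (complex ^ 'n) set)"
    unfolding torus_eq_wind by (intro connected_continuous_image continuous_intros) auto
  then show "connected_space (man_top (flat_torus :: (complex ^ 'n, 'n) riemannian))"
    by (simp add: connected_space_subtopology)
  show "smooth_atlas (man_top (flat_torus :: (complex ^ 'n, 'n) riemannian)) (charts flat_torus)"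
  proof -
    have sub: "subtopology (top_of_set torus) (patch a) = top_of_set (patch a)" for a :: "real ^ 'n"
      by (simp add: subtopology_subtopology Int_absorb1 patch_subset_torus)
    show ?thesis
      unfolding smooth_atlas_def flat_torus_simps
      by (simp add: Union_patch openin_patch open_cube image_coord_patch sub homeomorphic_map_coord
            smooth_on_transition)
  qed
  show "riemannian_metric (charts (flat_torus :: (complex ^ 'n, 'n) riemannian)) (metric flat_torus)"
    unfolding riemannian_metric_def flat_torus_simps
    by (simp add: smooth_on_const jacobian_transition Let_def transpose_mat)
qed

subsection \<open>Volume\<close>

text \<open>Half open, so that every point of the torus has exactly one preimage under
  \<open>wind\<close> in it.\<close>

definition unit_cell :: "(real ^ 'n::finite) set" where
  "unit_cell = {x. \<forall>i. 0 \<le> x $ i \<and> x $ i < 1}"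

text \<open>An explicit candidate for the volume: as \<open>volume_measure\<close> is a definite
  description, it is determined by showing that this measure satisfies the description and that no
  other one does.\<close>

definition torus_measure :: "(complex ^ 'n::finite) measure" where
  "torus_measure = distr (restrict_space lborel unit_cell) (manifold_borel flat_torus) wind"

lemma space_manifold_borel [simp]:
  "space (manifold_borel flat_torus) = (torus :: (complex ^ 'n::finite) set)"
proof -
  have "{U. openin (top_of_set torus) U} \<subseteq> Pow (torus :: (complex ^ 'n) set)"
    using openin_imp_subset by auto
  then show ?thesis unfolding manifold_borel_def flat_torus_simps topspace_euclidean_subtopology
    by (rule space_measure_of)
qed

lemma openin_in_sets:
  assumes "openin (top_of_set torus) U"
  shows "U \<in> sets (manifold_borel flat_torus)"
proof -
  have "{U. openin (top_of_set torus) U} \<subseteq> Pow torus"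
    using openin_imp_subset by auto
  then show ?thesis
    unfolding manifold_borel_def using assms by (auto intro: sigma_sets.Basic)
qed

lemma patch_in_sets [simp]: "patch a \<in> sets (manifold_borel flat_torus)"
  by (simp add: openin_in_sets openin_patch)

lemma borel_measurable_continuous_on_torus:
  fixes f :: "complex ^ 'n::finite \<Rightarrow> 'b::topological_space"
  assumes "continuous_on torus f"
  shows "f \<in> borel_measurable (manifold_borel flat_torus)"
proof (rule borel_measurableI)
  fix S :: "'b set" assume "open S"
  then have "openin (top_of_set torus) (torus \<inter> f -` S)"
    using assms continuous_on_open_gen continuous_openin_preimage_gen by blast
  then show "f -` S \<inter> space (manifold_borel flat_torus) \<in> sets (manifold_borel flat_torus)"
    by (simp add: openin_in_sets Int_commute)
qed

lemma measurable_wind [measurable]: "wind \<in> borel \<rightarrow>\<^sub>M manifold_borel flat_torus"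
  unfolding manifold_borel_def
proof (rule measurable_measure_of)
  show "{U. openin (man_top flat_torus) U} \<subseteq> Pow (topspace (man_top flat_torus))"
    using openin_subset by blast
  fix U :: "(complex ^ 'n) set" assume "U \<in> {U. openin (man_top flat_torus) U}"
  then obtain T where T: "open T" "U = torus \<inter> T"
    by (auto simp: openin_open)
  have "open (wind -` T)"
    by (rule open_vimage[OF T(1)]) (intro continuous_intros)
  moreover have "wind -` U = wind -` T" by (auto simp: T(2))
  ultimately show "wind -` U \<inter> space borel \<in> sets borel" by simp
qed (simp add: Pi_iff)

text \<open>Images of Borel sets are not measurable for free; rewriting the image under a chart as a
  preimage under the measurable map \<open>wind\<close> settles this.\<close>

lemma coord_image_eq: "B \<subseteq> patch a \<Longrightarrow> coord a ` B = cube a \<inter> wind -` B"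
proof
  show "cube a \<inter> wind -` B \<subseteq> coord a ` B"
    using coord_wind by (metis IntD1 IntD2 image_eqI subsetI vimage_eq)
  show "coord a ` B \<subseteq> cube a \<inter> wind -` B" if "B \<subseteq> patch a"
  proof (rule image_subsetI)
    fix z assume "z \<in> B"
    then show "coord a z \<in> cube a \<inter> wind -` B"
      using that coord_in_cube[of z a] wind_coord[of z a] by auto
  qed
qed

lemma coord_image_in_sets:
  assumes "B \<in> sets (manifold_borel flat_torus)" "B \<subseteq> patch a"
  shows "coord a ` B \<in> sets borel"
proof -
  have "wind -` B \<inter> space borel \<in> sets borel"
    using assms(1) by (rule measurable_sets[OF measurable_wind])
  then show ?thesis
    using borel_open[OF open_cube[of a]] by (simp add: coord_image_eq[OF assms(2)] sets.Int)
qed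

lemma unit_cell_in_sets [measurable]: "unit_cell \<in> sets borel"
  unfolding unit_cell_def by measurable

lemma emeasure_torus_measure:
  assumes "B \<in> sets (manifold_borel flat_torus)"
  shows "emeasure torus_measure B = emeasure lborel (unit_cell \<inter> wind -` B)"
proof -
  have "wind \<in> restrict_space lborel unit_cell \<rightarrow>\<^sub>M manifold_borel flat_torus"
    by (intro measurable_restrict_space1) (use measurable_wind in simp)
  then have "emeasure torus_measure B =
      emeasure (restrict_space lborel unit_cell) (wind -` B \<inter> space (restrict_space lborel unit_cell))"
    unfolding torus_measure_def using assms by (rule emeasure_distr)
  also have "\<dots> = emeasure lborel (wind -` B \<inter> unit_cell)"
    by (subst emeasure_restrict_space) (simp_all add: space_restrict_space)
  also have "wind -` B \<inter> unit_cell = unit_cell \<inter> wind -` B" by (rule Int_commute)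
  finally show ?thesis .
qed

text \<open>The half-open cell is squeezed between the open and the closed unit box, which have
  equal volume.\<close>

lemma emeasure_unit_cell: "emeasure lborel (unit_cell :: (real ^ 'n::finite) set) = 1"
proof (rule antisym)
  have "measure lborel (cbox 0 (1 :: real ^ 'n)) = 1"
    by (subst content_cbox_cart) (auto simp: interval_eq_empty_cart)
  then have c: "emeasure lborel (cbox 0 (1 :: real ^ 'n)) = 1"
    using emeasure_lborel_cbox_finite[of 0 "1 :: real ^ 'n"]
    by (simp add: emeasure_eq_ennreal_measure less_top)
  then have b: "emeasure lborel (box 0 (1 :: real ^ 'n)) = 1"
    by (simp only: emeasure_lborel_cbox_eq emeasure_lborel_box_eq)
  have "unit_cell \<subseteq> cbox 0 (1 :: real ^ 'n)"
    by (auto simp: unit_cell_def mem_box_cart order.strict_iff_order)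
  then show "emeasure lborel (unit_cell :: (real ^ 'n) set) \<le> 1"
    using emeasure_mono[of unit_cell "cbox 0 (1 :: real ^ 'n)" lborel] by (simp only: c) simp
  have "box 0 (1 :: real ^ 'n) \<subseteq> unit_cell"
    by (auto simp: unit_cell_def mem_box_cart order.strict_iff_order)
  then show "1 \<le> emeasure lborel (unit_cell :: (real ^ 'n) set)"
    using emeasure_mono[of "box 0 (1 :: real ^ 'n)" unit_cell lborel] by (simp only: b) simp
qed

lemma emeasure_lborel_translate:
  fixes A :: "(real ^ 'n::finite) set"
  assumes "A \<in> sets borel"
  shows "emeasure lborel {y. c + y \<in> A} = emeasure lborel A"
proof -
  have "emeasure lborel A = emeasure (distr lborel borel ((+) c)) A"
    by (simp add: lborel_distr_plus)
  also have "\<dots> = emeasure lborel ((+) c -` A \<inter> space lborel)"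
    using assms by (intro emeasure_distr) auto
  finally show ?thesis by (simp add: vimage_def)
qed

text \<open>Cutting \<open>S\<close> along the integer lattice and translating the pieces into the unit cell gives
  exactly the points of the unit cell that wind onto the image of \<open>S\<close>.\<close>

lemma emeasure_unit_cell_wind:
  fixes S :: "(real ^ 'n::finite) set"
  assumes S: "S \<in> sets borel" and inj: "inj_on wind S"
  shows "emeasure lborel (unit_cell \<inter> wind -` wind ` S) = emeasure lborel S"
proof -
  define K :: "int ^ 'n \<Rightarrow> real ^ 'n" where "K k = (\<chi> i. of_int (k $ i))" for k
  define P where "P k = {x \<in> S. \<forall>i. \<lfloor>x $ i\<rfloor> = k $ i}" for k
  define T where "T k = {y. K k + y \<in> P k}" for k
  have P [measurable]: "P k \<in> sets borel" for k
  proof -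
    have "P k = S \<inter> {x. \<forall>i. of_int (k $ i) \<le> x $ i \<and> x $ i < of_int (k $ i) + 1}"
      by (simp add: P_def floor_eq_iff Int_def)
    also have "\<dots> \<in> sets borel"
      by (rule sets.Int[OF S]) measurable
    finally show ?thesis .
  qed
  have T [measurable]: "T k \<in> sets borel" for k
  proof -
    have "T k = (+) (K k) -` P k \<inter> space borel" by (auto simp: T_def)
    also have "\<dots> \<in> sets borel" by measurable
    finally show ?thesis .
  qed
  have KInts: "K k $ i \<in> \<int>" for k i by (simp add: K_def)
  have wK: "wind (K k + y) = wind y" for k y
    using wind_add_Ints[of "K k" y] KInts by (simp add: add.commute)
  have S_eq: "S = (\<Union>k. P k)"
  proof
    show "S \<subseteq> (\<Union>k. P k)"
    proof
      fix x assume "x \<in> S"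
      then have "x \<in> P (\<chi> i. \<lfloor>x $ i\<rfloor>)" by (simp add: P_def)
      then show "x \<in> (\<Union>k. P k)" by blast
    qed
  qed (auto simp: P_def)
  have T_eq: "unit_cell \<inter> wind -` wind ` S = (\<Union>k. T k)"
  proof
    show "(\<Union>k. T k) \<subseteq> unit_cell \<inter> wind -` wind ` S"
    proof
      fix y assume "y \<in> (\<Union>k. T k)"
      then obtain k where k: "K k + y \<in> S" "\<And>i. \<lfloor>(K k + y) $ i\<rfloor> = k $ i"
        by (auto simp: T_def P_def)
      have "\<lfloor>y $ i\<rfloor> = 0" for i using k(2)[of i] by (simp add: K_def)
      then have "y \<in> unit_cell" by (simp add: unit_cell_def floor_eq_iff)
      moreover have "wind y \<in> wind ` S" using k(1) wK[of k y] by (metis imageI)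
      ultimately show "y \<in> unit_cell \<inter> wind -` wind ` S" by blast
    qed
    show "unit_cell \<inter> wind -` wind ` S \<subseteq> (\<Union>k. T k)"
    proof
      fix y assume "y \<in> unit_cell \<inter> wind -` wind ` S"
      then obtain x where y: "y \<in> unit_cell" and x: "x \<in> S" "wind y = wind x" by auto
      define k :: "int ^ 'n" where "k = (\<chi> i. \<lfloor>x $ i - y $ i\<rfloor>)"
      \<comment> \<open>The difference of two lifts of one point is an integer, so the floor in
        \<open>k\<close> loses nothing.\<close>
      have "K k $ i = x $ i - y $ i" for i
        using wind_eq_imp_Ints[OF x(2), of i] by (simp add: K_def k_def)
      then have xK: "x = K k + y" by (simp add: vec_eq_iff)
      have "\<lfloor>x $ i\<rfloor> = k $ i" for i
      proof -
        have "\<lfloor>y $ i\<rfloor> = 0" using y by (simp add: unit_cell_def floor_eq_iff)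
        then show ?thesis by (simp add: xK K_def)
      qed
      then have "y \<in> T k" using x(1) unfolding T_def P_def by (simp only: mem_Collect_eq flip: xK) simp
      then show "y \<in> (\<Union>k. T k)" by blast
    qed
  qed
  have disjP: "disjoint_family P"
  proof -
    have "k = l" if "x \<in> P k" "x \<in> P l" for k l x
      using that by (simp add: P_def vec_eq_iff)
    then show ?thesis unfolding disjoint_family_on_def by blast
  qed
  have disjT: "disjoint_family T"
  proof -
    \<comment> \<open>Two pieces overlapping after translation would give two points of
      \<open>S\<close> with the same image; this is where injectivity enters.\<close>
    have "k = l" if "y \<in> T k" "y \<in> T l" for k l y
    proof -
      have "K k + y = K l + y"
        using that wK[of k y] wK[of l y] by (intro inj_onD[OF inj]) (simp_all add: T_def P_def)
      then show ?thesis by (simp add: K_def vec_eq_iff)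
    qed
    then show ?thesis unfolding disjoint_family_on_def by blast
  qed
  have "emeasure lborel (unit_cell \<inter> wind -` wind ` S) = (\<integral>\<^sup>+k. emeasure lborel (T k) \<partial>count_space UNIV)"
    unfolding T_eq by (rule emeasure_UN_countable) (auto simp: disjT)
  also have "\<dots> = (\<integral>\<^sup>+k. emeasure lborel (P k) \<partial>count_space UNIV)"
    unfolding T_def by (simp add: emeasure_lborel_translate)
  also have "\<dots> = emeasure lborel (\<Union>k. P k)"
    by (rule emeasure_UN_countable[symmetric]) (auto simp: disjP)
  finally show ?thesis unfolding S_eq[symmetric] .
qed

lemma emeasure_torus_measure_patch:
  assumes B: "B \<in> sets (manifold_borel flat_torus)" "B \<subseteq> patch a"
  shows "emeasure torus_measure B = emeasure lborel (coord a ` B)"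
proof -
  have wB: "wind ` coord a ` B = B"
    using B(2) wind_coord[of _ a] by (force simp: image_image)
  have "inj_on wind (coord a ` B)"
    using B(2) wind_coord[of _ a] by (auto simp: inj_on_def subset_iff)
  from emeasure_unit_cell_wind[OF coord_image_in_sets[OF B] this] show ?thesis
    by (simp add: emeasure_torus_measure[OF B(1)] wB)
qed

section \<open>Identification of the volume measure\<close>

lemma is_volume_measure_flat_torus_iff:
  fixes V :: "(complex ^ 'n::finite) measure"
  shows "is_volume_measure flat_torus V \<longleftrightarrow>
     space V = torus \<and> sets V = sets (manifold_borel flat_torus) \<and>
     (\<forall>a. \<forall>B\<in>sets (manifold_borel flat_torus). B \<subseteq> patch a \<longrightarrow>
        emeasure V B = emeasure lborel (coord a ` B))"
proof -
  have "(\<integral>\<^sup>+ x. ennreal (sqrt (det (mat 1 :: real ^ 'n ^ 'n))) * indicator (coord a ` B) x \<partial>lborel)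
      = emeasure lborel (coord a ` B)"
    if "B \<in> sets (manifold_borel flat_torus)" "B \<subseteq> patch a" for a :: "real ^ 'n" and B
    using coord_image_in_sets[OF that] by simp
  then show ?thesis unfolding is_volume_measure_def flat_torus_simps by simp
qed

text \<open>Centres in the lattice of mesh 1/4 suffice, since rounding down moves each coordinate by
  strictly less than 1/4. Countability is what allows a measure known inside patches to be recovered
  by countable additivity.\<close>

lemma countable_patch_cover: "\<exists>c :: nat \<Rightarrow> real ^ 'n::finite. (\<Union>m. patch (c m)) = torus"
proof -
  define c :: "nat \<Rightarrow> real ^ 'n" where "c m = (\<chi> i. of_int ((from_nat m :: int ^ 'n) $ i) / 4)" for m
  have "z \<in> (\<Union>m. patch (c m))" if "z \<in> torus" for z
  proof -
    obtain x where x: "z = wind x" using \<open>z \<in> torus\<close> torus_eq_wind by auto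
    define k :: "int ^ 'n" where "k = (\<chi> i. \<lfloor>4 * x $ i\<rfloor>)"
    have "\<bar>x $ i - of_int (k $ i) / 4\<bar> < 1 / 4" for i
    proof -
      have "\<bar>4 * x $ i - of_int (k $ i)\<bar> < 1"
        using floor_correct[of "4 * x $ i"] unfolding k_def vec_lambda_beta by linarith
      then show ?thesis by linarith
    qed
    then have "x \<in> cube (c (to_nat k))" by (simp add: cube_def c_def)
    then show ?thesis using wind_in_patch x by blast
  qed
  then show ?thesis using patch_subset_torus by (intro exI[of _ c]) blast
qed

text \<open>The description prescribes the measure only of sets contained in one patch. Making a
  countable cover disjoint splits any Borel set into such pieces.\<close>

lemma is_volume_measure_unique:
  fixes V W :: "(complex ^ 'n::finite) measure"
  assumes V: "is_volume_measure flat_torus V" and W: "is_volume_measure flat_torus W"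
  shows "V = W"
proof (rule measure_eqI)
  have sV: "sets V = sets (manifold_borel flat_torus)"
    and sW: "sets W = sets (manifold_borel flat_torus)"
    using V W by (simp_all add: is_volume_measure_flat_torus_iff)
  then show "sets V = sets W" by simp
  obtain c :: "nat \<Rightarrow> real ^ 'n" where c: "(\<Union>m. patch (c m)) = torus"
    using countable_patch_cover by blast
  define D where "D = disjointed (\<lambda>m. patch (c m))"
  have D: "D m \<in> sets (manifold_borel flat_torus)" for m
  proof -
    have "range D \<subseteq> sets (manifold_borel flat_torus)"
      unfolding D_def by (rule sets.range_disjointed_sets) auto
    then show ?thesis by blast
  qed
  fix B assume "B \<in> sets V"
  then have B: "B \<in> sets (manifold_borel flat_torus)" by (simp add: sV)
  then have "B \<subseteq> torus" using sets.sets_into_space by fastforce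
  then have B_eq: "B = (\<Union>m. B \<inter> D m)"
    using c UN_disjointed_eq[of "\<lambda>m. patch (c m)"] by (auto simp: D_def)
  have disj: "disjoint_family (\<lambda>m. B \<inter> D m)"
    using disjoint_family_disjointed[of "\<lambda>m. patch (c m)"]
    by (auto simp: D_def disjoint_family_on_def)
  have eq: "emeasure V (B \<inter> D m) = emeasure W (B \<inter> D m)" for m
  proof -
    have "B \<inter> D m \<subseteq> patch (c m)" using disjointed_subset[of "\<lambda>m. patch (c m)" m] by (auto simp: D_def)
    moreover have "B \<inter> D m \<in> sets (manifold_borel flat_torus)" using B D by blast
    ultimately show ?thesis
      using V W unfolding is_volume_measure_flat_torus_iff by presburger
  qed
  have "emeasure V B = (\<Sum>m. emeasure V (B \<inter> D m))"
    using suminf_emeasure[OF _ disj, of V] B D arg_cong[OF B_eq, of "emeasure V"]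
    by (simp add: sV image_subset_iff)
  also have "\<dots> = (\<Sum>m. emeasure W (B \<inter> D m))" by (simp add: eq)
  also have "\<dots> = emeasure W B"
    using suminf_emeasure[OF _ disj, of W] B D arg_cong[OF B_eq, of "emeasure W"]
    by (simp add: sW image_subset_iff)
  finally show "emeasure V B = emeasure W B" .
qed

lemma volume_measure_flat_torus: "volume_measure flat_torus = torus_measure"
proof -
  have "is_volume_measure flat_torus torus_measure"
    unfolding is_volume_measure_flat_torus_iff
    by (simp add: emeasure_torus_measure_patch) (simp add: torus_measure_def)
  then show ?thesis
    unfolding volume_measure_def using is_volume_measure_unique by (intro the_equality) auto
qed

lemma space_torus_measure [simp]: "space torus_measure = torus"
  and sets_torus_measure [simp, measurable_cong]: "sets torus_measure = sets (manifold_borel flat_torus)"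
  by (simp_all add: torus_measure_def)

lemma torus_in_sets [simp]: "torus \<in> sets (manifold_borel flat_torus)"
  by (simp add: openin_in_sets)

lemma emeasure_torus: "emeasure torus_measure (torus :: (complex ^ 'n::finite) set) = 1"
proof -
  have "unit_cell \<inter> wind -` (torus :: (complex ^ 'n) set) = unit_cell" by auto
  then show ?thesis by (simp add: emeasure_torus_measure emeasure_unit_cell)
qed

lemma tau_flat_torus: "tau flat_torus = (torus_measure :: (complex ^ 'n::finite) measure)"
proof -
  have "emeasure torus_measure (torus \<inter> A) = emeasure torus_measure A"
    if "A \<in> sets torus_measure" for A :: "(complex ^ 'n) set"
    using sets.sets_into_space[OF that] by (simp add: Int_absorb1)
  then show ?thesis
    unfolding tau_def volume_measure_flat_torus
    by (intro measure_eqI) (simp_all add: emeasure_torus divide_ennreal_def)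
qed

section \<open>Measure of small balls around 1\<close>

lemma norm_minus_one_ball_in_sets:
  "{z \<in> torus. norm (z - 1) < s} \<in> sets (manifold_borel flat_torus)"
proof -
  have "open {z :: complex ^ 'n. norm (z - 1) < s}"
    by (intro open_Collect_less continuous_intros)
  then have "openin (top_of_set torus) {z \<in> torus. norm (z - 1) < s}"
    by (auto simp: openin_open)
  then show ?thesis by (rule openin_in_sets)
qed

text \<open>For \<open>s \<ge> 1 / 2\<close> the right-hand side is at least the total mass 1. For
  smaller \<open>s\<close> the ball lies in one patch, and its coordinates are small because
  \<open>Arg\<close> is the imaginary part of \<open>Ln\<close>, which is at most
  \<open>2 * norm (w - 1)\<close> in norm near 1.\<close>

lemma emeasure_ball_le:
  assumes "0 < s"
  shows "emeasure torus_measure {z :: complex ^ 'n::finite \<in> torus. norm (z - 1) < s}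
    \<le> ennreal ((2 * s) ^ CARD('n))"
proof (cases "s < 1 / 2")
  case False
  let ?B = "{z :: complex ^ 'n \<in> torus. norm (z - 1) < s}"
  have "emeasure torus_measure ?B \<le> emeasure torus_measure (torus :: (complex ^ 'n) set)"
    using emeasure_space[of torus_measure ?B] by simp
  also have "\<dots> = ennreal 1" by (simp add: emeasure_torus)
  also have "\<dots> \<le> ennreal ((2 * s) ^ CARD('n))"
    using False by (intro ennreal_leI one_le_power) simp
  finally show ?thesis .
next
  case True
  let ?B = "{z :: complex ^ 'n \<in> torus. norm (z - 1) < s}"
  have near: "norm (z $ i - 1) < s" if "z \<in> ?B" for z i
    using that Finite_Cartesian_Product.norm_nth_le[of "z - 1" i] by simp
  have "?B \<subseteq> patch 0"
  proof
    fix z assume z: "z \<in> ?B"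
    have "0 < Re (z $ i)" for i
      using near[OF z, of i] abs_Re_le_cmod[of "z $ i - 1"] True by simp
    then show "z \<in> patch 0" using z by (simp add: patch_def)
  qed
  then have "emeasure torus_measure ?B = emeasure lborel (coord 0 ` ?B)"
    by (rule emeasure_torus_measure_patch[OF norm_minus_one_ball_in_sets])
  also have "\<dots> \<le> emeasure lborel (cbox (\<chi> i. - s) (\<chi> i. s) :: (real ^ 'n) set)"
  proof (rule emeasure_mono)
    show "coord 0 ` ?B \<subseteq> cbox (\<chi> i. - s) (\<chi> i. s)"
    proof (rule image_subsetI)
      fix z assume z: "z \<in> ?B"
      have "\<bar>coord 0 z $ i\<bar> \<le> s" for i
      proof -
        have n: "norm (z $ i - 1) < s" by (rule near[OF z])
        then have "z $ i \<noteq> 0" using True by auto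
        then have "\<bar>Arg (z $ i)\<bar> \<le> norm (Ln (1 + (z $ i - 1)))"
          by (simp add: Arg_eq_Im_Ln abs_Im_le_cmod)
        also have "\<dots> \<le> 2 * norm (z $ i - 1)"
          using n True by (intro norm_Ln_le) simp
        finally have "\<bar>Arg (z $ i)\<bar> \<le> 2 * s" using n by simp
        \<comment> \<open>Deliberately coarse: constants in the measure of the ball are later
          absorbed by rescaling the argument of \<open>\<eta>\<close>.\<close>
        also have "\<dots> \<le> s * (2 * pi)"
          using assms pi_ge_two by simp
        finally have "\<bar>Arg (z $ i)\<bar> / (2 * pi) \<le> s"
          by (simp add: divide_le_eq)
        then show ?thesis by (simp add: coord_def)
      qed
      then show "coord 0 z \<in> cbox (\<chi> i. - s) (\<chi> i. s)"
        by (simp add: mem_box_cart abs_le_iff minus_le_iff)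
    qed
  qed simp
  also have "\<dots> = ennreal ((2 * s) ^ CARD('n))"
  proof -
    have "measure lborel (cbox (\<chi> i. - s) (\<chi> i. s) :: (real ^ 'n) set) = (2 * s) ^ CARD('n)"
      using assms by (subst content_cbox_cart) (auto simp: interval_eq_empty_cart)
    then show ?thesis by (metis emeasure_lborel_cbox_finite emeasure_eq_ennreal_measure less_irrefl infinity_ennreal_def)
  qed
  finally show ?thesis .
qed

text \<open>Needed to normalise the uniform densities on balls that approximate the Dirac mass. In
  coordinates the ball contains a nonempty open set.\<close>

lemma emeasure_ball_pos:
  assumes "0 < s"
  shows "0 < emeasure torus_measure {z :: complex ^ 'n::finite \<in> torus. norm (z - 1) < s}"
proof -
  let ?B = "{z :: complex ^ 'n \<in> torus. norm (z - 1) < s}"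
  let ?O = "{x :: real ^ 'n. norm (wind x - 1) < s} \<inter> cube 0"
  have inter: "?B \<inter> patch 0 \<in> sets (manifold_borel flat_torus)"
    by (intro sets.Int norm_minus_one_ball_in_sets patch_in_sets)
  have "?O \<subseteq> coord 0 ` (?B \<inter> patch 0)"
  proof
    fix x assume x: "x \<in> ?O"
    then have "wind x \<in> ?B \<inter> patch 0" by (simp add: wind_in_patch)
    moreover have "x = coord 0 (wind x)" using x by (simp add: coord_wind)
    ultimately show "x \<in> coord 0 ` (?B \<inter> patch 0)" by (rule rev_image_eqI)
  qed
  then have "emeasure lborel ?O \<le> emeasure lborel (coord 0 ` (?B \<inter> patch 0))"
    using coord_image_in_sets[OF inter, of 0] by (intro emeasure_mono) simp_all
  also have "\<dots> = emeasure torus_measure (?B \<inter> patch 0)"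
    by (rule emeasure_torus_measure_patch[OF inter, symmetric]) simp
  also have "\<dots> \<le> emeasure torus_measure ?B"
    using norm_minus_one_ball_in_sets by (intro emeasure_mono) auto
  finally have le: "emeasure lborel ?O \<le> emeasure torus_measure ?B" .
  have "open ?O"
    by (intro open_Int open_cube open_Collect_less continuous_intros)
  moreover have "wind (0 :: real ^ 'n) = 1" by (simp add: wind_def vec_eq_iff)
  then have "0 \<in> ?O" using assms by simp
  ultimately have "\<not> negligible ?O" "?O \<in> sets lborel"
    using open_not_negligible[of ?O] by (blast, simp)
  then have "emeasure lborel ?O \<noteq> 0"
    using null_sets_completionI[OF null_setsI[of lborel ?O]] by (auto simp: negligible_iff_null_sets)
  then show ?thesis using le by (auto simp: zero_less_iff_neq_zero)
qed

subsection \<open>Geodesic distance\<close>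

definition wind_deriv :: "real ^ 'n::finite \<Rightarrow> real ^ 'n \<Rightarrow> complex ^ 'n" where
  "wind_deriv x h = (\<chi> i. (2 * pi * h $ i) *\<^sub>R (\<i> * cis (2 * pi * x $ i)))"

text \<open>Allows a vector-valued map to be differentiated componentwise, as a finite sum of
  \<open>axis i\<close> terms.\<close>

lemma bounded_linear_axis: "bounded_linear (axis i :: 'a::real_normed_vector \<Rightarrow> 'a ^ 'n::finite)"
proof (rule bounded_linear_intro[where K = 1])
  show "norm (axis i x :: 'a ^ 'n) \<le> norm x * 1" for x :: 'a
  proof -
    have "norm (axis i x :: 'a ^ 'n) \<le> (\<Sum>j\<in>UNIV. norm (axis i x $ j))"
      unfolding norm_vec_def by (rule L2_set_le_sum) simp
    also have "\<dots> = (\<Sum>j\<in>UNIV. if j = i then norm x else 0)"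
      by (intro sum.cong) (auto simp: axis_def)
    finally show ?thesis by simp
  qed
qed (simp_all add: axis_def vec_eq_iff)

lemma has_derivative_wind:
  fixes x :: "real ^ 'n::finite"
  shows "(wind has_derivative wind_deriv x) (at x)"
proof -
  have lin: "bounded_linear (\<lambda>y :: real ^ 'n. y $ i)" for i :: 'n
    by (rule bounded_linear_vec_nth)
  have "((\<lambda>y. \<Sum>i\<in>UNIV. axis i (cis (2 * pi * y $ i)) :: complex ^ 'n) has_derivative
      (\<lambda>h. \<Sum>i\<in>UNIV. axis i ((2 * pi * h $ i) *\<^sub>R (\<i> * cis (2 * pi * x $ i))))) (at x)"
    by (intro has_derivative_sum bounded_linear.has_derivative[OF bounded_linear_axis]
        has_derivative_cis has_derivative_mult_right bounded_linear_imp_has_derivative lin)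
  moreover have "(\<Sum>i\<in>UNIV. axis i (v i)) = (\<chi> i. v i)" for v :: "'n \<Rightarrow> complex"
    by (simp add: vec_eq_iff axis_def if_distrib cong: if_cong)
  moreover have "wind = (\<lambda>y :: real ^ 'n. \<chi> i. cis (2 * pi * y $ i))" by (simp add: fun_eq_iff wind_def)
  ultimately show ?thesis by (simp add: wind_deriv_def[abs_def])
qed

text \<open>The winding map scales lengths by the constant \<open>2 * pi\<close>, the source of this
  factor in all comparisons of chords with lengths.\<close>

lemma norm_wind_deriv: "norm (wind_deriv x h) = 2 * pi * norm h"
proof -
  have "norm (wind_deriv x h) = L2_set (\<lambda>i. 2 * pi * norm (h $ i)) UNIV"
    by (simp add: norm_vec_def wind_deriv_def norm_mult abs_mult)
  also have "\<dots> = 2 * pi * norm h"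
    unfolding norm_vec_def by (rule L2_set_right_distrib[symmetric]) simp
  finally show ?thesis .
qed

lemma coord_diff_eq:
  assumes "z \<in> patch a" "z \<in> patch b" "w \<in> patch a" "w \<in> patch b"
  shows "coord b z - coord a z = coord b w - coord a w"
  using transition_translation[of "coord a z" a b "coord a w"] assms
  by (simp add: coord_in_cube wind_coord)

text \<open>A patch is open only relative to the torus, and curves are functions on the whole line
  that are controlled only on the unit interval; hence the last hypothesis.\<close>

lemma eventually_in_patch:
  assumes "isCont \<gamma> t" "\<gamma> t \<in> patch a" "\<forall>\<^sub>F u in nhds t. \<gamma> u \<in> torus"
  shows "\<forall>\<^sub>F u in nhds t. \<gamma> u \<in> patch a"
proof -
  obtain T where T: "open T" "patch a = torus \<inter> T"
    using openin_patch[of a] by (auto simp: openin_open)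
  have "\<forall>\<^sub>F u in nhds t. \<gamma> u \<in> T"
    using assms(1,2) T by (auto simp: continuous_at_imp_continuous_within isCont_def
        tendsto_at_iff_tendsto_nhds intro: topological_tendstoD)
  with assms(3) show ?thesis by eventually_elim (simp add: T(2))
qed

text \<open>The chart in \<open>speed\<close> is picked by \<open>SOME\<close>. Since any two charts
  differ by a constant translation near the point, the derivative may be computed in whichever chart
  is at hand.\<close>

lemma speed_eq:
  fixes \<gamma> :: "real \<Rightarrow> complex ^ 'n::finite"
  assumes cont: "isCont \<gamma> t" and a: "\<gamma> t \<in> patch a" and ev: "\<forall>\<^sub>F u in nhds t. \<gamma> u \<in> torus"
    and d: "((coord a \<circ> \<gamma>) has_vector_derivative v) (at t)"
  shows "speed flat_torus \<gamma> t = norm v"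
proof -
  define c where "c = (SOME c. c \<in> charts (flat_torus :: (complex ^ 'n, 'n) riemannian) \<and> \<gamma> t \<in> fst c)"
  have "\<exists>c. c \<in> charts (flat_torus :: (complex ^ 'n, 'n) riemannian) \<and> \<gamma> t \<in> fst c"
    using a by (intro exI[of _ "(patch a, coord a)"]) simp
  then have "c \<in> charts flat_torus \<and> \<gamma> t \<in> fst c"
    unfolding c_def by (rule someI_ex)
  then obtain b where c: "c = (patch b, coord b)" and b: "\<gamma> t \<in> patch b"
    by auto
  have "((\<lambda>u. (coord a \<circ> \<gamma>) u + (coord b (\<gamma> t) - coord a (\<gamma> t))) has_vector_derivative v) (at t)"
    using has_vector_derivative_add[OF d has_vector_derivative_const] by simp
  moreover have "\<forall>\<^sub>F u in nhds t. (coord a \<circ> \<gamma>) u + (coord b (\<gamma> t) - coord a (\<gamma> t)) = (coord b \<circ> \<gamma>) u"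
    using eventually_in_patch[OF cont a ev] eventually_in_patch[OF cont b ev]
  proof eventually_elim
    case (elim u)
    then show ?case using coord_diff_eq[of "\<gamma> t" a b "\<gamma> u"] a b by simp
  qed
  ultimately have "((coord b \<circ> \<gamma>) has_vector_derivative v) (at t)"
    unfolding has_vector_derivative_def
    using has_derivative_transform_eventually[of _ _ t UNIV "coord b \<circ> \<gamma>"]
    by (simp add: eventually_nhds_conv_at o_def)
  then show ?thesis
    unfolding speed_def c_def[symmetric] Let_def
    by (simp add: c vector_derivative_at norm_eq_sqrt_inner)
qed

lemma has_vector_derivative_torus_curve:
  fixes \<gamma> :: "real \<Rightarrow> complex ^ 'n::finite"
  assumes cont: "isCont \<gamma> t" and a: "\<gamma> t \<in> patch a" and ev: "\<forall>\<^sub>F u in nhds t. \<gamma> u \<in> torus"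
    and d: "((coord a \<circ> \<gamma>) has_vector_derivative v) (at t)"
  shows "(\<gamma> has_vector_derivative wind_deriv (coord a (\<gamma> t)) v) (at t)"
proof -
  have "((wind \<circ> (coord a \<circ> \<gamma>)) has_vector_derivative wind_deriv (coord a (\<gamma> t)) v) (at t)"
    using vector_derivative_diff_chain_within[OF d has_derivative_at_withinI[OF has_derivative_wind]]
    by simp
  moreover have "\<forall>\<^sub>F u in nhds t. (wind \<circ> (coord a \<circ> \<gamma>)) u = \<gamma> u"
    using eventually_in_patch[OF cont a ev] by eventually_elim (simp add: wind_coord)
  ultimately show ?thesis
    unfolding has_vector_derivative_def
    using has_derivative_transform_eventually[of _ _ t UNIV \<gamma>] a
    by (simp add: eventually_nhds_conv_at wind_coord)
qed

section \<open>Chords and lengths of curves\<close>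

lemma norm_has_integral_le_nn_integral:
  fixes W :: "real \<Rightarrow> 'a::euclidean_space"
  assumes "(W has_integral I) {s..t}"
  shows "ennreal (norm I) \<le> (\<integral>\<^sup>+ x. ennreal (norm (W x)) * indicator {s..t} x \<partial>lebesgue)"
proof (cases "(\<integral>\<^sup>+ x. ennreal (norm (W x)) * indicator {s..t} x \<partial>lebesgue) < \<infinity>")
  \<comment> \<open>A gauge integrable function need not be absolutely integrable. If the right-hand
    side is infinite there is nothing to show; if it is finite, both integrals exist and
    agree.\<close>
  case True
  have m: "W \<in> borel_measurable (lebesgue_on {s..t})"
    using assms integrable_imp_measurable by blast
  have eq: "(\<integral>\<^sup>+ x. ennreal (norm (W x)) \<partial>lebesgue_on {s..t})
      = (\<integral>\<^sup>+ x. ennreal (norm (W x)) * indicator {s..t} x \<partial>lebesgue)"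
    by (rule nn_integral_restrict_space) simp
  then have i: "integrable (lebesgue_on {s..t}) W"
    using m True by (intro integrableI_bounded) simp_all
  then have "integral\<^sup>L (lebesgue_on {s..t}) W = I"
    using assms lebesgue_integral_eq_integral[OF i] by (simp add: integral_unique)
  then have "ennreal (norm I) \<le> (\<integral>\<^sup>+ x. ennreal (norm (W x)) \<partial>lebesgue_on {s..t})"
    using integral_norm_bound_ennreal[OF i] by simp
  then show ?thesis by (simp add: eq)
qed (simp add: not_less top_unique)

text \<open>Over the completed measure, since gauge integrability yields Lebesgue measurability.
  Completion does not change the integral, so \<open>curve_length\<close> is recovered at the
  end.\<close>

definition arc_length :: "(real \<Rightarrow> complex ^ 'n::finite) \<Rightarrow> real \<Rightarrow> real \<Rightarrow> ennreal" where
  "arc_length \<gamma> a b = (\<integral>\<^sup>+ t. ennreal (speed flat_torus \<gamma> t) * indicator {a..b} t \<partial>lebesgue)"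

lemma speed_nonneg: "0 \<le> speed flat_torus \<gamma> t"
  by (simp add: speed_def Let_def)

text \<open>In one patch the curve is \<open>wind\<close> after a coordinate curve, so the
  fundamental theorem of calculus in the ambient space bounds the chord. Measurability is part of
  the conclusion because pieces are to be added later and \<open>speed\<close> involves arbitrary
  choices of charts.\<close>

lemma chord_le_length_in_patch:
  fixes \<gamma> :: "real \<Rightarrow> complex ^ 'n::finite"
  assumes \<gamma>: "piecewise_C1_curve flat_torus \<gamma>" and st: "0 \<le> s" "s \<le> t" "t \<le> 1"
    and a: "\<gamma> ` {s..t} \<subseteq> patch a"
  shows "(\<lambda>x. ennreal (speed flat_torus \<gamma> x) * indicator {s..t} x) \<in> borel_measurable lebesgue"
    and "ennreal (norm (\<gamma> t - \<gamma> s)) \<le> ennreal (2 * pi) * arc_length \<gamma> s t"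
proof -
  have c01: "continuous_on {0..1} \<gamma>" and tor: "\<And>u. u \<in> {0..1} \<Longrightarrow> \<gamma> u \<in> torus"
    using \<gamma> by (auto simp: piecewise_C1_curve_def)
  have "(coord a \<circ> \<gamma>) piecewise_C1_differentiable_on {s..t}"
    using \<gamma> st a by (auto simp: piecewise_C1_curve_def)
  then obtain S where S: "finite S" "(coord a \<circ> \<gamma>) C1_differentiable_on ({s..t} - S)"
    by (auto simp: piecewise_C1_differentiable_on_def)
  then obtain D where D: "\<And>x. x \<in> {s..t} - S \<Longrightarrow> ((coord a \<circ> \<gamma>) has_vector_derivative D x) (at x)"
    unfolding C1_differentiable_on_def by blast
  obtain e :: "complex ^ 'n" where e: "norm e = 1"
    by (rule vector_choose_size[of 1]) simp_all
  \<comment> \<open>At the finitely many exceptional points, and outside the open interval, the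
    speed is not under control; there \<open>W\<close> is an arbitrary vector of the right length.
    Thus \<open>norm (W x)\<close> is \<open>2 * pi\<close> times the speed everywhere, and
    measurability passes from \<open>W\<close> to the speed.\<close>
  define W where "W x = (if x \<in> {s<..<t} - S then wind_deriv (coord a (\<gamma> x)) (D x)
      else (2 * pi * speed flat_torus \<gamma> x) *\<^sub>R e)" for x
  have interior: "isCont \<gamma> x" "\<forall>\<^sub>F u in nhds x. \<gamma> u \<in> torus" if "x \<in> {s<..<t}" for x
  proof -
    have x: "x \<in> {0<..<1}" using that st by auto
    have "continuous_on {0<..<1} \<gamma>" by (rule continuous_on_subset[OF c01]) auto
    then show "isCont \<gamma> x" using x by (simp add: continuous_on_eq_continuous_at)
    have "\<forall>\<^sub>F u in nhds x. u \<in> {0<..<1}"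
      by (rule eventually_nhds_in_open) (use x in auto)
    then show "\<forall>\<^sub>F u in nhds x. \<gamma> u \<in> torus"
      by eventually_elim (use tor in auto)
  qed
  have nW: "norm (W x) = 2 * pi * speed flat_torus \<gamma> x" for x
  proof (cases "x \<in> {s<..<t} - S")
    case True
    then have "\<gamma> x \<in> patch a" "((coord a \<circ> \<gamma>) has_vector_derivative D x) (at x)"
      using a D by auto
    then have "speed flat_torus \<gamma> x = norm (D x)"
      using True interior by (intro speed_eq) auto
    then show ?thesis using True by (simp add: W_def norm_wind_deriv)
  qed (auto simp: W_def e speed_nonneg abs_mult)
  have int: "(W has_integral (\<gamma> t - \<gamma> s)) {s..t}"
  proof (rule fundamental_theorem_of_calculus_interior_strong[OF S(1) st(2)])
    show "continuous_on {s..t} \<gamma>"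
      by (rule continuous_on_subset[OF c01]) (use st in auto)
    fix x assume x: "x \<in> {s<..<t} - S"
    then have "\<gamma> x \<in> patch a" "((coord a \<circ> \<gamma>) has_vector_derivative D x) (at x)"
      using a D by auto
    then have "(\<gamma> has_vector_derivative wind_deriv (coord a (\<gamma> x)) (D x)) (at x)"
      using interior x by (intro has_vector_derivative_torus_curve) auto
    then show "(\<gamma> has_vector_derivative W x) (at x)" using x by (simp add: W_def)
  qed
  have "W \<in> borel_measurable (lebesgue_on {s..t})"
    using int integrable_imp_measurable by blast
  then have "(\<lambda>x. norm (W x) / (2 * pi)) \<in> borel_measurable (lebesgue_on {s..t})"
    by measurable
  then have "speed flat_torus \<gamma> \<in> borel_measurable (lebesgue_on {s..t})"
    by (simp add: nW)
  then have "(\<lambda>x. ennreal (speed flat_torus \<gamma> x)) \<in> borel_measurable (lebesgue_on {s..t})"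
    by measurable
  then show "(\<lambda>x. ennreal (speed flat_torus \<gamma> x) * indicator {s..t} x) \<in> borel_measurable lebesgue"
    by (subst (asm) borel_measurable_restrict_space_iff_ennreal) simp_all
  have "ennreal (norm (\<gamma> t - \<gamma> s)) \<le> (\<integral>\<^sup>+ x. ennreal (norm (W x)) * indicator {s..t} x \<partial>lebesgue)"
    by (rule norm_has_integral_le_nn_integral[OF int])
  also have "\<dots> = (\<integral>\<^sup>+ x. ennreal (2 * pi) * (ennreal (speed flat_torus \<gamma> x) * indicator {s..t} x) \<partial>lebesgue)"
    by (simp add: nW ennreal_mult speed_nonneg mult.assoc)
  also have "\<dots> = ennreal (2 * pi) * arc_length \<gamma> s t"
    unfolding arc_length_def by (rule nn_integral_cmult) fact
  finally show "ennreal (norm (\<gamma> t - \<gamma> s)) \<le> ennreal (2 * pi) * arc_length \<gamma> s t" .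
qed

text \<open>A bisection argument replaces the choice of a partition: the claim passes from two
  adjacent intervals to their union, and by continuity short intervals around any point are mapped
  into a single patch.\<close>

lemma chord_le_length:
  fixes \<gamma> :: "real \<Rightarrow> complex ^ 'n::finite"
  assumes \<gamma>: "piecewise_C1_curve flat_torus \<gamma>"
  shows "ennreal (norm (\<gamma> 1 - \<gamma> 0)) \<le> ennreal (2 * pi) * curve_length flat_torus \<gamma>"
proof -
  let ?f = "\<lambda>s t x. ennreal (speed flat_torus \<gamma> x) * indicator {s..t} x"
  have c01: "continuous_on {0..1} \<gamma>" and tor: "\<And>u. u \<in> {0..1} \<Longrightarrow> \<gamma> u \<in> torus"
    using \<gamma> by (auto simp: piecewise_C1_curve_def)
  define P where "P s t \<longleftrightarrow> (0 \<le> s \<and> s \<le> t \<and> t \<le> 1 \<longrightarrow> ?f s t \<in> borel_measurable lebesgue \<and>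
     ennreal (norm (\<gamma> t - \<gamma> s)) \<le> ennreal (2 * pi) * arc_length \<gamma> s t)" for s t
  have "P 0 1"
  proof (rule Bolzano[of 0 1 P])
    fix r s t assume rs: "P r s" and st: "P s t" and le: "r \<le> s" "s \<le> t"
    show "P r t" unfolding P_def
    proof (intro impI)
      assume rt: "0 \<le> r \<and> r \<le> t \<and> t \<le> 1"
      then have m: "?f r s \<in> borel_measurable lebesgue" "?f s t \<in> borel_measurable lebesgue"
        and b: "ennreal (norm (\<gamma> s - \<gamma> r)) \<le> ennreal (2 * pi) * arc_length \<gamma> r s"
          "ennreal (norm (\<gamma> t - \<gamma> s)) \<le> ennreal (2 * pi) * arc_length \<gamma> s t"
        using rs st le by (auto simp: P_def)
      \<comment> \<open>Both indicators are 1 at the common endpoint \<open>s\<close>, hence the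
        maximum. The sum can exceed it only at this point, which is a null set; the comparison below
        is therefore almost everywhere.\<close>
      have "?f r t = (\<lambda>x. max (?f r s x) (?f s t x))"
        using le by (auto simp: indicator_def max_def)
      then have m': "?f r t \<in> borel_measurable lebesgue" using m by simp
      have "arc_length \<gamma> r s + arc_length \<gamma> s t = (\<integral>\<^sup>+ x. ?f r s x + ?f s t x \<partial>lebesgue)"
        unfolding arc_length_def using m by (rule nn_integral_add[symmetric])
      also have "\<dots> \<le> arc_length \<gamma> r t"
        unfolding arc_length_def
      proof (rule nn_integral_mono_AE)
        have "AE x in lebesgue. x \<noteq> s"
          by (intro AE_completion AE_lborel_singleton)
        then show "AE x in lebesgue. ?f r s x + ?f s t x \<le> ?f r t x"
          by eventually_elim (use le in \<open>auto simp: indicator_def\<close>)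
      qed
      finally have len: "arc_length \<gamma> r s + arc_length \<gamma> s t \<le> arc_length \<gamma> r t" .
      have "norm (\<gamma> t - \<gamma> r) \<le> norm (\<gamma> s - \<gamma> r) + norm (\<gamma> t - \<gamma> s)"
        using norm_triangle_ineq[of "\<gamma> s - \<gamma> r" "\<gamma> t - \<gamma> s"] by simp
      then have "ennreal (norm (\<gamma> t - \<gamma> r)) \<le> ennreal (norm (\<gamma> s - \<gamma> r)) + ennreal (norm (\<gamma> t - \<gamma> s))"
        by (simp flip: ennreal_plus)
      also have "\<dots> \<le> ennreal (2 * pi) * (arc_length \<gamma> r s + arc_length \<gamma> s t)"
        unfolding distrib_left by (intro add_mono b)
      also have "\<dots> \<le> ennreal (2 * pi) * arc_length \<gamma> r t"
        by (intro mult_left_mono len) simp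
      finally show "?f r t \<in> borel_measurable lebesgue \<and>
          ennreal (norm (\<gamma> t - \<gamma> r)) \<le> ennreal (2 * pi) * arc_length \<gamma> r t"
        using m' by blast
    qed
  next
    fix x :: real assume x: "0 \<le> x" "x \<le> 1"
    then have "\<gamma> x \<in> torus" by (intro tor) simp
    then obtain a where a: "\<gamma> x \<in> patch a" using Union_patch by blast
    obtain T where T: "open T" "patch a = torus \<inter> T"
      using openin_patch[of a] by (auto simp: openin_open)
    have "openin (top_of_set {0..1}) ({0..1} \<inter> \<gamma> -` T)"
      using c01 T(1) by (rule continuous_openin_preimage_gen)
    moreover have "x \<in> {0..1} \<inter> \<gamma> -` T" using x a T by auto
    ultimately obtain d where d: "0 < d" "\<And>u. u \<in> {0..1} \<Longrightarrow> dist u x < d \<Longrightarrow> u \<in> {0..1} \<inter> \<gamma> -` T"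
      unfolding openin_euclidean_subtopology_iff by metis
    have "P s t" if st: "s \<le> x" "x \<le> t" "t - s < d" for s t
      unfolding P_def
    proof (intro impI)
      assume s01: "0 \<le> s \<and> s \<le> t \<and> t \<le> 1"
      have "\<gamma> ` {s..t} \<subseteq> patch a"
      proof (rule image_subsetI)
        fix u assume "u \<in> {s..t}"
        then have u: "u \<in> {0..1}" "dist u x < d" using st s01 by (auto simp: dist_real_def)
        then show "\<gamma> u \<in> patch a" using d(2)[OF u] tor T by auto
      qed
      then show "?f s t \<in> borel_measurable lebesgue \<and>
          ennreal (norm (\<gamma> t - \<gamma> s)) \<le> ennreal (2 * pi) * arc_length \<gamma> s t"
        using chord_le_length_in_patch[OF \<gamma>] s01 by blast
    qed
    then show "\<exists>d>0. \<forall>s t. s \<le> x \<and> x \<le> t \<and> t - s < d \<longrightarrow> P s t" using d(1) by blast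
  qed simp
  then have "ennreal (norm (\<gamma> 1 - \<gamma> 0)) \<le> ennreal (2 * pi) * arc_length \<gamma> 0 1"
    by (simp add: P_def)
  then show ?thesis
    by (simp add: arc_length_def curve_length_def nn_integral_completion)
qed

text \<open>Supplies a competitor of finite length: an infinite infimum would be turned into 0 by
  \<open>enn2real\<close>, and no lower bound on \<open>geodesic_dist\<close> could hold.\<close>

lemma straight_curve:
  fixes X Y :: "real ^ 'n::finite"
  defines "\<gamma> \<equiv> \<lambda>t. wind (X + t *\<^sub>R (Y - X))"
  shows "piecewise_C1_curve flat_torus \<gamma>" "curve_length flat_torus \<gamma> < \<infinity>"
proof -
  have cont: "isCont \<gamma> u" for u
    unfolding \<gamma>_def by (rule continuous_on_interior[of UNIV]) (auto intro!: continuous_intros)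
  have deriv: "((coord a \<circ> \<gamma>) has_vector_derivative (Y - X)) (at u)" if u: "\<gamma> u \<in> patch a" for a u
  proof -
    \<comment> \<open>Along the curve, the coordinates are the straight line shifted by a locally
      constant integer vector, read off at \<open>u\<close>.\<close>
    define k where "k = coord a (\<gamma> u) - (X + u *\<^sub>R (Y - X))"
    have "wind (X + u *\<^sub>R (Y - X)) = wind (coord a (\<gamma> u))"
      using u by (simp add: wind_coord) (simp add: \<gamma>_def)
    then have k: "k $ i \<in> \<int>" for i
      using wind_eq_imp_Ints unfolding k_def by fastforce
    let ?l = "\<lambda>t. X + t *\<^sub>R (Y - X) + k"
    have "isCont ?l u" by (intro continuous_intros)
    then have "(?l \<longlongrightarrow> ?l u) (nhds u)"
      unfolding isCont_def using tendsto_at_iff_tendsto_nhds[of ?l u] by (rule iffD1[rotated])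
    moreover have "?l u \<in> cube a" using coord_in_cube[OF u] by (simp add: k_def)
    ultimately have "\<forall>\<^sub>F t in nhds u. ?l t \<in> cube a"
      using topological_tendstoD[of ?l "?l u" "nhds u" "cube a"] open_cube[of a] by blast
    then have ev: "\<forall>\<^sub>F t in nhds u. ?l t = (coord a \<circ> \<gamma>) t"
    proof eventually_elim
      case (elim t)
      have "\<gamma> t = wind (?l t)" unfolding \<gamma>_def by (rule wind_add_Ints[OF k, symmetric])
      then show ?case using coord_wind[OF elim] by simp
    qed
    moreover have "(?l has_vector_derivative (Y - X)) (at u)"
      by (auto intro!: derivative_eq_intros)
    ultimately show ?thesis
      unfolding has_vector_derivative_def
      using has_derivative_transform_eventually[of ?l _ u UNIV "coord a \<circ> \<gamma>"] eventually_nhds_x_imp_x[OF ev]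
      by (simp add: eventually_nhds_conv_at)
  qed
  show "piecewise_C1_curve flat_torus \<gamma>"
    unfolding piecewise_C1_curve_def
  proof (intro conjI)
    show "continuous_map (top_of_set {0..1}) (man_top flat_torus) \<gamma>"
      using cont by (auto simp: \<gamma>_def intro!: continuous_intros)
    have "(coord a \<circ> \<gamma>) piecewise_C1_differentiable_on {s..t}" if "\<gamma> ` {s..t} \<subseteq> patch a" for a s t
      by (rule C1_differentiable_imp_piecewise)
        (use deriv that in \<open>auto simp: C1_differentiable_on_def intro!: exI[of _ "\<lambda>_. Y - X"]\<close>)
    then show "\<forall>(U, \<phi>)\<in>charts flat_torus. \<forall>a b. 0 \<le> a \<longrightarrow> a \<le> b \<longrightarrow> b \<le> 1 \<longrightarrow> \<gamma> ` {a..b} \<subseteq> U \<longrightarrow>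
        (\<phi> \<circ> \<gamma>) piecewise_C1_differentiable_on {a..b}"
      by auto
  qed
  have "speed flat_torus \<gamma> u = norm (Y - X)" for u
  proof -
    have "\<gamma> u \<in> torus" by (simp add: \<gamma>_def)
    then obtain a where "\<gamma> u \<in> patch a" using Union_patch by blast
    then show ?thesis using deriv cont by (intro speed_eq) (auto simp: \<gamma>_def)
  qed
  then show "curve_length flat_torus \<gamma> < \<infinity>"
    by (simp add: curve_length_def nn_integral_cmult ennreal_mult_less_top)
qed

text \<open>Transfers Lipschitz bounds from the ambient norm, where they are elementary, to the
  geodesic distance.\<close>

lemma norm_le_geodesic_dist:
  fixes x y :: "complex ^ 'n::finite"
  assumes "x \<in> torus" "y \<in> torus"
  shows "norm (x - y) \<le> 2 * pi * geodesic_dist flat_torus x y"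
proof -
  let ?C = "{\<gamma>. piecewise_C1_curve flat_torus \<gamma> \<and> \<gamma> 0 = x \<and> \<gamma> 1 = y}"
  let ?I = "INF \<gamma>\<in>?C. curve_length flat_torus \<gamma>"
  obtain X Y where XY: "x = wind X" "y = wind Y"
    using assms torus_eq_wind by blast
  have "?I \<le> curve_length flat_torus (\<lambda>t. wind (X + t *\<^sub>R (Y - X)))"
    by (rule INF_lower) (simp add: straight_curve XY)
  also have "\<dots> < \<infinity>" by (rule straight_curve)
  finally have fin: "?I < \<infinity>" .
  have "ennreal (norm (x - y) / (2 * pi)) \<le> ?I"
  proof (rule INF_greatest)
    fix \<gamma> assume \<gamma>: "\<gamma> \<in> ?C"
    then have "ennreal (norm (x - y)) \<le> ennreal (2 * pi) * curve_length flat_torus \<gamma>"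
      using chord_le_length[of \<gamma>] by (auto simp: norm_minus_commute)
    then have "ennreal (1 / (2 * pi)) * ennreal (norm (x - y))
        \<le> ennreal (1 / (2 * pi)) * (ennreal (2 * pi) * curve_length flat_torus \<gamma>)"
      by (rule mult_left_mono) simp
    also have "\<dots> = curve_length flat_torus \<gamma>"
      by (simp add: mult.assoc[symmetric] flip: ennreal_mult)
    finally show "ennreal (norm (x - y) / (2 * pi)) \<le> curve_length flat_torus \<gamma>"
      by (simp flip: ennreal_mult)
  qed
  then have "norm (x - y) / (2 * pi) \<le> enn2real ?I"
    using fin by (cases ?I) (auto simp: ennreal_le_iff2 split: if_splits)
  then show ?thesis
    by (simp add: geodesic_dist_def divide_le_eq mult.commute)
qed

subsection \<open>Distance-generating functions\<close>

lemma A2_finite: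
  assumes "assumption_A2 \<eta>" "x \<in> eff_dom \<eta>"
  shows "\<eta> x = ereal (real_of_ereal (\<eta> x))" "0 \<le> real_of_ereal (\<eta> x)"
proof -
  have "0 \<le> \<eta> x" "\<eta> x < \<infinity>" using assms by (auto simp: assumption_A2_def eff_dom_def)
  then show "\<eta> x = ereal (real_of_ereal (\<eta> x))" "0 \<le> real_of_ereal (\<eta> x)"
    by (cases "\<eta> x"; simp)+
qed

lemma A2_eff_dom:
  assumes "assumption_A2 \<eta>"
  shows "eff_dom \<eta> = {0..} \<or> eff_dom \<eta> = UNIV"
  using assms by (auto simp: assumption_A2_def)

text \<open>A common consequence of both alternatives: \<open>\<eta>\<close> has a zero in the unit
  interval.\<close>

lemma A2_vanishes: "assumption_A2 \<eta> \<Longrightarrow> \<eta> 0 = 0 \<or> \<eta> 1 = 0"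
  unfolding assumption_A2_def by blast

lemma A2_rescale:
  assumes "assumption_A2 \<eta>" "0 < c"
  shows "\<exists>C>0. eventually (\<lambda>x. \<eta> x \<le> ereal C * \<eta> (c * x)) at_top"
proof -
  have "\<exists>C>0. eventually (\<lambda>x. \<eta> (c * x) \<le> ereal C * \<eta> x \<and> \<eta> x \<le> ereal C * \<eta> (c * x)) at_top"
    using assms unfolding assumption_A2_def by blast
  then show ?thesis by (auto elim: eventually_mono)
qed

lemma A2_nonneg_in_eff_dom:
  assumes "assumption_A2 \<eta>" "0 \<le> x"
  shows "x \<in> eff_dom \<eta>"
  using A2_eff_dom[OF assms(1)] assms(2) by auto

lemma A2_pos_in_interior:
  assumes "assumption_A2 \<eta>" "0 < x"
  shows "x \<in> interior (eff_dom \<eta>)"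
  using A2_eff_dom[OF assms(1)] assms(2) by auto

text \<open>The inequality for extended reals becomes convexity of the real-valued function on the
  effective domain. Only the point of tangency is interior; \<open>a\<close> may be the boundary
  point 0, and tangents are evaluated there below.\<close>

lemma A2_tangent:
  assumes \<eta>: "assumption_A2 \<eta>" and a: "a \<in> eff_dom \<eta>" and x: "x \<in> interior (eff_dom \<eta>)"
  shows "real_of_ereal (\<eta> x) + eta_deriv \<eta> x * (a - x) \<le> real_of_ereal (\<eta> a)"
proof -
  define h where "h = (\<lambda>x. real_of_ereal (\<eta> x))"
  have conv: "convex (eff_dom \<eta>)"
    using A2_eff_dom[OF \<eta>] by auto
  have "convex_on (eff_dom \<eta>) h"
  proof (rule convex_onI[OF _ conv])
    fix t u v :: real assume t: "0 < t" "t < 1" and uv: "u \<in> eff_dom \<eta>" "v \<in> eff_dom \<eta>"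
    show "h ((1 - t) *\<^sub>R u + t *\<^sub>R v) \<le> (1 - t) * h u + t * h v"
    proof (cases "u = v")
      case True
      have "(1 - t) *\<^sub>R v + t *\<^sub>R v = v" by (simp add: algebra_simps)
      then show ?thesis using True by (simp add: algebra_simps)
    next
      case False
      have w: "(1 - t) *\<^sub>R u + t *\<^sub>R v \<in> eff_dom \<eta>"
        using conv uv t by (simp add: convex_alt)
      have "\<eta> ((1 - t) * u + t * v) < ereal (1 - t) * \<eta> u + ereal t * \<eta> v"
        using \<eta> uv t False by (simp add: assumption_A2_def)
      then have "ereal (h ((1 - t) * u + t * v)) < ereal ((1 - t) * h u + t * h v)"
        using A2_finite(1)[OF \<eta> uv(1)] A2_finite(1)[OF \<eta> uv(2)] A2_finite(1)[OF \<eta> w]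
        unfolding h_def by (metis plus_ereal.simps(1) real_scaleR_def times_ereal.simps(1))
      then show ?thesis by simp
    qed
  qed
  moreover have "h differentiable (at x)"
    using \<eta> x by (simp add: assumption_A2_def h_def)
  then have "(h has_real_derivative eta_deriv \<eta> x) (at x within eff_dom \<eta>)"
    unfolding eta_deriv_def h_def[symmetric]
    by (simp add: DERIV_deriv_iff_real_differentiable has_field_derivative_at_within)
  moreover have "connected (eff_dom \<eta>)" using conv by (rule convex_connected)
  ultimately have "eta_deriv \<eta> x * (a - x) \<le> h a - h x"
    using a x by (intro convex_on_imp_above_tangent)
  then show ?thesis by (simp add: h_def)
qed

text \<open>The derivative takes every real value, so some tangent has slope
  \<open>\<bar>M\<bar> + 1\<close>; its surplus slope 1 eventually outweighs the intercept.\<close>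

lemma A2_superlinear:
  assumes \<eta>: "assumption_A2 \<eta>"
  shows "\<exists>X\<ge>1. \<forall>x\<ge>X. M * x \<le> real_of_ereal (\<eta> x)"
proof -
  have "\<bar>M\<bar> + 1 \<in> eta_deriv \<eta> ` interior (eff_dom \<eta>)"
    using \<eta> unfolding assumption_A2_def by blast
  then obtain y where y: "y \<in> interior (eff_dom \<eta>)" "eta_deriv \<eta> y = \<bar>M\<bar> + 1"
    by auto
  have yd: "y \<in> eff_dom \<eta>" using y(1) interior_subset by blast
  show ?thesis
  proof (intro exI conjI allI impI)
    \<comment> \<open>Beyond \<open>(\<bar>M\<bar> + 1) * y\<close> the quantity
      \<open>(\<bar>M\<bar> + 1) * (x - y)\<close> is at least \<open>\<bar>M\<bar> * x\<close>. The
      entry 1 keeps \<open>x\<close> positive.\<close>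
    show "1 \<le> max 1 ((\<bar>M\<bar> + 1) * y)" by simp
    fix x assume x: "max 1 ((\<bar>M\<bar> + 1) * y) \<le> x"
    have "real_of_ereal (\<eta> y) + (\<bar>M\<bar> + 1) * (x - y) \<le> real_of_ereal (\<eta> x)"
      using A2_tangent[OF \<eta> _ y(1), of x] A2_nonneg_in_eff_dom[OF \<eta>, of x] x y(2) by simp
    moreover have "0 \<le> real_of_ereal (\<eta> y)" by (rule A2_finite[OF \<eta> yd])
    moreover have "M * x \<le> \<bar>M\<bar> * x" using x by (intro mult_right_mono) auto
    moreover have "(\<bar>M\<bar> + 1) * (x - y) = \<bar>M\<bar> * x + x - (\<bar>M\<bar> + 1) * y" by (simp add: algebra_simps)
    ultimately show "M * x \<le> real_of_ereal (\<eta> x)"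
      using x by linarith
  qed
qed

text \<open>The tangent at \<open>x\<close> handles \<open>\<eta> a\<close>. The tangent at
  \<open>b\<close>, evaluated at a zero of \<open>\<eta>\<close> in the unit interval, shows that
  the terms containing \<open>b\<close> lower the value by at most \<open>B * a + B\<close>.\<close>

lemma bregman_ge_affine:
  assumes \<eta>: "assumption_A2 \<eta>" and "0 \<le> a" "0 < x"
    and b: "b \<in> interior (eff_dom \<eta>)" "\<bar>eta_deriv \<eta> b\<bar> \<le> B"
  shows "ereal ((eta_deriv \<eta> x - B) * a - (x * eta_deriv \<eta> x - real_of_ereal (\<eta> x) + B)) \<le> bregman \<eta> a b"
proof -
  let ?h = "\<lambda>x. real_of_ereal (\<eta> x)"
  have bd: "b \<in> eff_dom \<eta>" using b(1) interior_subset by blast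
  have ad: "a \<in> eff_dom \<eta>" using assms by (simp add: A2_nonneg_in_eff_dom)
  have t1: "?h x + eta_deriv \<eta> x * (a - x) \<le> ?h a"
    using A2_tangent[OF \<eta> ad A2_pos_in_interior[OF \<eta> \<open>0 < x\<close>]] .
  have t2: "- B \<le> eta_deriv \<eta> b * b - ?h b"
  proof -
    obtain x0 where x0: "0 \<le> x0" "x0 \<le> 1" "?h x0 = 0"
      using A2_vanishes[OF \<eta>] by (metis order_refl zero_le_one real_of_ereal_0)
    have "?h b + eta_deriv \<eta> b * (x0 - b) \<le> ?h x0"
      by (rule A2_tangent[OF \<eta> A2_nonneg_in_eff_dom[OF \<eta> x0(1)] b(1)])
    moreover have "\<bar>eta_deriv \<eta> b * x0\<bar> \<le> B * 1"
      unfolding abs_mult using b(2) x0 by (intro mult_mono) auto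
    ultimately show ?thesis using x0(3) by (simp add: algebra_simps abs_le_iff)
  qed
  have t3: "eta_deriv \<eta> b * a \<le> B * a"
    using b(2) \<open>0 \<le> a\<close> by (intro mult_right_mono) auto
  have "bregman \<eta> a b = ereal (?h a - ?h b - eta_deriv \<eta> b * (a - b))"
    unfolding bregman_def using A2_finite(1)[OF \<eta> ad] A2_finite(1)[OF \<eta> bd]
    by (metis ereal_minus(1))
  moreover have "(eta_deriv \<eta> x - B) * a - (x * eta_deriv \<eta> x - ?h x + B)
      \<le> ?h a - ?h b - eta_deriv \<eta> b * (a - b)"
    using t1 t2 t3 by (simp add: algebra_simps)
  ultimately show ?thesis by simp
qed

section \<open>Divergence of concentrated densities\<close>

lemma ennreal_integral_le_nn_integral:
  fixes g :: "'a \<Rightarrow> real"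
  assumes "integrable M g"
  shows "ennreal (integral\<^sup>L M g) \<le> (\<integral>\<^sup>+ x. ennreal (g x) \<partial>M)"
proof -
  have i: "integrable M (\<lambda>x. max 0 (g x))" using assms by simp
  have "integral\<^sup>L M g \<le> (\<integral>x. max 0 (g x) \<partial>M)"
    using assms i by (intro integral_mono) auto
  then have "ennreal (integral\<^sup>L M g) \<le> ennreal (\<integral>x. max 0 (g x) \<partial>M)" by (rule ennreal_leI)
  also have "\<dots> = (\<integral>\<^sup>+ x. ennreal (max 0 (g x)) \<partial>M)"
    using i by (intro nn_integral_eq_integral[symmetric]) auto
  also have "\<dots> = (\<integral>\<^sup>+ x. ennreal (g x) \<partial>M)"
    by (intro nn_integral_cong) (simp add: max_def ennreal_neg)
  finally show ?thesis .
qed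

text \<open>Jensen's inequality on \<open>A\<close>, in the form of integrating the tangent of \<open>\<eta>\<close> at \<open>x\<close>.\<close>

lemma bregman_integral_ge:
  fixes M :: "'a measure" and f f0 :: "'a \<Rightarrow> real"
  assumes \<eta>: "assumption_A2 \<eta>" and M: "finite_measure M" and A: "A \<in> sets M"
    and f: "integrable M f" "AE \<theta> in M. 0 \<le> f \<theta>"
    and f0: "AE \<theta> in M. f0 \<theta> \<in> interior (eff_dom \<eta>)" "AE \<theta> in M. \<bar>eta_deriv \<eta> (f0 \<theta>)\<bar> \<le> B"
    and x: "0 < x" "B \<le> eta_deriv \<eta> x" "0 \<le> B"
    and mA: "measure M A \<le> 1 / (2 * x)" and fA: "1 / 2 \<le> (\<integral>\<theta>. indicator A \<theta> * f \<theta> \<partial>M)"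
  shows "ennreal ((real_of_ereal (\<eta> x) - (B + real_of_ereal (\<eta> 0)) - B * x) / (2 * x))
    \<le> (\<integral>\<^sup>+ \<theta>. e2ennreal (bregman \<eta> (f \<theta>) (f0 \<theta>)) \<partial>M)"
proof -
  let ?h = "\<lambda>x. real_of_ereal (\<eta> x)"
  interpret finite_measure M by fact
  \<comment> \<open>The summand \<open>\<eta> 0\<close> makes \<open>P\<close> nonnegative, as the
    tangent at \<open>x\<close> evaluated at 0 shows. Otherwise an upper bound on the measure of
    \<open>A\<close> could not be inserted.\<close>
  define K where "K = B + ?h 0"
  define P where "P = x * eta_deriv \<eta> x - ?h x + K"
  define s where "s = eta_deriv \<eta> x - B"
  have h0: "0 \<le> ?h 0"
    using A2_finite[OF \<eta> A2_nonneg_in_eff_dom[OF \<eta>]] by simp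
  have "?h x + eta_deriv \<eta> x * (0 - x) \<le> ?h 0"
    by (rule A2_tangent[OF \<eta> A2_nonneg_in_eff_dom[OF \<eta>] A2_pos_in_interior[OF \<eta> x(1)]]) simp
  then have P0: "0 \<le> P" using x(3) by (simp add: P_def K_def mult.commute)
  have s0: "0 \<le> s" using x(2) by (simp add: s_def)
  define g where "g \<theta> = s * (indicator A \<theta> * f \<theta>) - P * indicator A \<theta>" for \<theta>
  have iA: "integrable M (\<lambda>\<theta>. indicator A \<theta> * f \<theta>)"
    using integrable_real_mult_indicator[OF A f(1)] by (simp add: mult.commute)
  have iI: "integrable M (indicator A :: _ \<Rightarrow> real)"
    using A by (simp add: less_top[symmetric])
  have ig: "integrable M g" unfolding g_def using iA iI by simp
  \<comment> \<open>Mass 1/2 on measure \<open>1 / (2 * x)\<close> means average \<open>x\<close>,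
    exactly the tangent point; the terms with \<open>eta_deriv \<eta> x\<close> cancel.\<close>
  have "(?h x - K - B * x) / (2 * x) = s * (1 / 2) - P * (1 / (2 * x))"
    using x(1) by (simp add: s_def P_def field_simps)
  also have "\<dots> \<le> s * (\<integral>\<theta>. indicator A \<theta> * f \<theta> \<partial>M) - P * measure M A"
    using fA mA s0 P0 by (intro diff_mono mult_left_mono) auto
  also have "\<dots> = integral\<^sup>L M g"
    unfolding g_def using iA iI A by simp
  finally have "ennreal ((?h x - K - B * x) / (2 * x)) \<le> ennreal (integral\<^sup>L M g)"
    by (rule ennreal_leI)
  also have "\<dots> \<le> (\<integral>\<^sup>+ \<theta>. ennreal (g \<theta>) \<partial>M)"
    by (rule ennreal_integral_le_nn_integral[OF ig])
  also have "\<dots> \<le> (\<integral>\<^sup>+ \<theta>. e2ennreal (bregman \<eta> (f \<theta>) (f0 \<theta>)) \<partial>M)"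
  proof (rule nn_integral_mono_AE)
    show "AE \<theta> in M. ennreal (g \<theta>) \<le> e2ennreal (bregman \<eta> (f \<theta>) (f0 \<theta>))"
      using f(2) f0
    proof eventually_elim
      case (elim \<theta>)
      show ?case
      proof (cases "\<theta> \<in> A")
        case True
        have "ereal (g \<theta>) \<le> ereal (s * f \<theta> - (x * eta_deriv \<eta> x - ?h x + B))"
          using True h0 by (simp add: g_def P_def K_def)
        also have "\<dots> \<le> bregman \<eta> (f \<theta>) (f0 \<theta>)"
          unfolding s_def by (rule bregman_ge_affine[OF \<eta> elim(1) x(1) elim(2,3)])
        finally have "e2ennreal (ereal (g \<theta>)) \<le> e2ennreal (bregman \<eta> (f \<theta>) (f0 \<theta>))"
          by (rule e2ennreal_mono)
        then show ?thesis by simp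
      qed (simp add: g_def)
    qed
  qed
  finally show ?thesis by (simp add: K_def)
qed

text \<open>For small \<open>\<epsilon>\<close> the tangent point is so large that the terms
  depending on \<open>B\<close> consume at most half of \<open>\<eta> x\<close>. What remains is
  compared with \<open>\<eta>\<close> at the unscaled argument.\<close>

lemma bregman_integral_ge_scaled:
  fixes M :: "'a measure" and f0 :: "'a \<Rightarrow> real"
  assumes \<eta>: "assumption_A2 \<eta>" and M: "finite_measure M" and n: "0 < n"
    and f0: "AE \<theta> in M. f0 \<theta> \<in> interior (eff_dom \<eta>)" "AE \<theta> in M. \<bar>eta_deriv \<eta> (f0 \<theta>)\<bar> \<le> B"
    and B: "0 \<le> B"
  shows "\<exists>c>0. \<exists>e>0. \<forall>\<epsilon>. \<forall>A\<in>sets M. \<forall>f. 0 < \<epsilon> \<longrightarrow> \<epsilon> \<le> e \<longrightarrow> integrable M f \<longrightarrow> (AE \<theta> in M. 0 \<le> f \<theta>) \<longrightarrow>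
     measure M A \<le> (2 * \<epsilon>) ^ n \<longrightarrow> 1 / 2 \<le> (\<integral>\<theta>. indicator A \<theta> * f \<theta> \<partial>M) \<longrightarrow>
     ennreal (c * (\<epsilon> ^ n * real_of_ereal (\<eta> (1 / \<epsilon> ^ n))))
       \<le> (\<integral>\<^sup>+ \<theta>. e2ennreal (bregman \<eta> (f \<theta>) (f0 \<theta>)) \<partial>M)"
proof -
  let ?h = "\<lambda>x. real_of_ereal (\<eta> x)"
  \<comment> \<open>Chosen so that \<open>(2 * \<epsilon>) ^ n = 1 / (2 * x)\<close> for
    \<open>x = \<kappa> / \<epsilon> ^ n\<close>.\<close>
  define \<kappa> :: real where "\<kappa> = 1 / (2 * 2 ^ n)"
  have \<kappa>: "0 < \<kappa>" by (simp add: \<kappa>_def)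
  define K where "K = B + ?h 0"
  have h0: "0 \<le> ?h 0"
    using A2_finite[OF \<eta> A2_nonneg_in_eff_dom[OF \<eta>]] by simp
  have K: "B \<le> K" "0 \<le> K" using h0 B by (simp_all add: K_def)
  \<comment> \<open>For \<open>x \<ge> 1\<close> the loss \<open>K + B * x\<close> is at most
    \<open>(K + B) * x\<close>, hence at most half of \<open>\<eta> x\<close> under this
    bound.\<close>
  obtain X where X: "1 \<le> X" "\<And>x. X \<le> x \<Longrightarrow> (2 * (K + B)) * x \<le> ?h x"
    using A2_superlinear[OF \<eta>, of "2 * (K + B)"] by auto
  obtain C where C: "0 < C" "eventually (\<lambda>x. \<eta> x \<le> ereal C * \<eta> (\<kappa> * x)) at_top"
    using A2_rescale[OF \<eta> \<kappa>] by blast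
  then obtain Y where Y: "\<And>y. Y \<le> y \<Longrightarrow> \<eta> y \<le> ereal C * \<eta> (\<kappa> * y)"
    by (auto simp: eventually_at_top_linorder)
  define Z where "Z = max 1 (max Y (X / \<kappa>))"
  have Z: "1 \<le> Z" "Y \<le> Z" "X / \<kappa> \<le> Z" by (simp_all add: Z_def)
  show ?thesis
  \<comment> \<open>One factor 2 is the half of \<open>\<eta> x\<close> given up, the other the
    denominator \<open>2 * x\<close>; \<open>\<kappa>\<close> comes from
    \<open>x = \<kappa> * y\<close> and \<open>C\<close> from returning to
    \<open>\<eta> y\<close>.\<close>
  proof (rule exI[of _ "1 / (4 * \<kappa> * C)"], intro conjI, goal_cases)
    case 1 show ?case using \<kappa> C by simp
    case 2 show ?case
    proof (rule exI[of _ "1 / Z"], intro conjI allI ballI impI, goal_cases)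
      case 1 show ?case using Z by simp
      case (2 \<epsilon> A f)
      define y where "y = 1 / \<epsilon> ^ n"
      define x where "x = \<kappa> * y"
      have "\<epsilon> \<le> 1" using \<open>\<epsilon> \<le> 1 / Z\<close> Z(1) by (smt (verit) divide_le_eq_1)
      then have "\<epsilon> ^ n \<le> \<epsilon> ^ 1" using \<open>0 < \<epsilon>\<close> n by (intro power_decreasing) auto
      then have "\<epsilon> ^ n \<le> 1 / Z" using \<open>\<epsilon> \<le> 1 / Z\<close> by simp
      then have yZ: "Z \<le> y" using \<open>0 < \<epsilon>\<close> Z(1) by (simp add: y_def field_simps)
      have "X \<le> Z * \<kappa>" using Z(3) \<kappa> by (simp add: divide_le_eq)
      also have "\<dots> \<le> y * \<kappa>" using yZ \<kappa> by (intro mult_right_mono) auto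
      finally have xX: "X \<le> x" by (simp add: x_def mult.commute)
      then have x1: "1 \<le> x" using X(1) by simp
      have y0: "0 < y" using yZ Z(1) by simp
      have big: "2 * (K + B) * x \<le> ?h x" by (rule X(2)[OF xX])
      have KBx: "K + B * x \<le> (K + B) * x"
        using mult_left_mono[OF x1 K(2)] by (simp add: algebra_simps)
      \<comment> \<open>Evaluating the tangent at 0 turns the superlinear size of
        \<open>\<eta> x\<close> into a lower bound on the slope, as required by
        \<open>bregman_integral_ge\<close>.\<close>
      have "?h x + eta_deriv \<eta> x * (0 - x) \<le> ?h 0"
        by (rule A2_tangent[OF \<eta> A2_nonneg_in_eff_dom[OF \<eta>] A2_pos_in_interior[OF \<eta>]]) (use x1 in auto)
      moreover have "?h 0 \<le> K" using B by (simp add: K_def)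
      moreover have "0 \<le> (K + B) * x" using K B x1 by simp
      ultimately have "B * x \<le> eta_deriv \<eta> x * x"
        using big KBx by (simp add: algebra_simps)
      then have deriv: "B \<le> eta_deriv \<eta> x" using x1 by simp
      have mA: "measure M A \<le> 1 / (2 * x)"
        using \<open>measure M A \<le> _\<close> \<open>0 < \<epsilon>\<close> by (simp add: x_def y_def \<kappa>_def power_mult_distrib)
      have hy: "?h y \<le> C * ?h x"
      proof -
        have "ereal (?h y) \<le> ereal (C * ?h x)"
          using Y[of y] yZ Z(2) A2_finite(1)[OF \<eta> A2_nonneg_in_eff_dom[OF \<eta>], of y]
            A2_finite(1)[OF \<eta> A2_nonneg_in_eff_dom[OF \<eta>], of x] y0 x1
          by (metis x_def less_imp_le order_trans times_ereal.simps(1) zero_le_one)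
        then show ?thesis by simp
      qed
      have "1 / (4 * \<kappa> * C) * (\<epsilon> ^ n * ?h y) = ?h y / C / (4 * x)"
        by (simp add: x_def y_def mult_ac)
      also have "\<dots> \<le> ?h x / (4 * x)"
        using hy C x1 by (intro divide_right_mono) (auto simp: field_simps)
      also have "\<dots> = (?h x / 2) / (2 * x)" by simp
      also have "\<dots> \<le> (?h x - K - B * x) / (2 * x)"
      proof (rule divide_right_mono)
        show "?h x / 2 \<le> ?h x - K - B * x" using big KBx unfolding mult.assoc by linarith
      qed (use x1 in simp)
      finally have "ennreal (1 / (4 * \<kappa> * C) * (\<epsilon> ^ n * ?h y)) \<le> ennreal ((?h x - K - B * x) / (2 * x))"
        by (rule ennreal_leI)
      also have "\<dots> \<le> (\<integral>\<^sup>+ \<theta>. e2ennreal (bregman \<eta> (f \<theta>) (f0 \<theta>)) \<partial>M)"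
        unfolding K_def using x1 2 by (intro bregman_integral_ge[OF \<eta> M _ _ _ f0 _ deriv B mA]) auto
      finally show ?case by (simp add: y_def)
    qed
  qed
qed

text \<open>The radius \<open>\<epsilon>\<close> of the concentration set is tested in the infimum
  itself while it is small, and replaced by the fixed radius \<open>e\<close> otherwise. The term
  \<open>\<epsilon> ^ q / 2 ^ m\<close> stands for the objective value of \<open>f\<close>.\<close>

lemma rate_lower_bound:
  fixes M :: "'a measure" and f0 :: "'a \<Rightarrow> real"
  assumes \<eta>: "assumption_A2 \<eta>" and M: "finite_measure M" and n: "0 < n"
    and f0: "AE \<theta> in M. f0 \<theta> \<in> interior (eff_dom \<eta>)" "AE \<theta> in M. \<bar>eta_deriv \<eta> (f0 \<theta>)\<bar> \<le> B"
    and B: "0 \<le> B"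
  shows "\<exists>c>0. \<forall>\<alpha>\<in>{0<..1}. \<forall>\<epsilon>. \<forall>A\<in>sets M. \<forall>f. 0 < \<epsilon> \<longrightarrow> integrable M f \<longrightarrow> (AE \<theta> in M. 0 \<le> f \<theta>) \<longrightarrow>
     measure M A \<le> (2 * \<epsilon>) ^ n \<longrightarrow> 1 / 2 \<le> (\<integral>\<theta>. indicator A \<theta> * f \<theta> \<partial>M) \<longrightarrow>
     ereal c * (INF \<epsilon> \<in> {0<..}. ereal (\<epsilon> ^ q) + ereal \<alpha> * ereal (\<epsilon> ^ n) * \<eta> (1 / \<epsilon> ^ n))
       \<le> ereal (\<epsilon> ^ q / 2 ^ m)
         + ereal \<alpha> * enn2ereal (\<integral>\<^sup>+ \<theta>. e2ennreal (bregman \<eta> (f \<theta>) (f0 \<theta>)) \<partial>M)"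
proof -
  let ?h = "\<lambda>x. real_of_ereal (\<eta> x)"
  define r where "r \<alpha> \<epsilon> = \<epsilon> ^ q + \<alpha> * (\<epsilon> ^ n * ?h (1 / \<epsilon> ^ n))" for \<alpha> \<epsilon>
  have h_nonneg: "0 \<le> ?h (1 / \<epsilon> ^ n)" if "0 < \<epsilon>" for \<epsilon>
    using that by (intro A2_finite(2)[OF \<eta> A2_nonneg_in_eff_dom[OF \<eta>]]) simp
  have r_eq: "ereal (\<epsilon> ^ q) + ereal \<alpha> * ereal (\<epsilon> ^ n) * \<eta> (1 / \<epsilon> ^ n) = ereal (r \<alpha> \<epsilon>)"
    if "0 < \<epsilon>" for \<alpha> \<epsilon>
  proof -
    have "0 \<le> 1 / \<epsilon> ^ n" using that by simp
    then obtain z where "\<eta> (1 / \<epsilon> ^ n) = ereal z"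
      using A2_finite(1)[OF \<eta> A2_nonneg_in_eff_dom[OF \<eta>], of "1 / \<epsilon> ^ n"] by blast
    then show ?thesis by (simp add: r_def mult.assoc)
  qed
  obtain c1 e where c1: "0 < c1" and e: "0 < e" and low: "\<forall>\<epsilon>. \<forall>A\<in>sets M. \<forall>f. 0 < \<epsilon> \<longrightarrow> \<epsilon> \<le> e \<longrightarrow>
     integrable M f \<longrightarrow> (AE \<theta> in M. 0 \<le> f \<theta>) \<longrightarrow>
     measure M A \<le> (2 * \<epsilon>) ^ n \<longrightarrow> 1 / 2 \<le> (\<integral>\<theta>. indicator A \<theta> * f \<theta> \<partial>M) \<longrightarrow>
     ennreal (c1 * (\<epsilon> ^ n * ?h (1 / \<epsilon> ^ n))) \<le> (\<integral>\<^sup>+ \<theta>. e2ennreal (bregman \<eta> (f \<theta>) (f0 \<theta>)) \<partial>M)"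
    using bregman_integral_ge_scaled[OF \<eta> M n f0 B] by blast
  have r1: "0 < r 1 e" unfolding r_def using e h_nonneg[OF e] by (intro add_pos_nonneg) auto
  \<comment> \<open>The first two entries compare the power and the divergence term in the case
    \<open>\<epsilon> \<le> e\<close>; the third serves larger \<open>\<epsilon>\<close>.\<close>
  define c where "c = min (min (1 / 2 ^ m) c1) (e ^ q / 2 ^ m / r 1 e)"
  have c: "0 < c" "c \<le> 1 / 2 ^ m" "c \<le> c1" "c \<le> e ^ q / 2 ^ m / r 1 e"
    using c1 e r1 by (auto simp: c_def)
  show ?thesis
  proof (rule exI[of _ c], intro conjI c(1) ballI allI impI, goal_cases)
    case (1 \<alpha> \<epsilon> A f)
    define D where "D = (\<integral>\<^sup>+ \<theta>. e2ennreal (bregman \<eta> (f \<theta>) (f0 \<theta>)) \<partial>M)"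
    have \<alpha>: "0 < \<alpha>" "\<alpha> \<le> 1" using 1 by auto
    have "\<exists>\<delta>>0. ereal (c * r \<alpha> \<delta>) \<le> ereal (\<epsilon> ^ q / 2 ^ m) + ereal \<alpha> * enn2ereal D"
    proof (cases "\<epsilon> \<le> e")
      case True
      define w where "w = \<epsilon> ^ n * ?h (1 / \<epsilon> ^ n)"
      have w: "0 \<le> w" using h_nonneg[of \<epsilon>] 1 by (simp add: w_def)
      have "ennreal (c1 * w) \<le> D"
        unfolding D_def w_def using 1 True by (intro low[rule_format])
      then have "enn2ereal (ennreal (c1 * w)) \<le> enn2ereal D"
        by (simp add: less_eq_ennreal.rep_eq)
      then have "ereal (c1 * w) \<le> enn2ereal D" using c1 w by (simp add: enn2ereal_ennreal)
      then have "ereal \<alpha> * ereal (c1 * w) \<le> ereal \<alpha> * enn2ereal D"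
        using \<alpha> by (intro ereal_mult_left_mono) auto
      moreover have "ereal (c * r \<alpha> \<epsilon>) \<le> ereal (\<epsilon> ^ q / 2 ^ m) + ereal \<alpha> * ereal (c1 * w)"
      proof -
        have "c * \<epsilon> ^ q \<le> 1 / 2 ^ m * \<epsilon> ^ q" using c 1 by (intro mult_right_mono) auto
        moreover have "c * (\<alpha> * w) \<le> c1 * (\<alpha> * w)" using c \<alpha> w by (intro mult_right_mono) auto
        ultimately show ?thesis by (simp add: r_def w_def algebra_simps)
      qed
      ultimately have "ereal (c * r \<alpha> \<epsilon>) \<le> ereal (\<epsilon> ^ q / 2 ^ m) + ereal \<alpha> * enn2ereal D"
        using add_left_mono order_trans by blast
      then show ?thesis using 1 by blast
    next
      case False
      \<comment> \<open>Here \<open>\<alpha> \<le> 1\<close> bounds the competitor uniformly, and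
        \<open>\<epsilon> ^ q\<close> is at least \<open>e ^ q\<close>.\<close>
      have "r \<alpha> e \<le> r 1 e"
        unfolding r_def using \<alpha> e h_nonneg[OF e] by (intro add_left_mono mult_right_mono) auto
      then have "c * r \<alpha> e \<le> c * r 1 e" using c(1) by simp
      also have "\<dots> \<le> e ^ q / 2 ^ m" using c(4) r1 by (simp add: le_divide_eq mult_ac)
      also have "\<dots> \<le> \<epsilon> ^ q / 2 ^ m"
        using False e by (intro divide_right_mono power_mono) auto
      finally have "ereal (c * r \<alpha> e) \<le> ereal (\<epsilon> ^ q / 2 ^ m) + 0" by simp
      also have "\<dots> \<le> ereal (\<epsilon> ^ q / 2 ^ m) + ereal \<alpha> * enn2ereal D"
        using \<alpha> by (intro add_left_mono) simp
      finally show ?thesis using e by blast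
    qed
    then obtain \<delta> where \<delta>: "0 < \<delta>"
      "ereal (c * r \<alpha> \<delta>) \<le> ereal (\<epsilon> ^ q / 2 ^ m) + ereal \<alpha> * enn2ereal D" by blast
    have "(INF \<epsilon> \<in> {0<..}. ereal (\<epsilon> ^ q) + ereal \<alpha> * ereal (\<epsilon> ^ n) * \<eta> (1 / \<epsilon> ^ n)) \<le> ereal (r \<alpha> \<delta>)"
      using \<delta>(1) by (intro INF_lower2[of \<delta>] eq_refl r_eq) (simp_all only: greaterThan_iff)
    then have "ereal c * (INF \<epsilon> \<in> {0<..}. ereal (\<epsilon> ^ q) + ereal \<alpha> * ereal (\<epsilon> ^ n) * \<eta> (1 / \<epsilon> ^ n))
        \<le> ereal c * ereal (r \<alpha> \<delta>)"
      using c(1) by (intro ereal_mult_left_mono) auto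
    also have "\<dots> \<le> ereal (\<epsilon> ^ q / 2 ^ m) + ereal \<alpha> * enn2ereal D" using \<delta>(2) by simp
    finally show ?case by (simp add: D_def)
  qed
qed

subsection \<open>The objective\<close>

text \<open>All features are multiples of this vector, so the feature space is in effect the real
  line.\<close>

definition unit_ell2 :: ell2 where
  "unit_ell2 = Abs_ell2 (\<lambda>i. if i = 0 then 1 else 0)"

definition feature :: "nat \<Rightarrow> complex ^ 'n::finite \<Rightarrow> ell2" where
  "feature k z = norm (z - 1) ^ k *\<^sub>R unit_ell2"

definition loss :: "nat \<Rightarrow> ell2 \<Rightarrow> real" where
  "loss m u = (unit_ell2 \<bullet> u) ^ m"

definition prob_indicator :: "((complex ^ 'n::finite) set \<Rightarrow> real) \<Rightarrow> ereal" where
  "prob_indicator = convex_indicator (prob_measures flat_torus)"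

definition dirac_one :: "(complex ^ 'n::finite) set \<Rightarrow> real" where
  "dirac_one A = indicator A 1"

lemma inner_unit_ell2: "unit_ell2 \<bullet> unit_ell2 = 1"
proof -
  have s: "summable (\<lambda>i. (if i = 0 then 1 else 0 :: real)\<^sup>2)"
    by (rule summable_finite[of "{0}"]) auto
  have "unit_ell2 \<bullet> unit_ell2 = (\<Sum>i. if i = 0 then 1 else 0)"
    unfolding inner_ell2_def unit_ell2_def ell2_nth_Abs[OF s] by (intro suminf_cong) auto
  also have "\<dots> = (\<Sum>i\<in>{0 :: nat}. if i = 0 then 1 else (0 :: real))"
    by (rule suminf_finite) auto
  finally show ?thesis by simp
qed

lemma norm_unit_ell2: "norm unit_ell2 = 1"
  by (simp add: norm_eq_sqrt_inner inner_unit_ell2)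

lemma continuous_on_feature: "continuous_on S (feature k)"
  unfolding feature_def by (intro continuous_intros)

lemma GDERIV_loss: "GDERIV (loss m) u :> (real m * (unit_ell2 \<bullet> u) ^ (m - 1)) *\<^sub>R unit_ell2"
proof -
  have "((\<lambda>u. unit_ell2 \<bullet> u) has_derivative (\<lambda>h. unit_ell2 \<bullet> h)) (at u)"
    by (auto intro!: derivative_eq_intros)
  then have "((\<lambda>u. (unit_ell2 \<bullet> u) ^ m) has_derivative
      (\<lambda>h. real m * (unit_ell2 \<bullet> h) * (unit_ell2 \<bullet> u) ^ (m - 1))) (at u)"
    by (rule has_derivative_power)
  then show ?thesis
    by (simp add: gderiv_def loss_def[abs_def] inner_commute mult_ac)
qed

lemma gradient_loss: "gradient (loss m) u = (real m * (unit_ell2 \<bullet> u) ^ (m - 1)) *\<^sub>R unit_ell2"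
  unfolding gradient_def
proof (rule the_equality)
  show "GDERIV (loss m) u :> (real m * (unit_ell2 \<bullet> u) ^ (m - 1)) *\<^sub>R unit_ell2"
    by (rule GDERIV_loss)
  fix D assume "GDERIV (loss m) u :> D"
  then have "(\<lambda>h. h \<bullet> D) = (\<lambda>h. h \<bullet> ((real m * (unit_ell2 \<bullet> u) ^ (m - 1)) *\<^sub>R unit_ell2))"
    using GDERIV_loss[of m u] has_derivative_unique unfolding gderiv_def by blast
  then have "\<forall>h. h \<bullet> D = h \<bullet> ((real m * (unit_ell2 \<bullet> u) ^ (m - 1)) *\<^sub>R unit_ell2)"
    by (rule fun_cong[THEN allI])
  then show "D = (real m * (unit_ell2 \<bullet> u) ^ (m - 1)) *\<^sub>R unit_ell2"
    by (simp only: vector_eq_ldot)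
qed

lemma convex_on_loss:
  assumes "m = 1 \<or> m = 2"
  shows "convex_on UNIV (loss m)"
proof (rule convex_onI)
  fix t :: real and u v :: ell2 assume t: "0 < t" "t < 1"
  have lin: "unit_ell2 \<bullet> ((1 - t) *\<^sub>R u + t *\<^sub>R v) = (1 - t) * (unit_ell2 \<bullet> u) + t * (unit_ell2 \<bullet> v)"
    by (simp add: inner_add_right)
  have "((1 - t) * a + t * b)\<^sup>2 \<le> (1 - t) * a\<^sup>2 + t * b\<^sup>2" for a b :: real
    using convex_onD[OF convex_power2, of t a b] t by simp
  then show "loss m ((1 - t) *\<^sub>R u + t *\<^sub>R v) \<le> (1 - t) * loss m u + t * loss m v"
    using assms by (auto simp: loss_def lin)
qed simp

lemma lipschitz_gradient_loss:
  assumes "m = 1 \<or> m = 2"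
  shows "2-lipschitz_on UNIV (gradient (loss m))"
proof (rule lipschitz_onI)
  fix u v :: ell2
  have "dist (gradient (loss m) u) (gradient (loss m) v) \<le> 2 * \<bar>unit_ell2 \<bullet> (u - v)\<bar>"
    using assms
    by (auto simp: gradient_loss dist_norm norm_unit_ell2 inner_diff_right abs_mult
          simp flip: scaleR_diff_left right_diff_distrib)
  also have "\<dots> \<le> 2 * dist u v"
    using Cauchy_Schwarz_ineq2[of unit_ell2 "u - v"] by (simp add: norm_unit_ell2 dist_norm)
  finally show "dist (gradient (loss m) u) (gradient (loss m) v) \<le> 2 * dist u v" .
qed simp

section \<open>Nonnegative set functions as measures\<close>

lemma finite_measure_in_prob_measures:
  fixes N :: "(complex ^ 'n::finite) measure"
  assumes N: "finite_measure N" "sets N = sets (manifold_borel flat_torus)" "measure N torus = 1"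
    and \<mu>: "\<And>A. A \<in> sets (manifold_borel flat_torus) \<Longrightarrow> \<mu> A = measure N A"
  shows "\<mu> \<in> prob_measures flat_torus"
proof -
  interpret finite_measure N by fact
  have "(\<lambda>i. \<mu> (A i)) sums \<mu> (\<Union>i. A i)"
    if A: "range A \<subseteq> sets (manifold_borel flat_torus)" "disjoint_family A" for A :: "nat \<Rightarrow> _ set"
  proof -
    have "(\<lambda>i. measure N (A i)) sums measure N (\<Union>i. A i)"
      using A by (intro finite_measure_UNION) (auto simp: N(2))
    moreover have Ai: "A i \<in> sets (manifold_borel flat_torus)" for i using A by blast
    moreover have "(\<Union>i. A i) \<in> sets (manifold_borel flat_torus)" using A(1) by (rule sets.countable_UN)
    ultimately show ?thesis by (simp only: \<mu>)
  qed
  then have "\<mu> \<in> signed_measures flat_torus" unfolding signed_measures_def by blast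
  moreover have "0 \<le> \<mu> A" if "A \<in> sets (manifold_borel flat_torus)" for A
    by (simp add: \<mu>[OF that])
  moreover have "\<mu> torus = 1" by (simp add: \<mu> N(3))
  ultimately show ?thesis
    unfolding prob_measures_def nonneg_measures_def by simp
qed

text \<open>A nonnegative additive set function is monotone, so the supremum over measurable subsets
  of \<open>A\<close> is attained at \<open>A\<close> itself.\<close>

lemma upper_variation_nonneg:
  fixes \<mu> :: "(complex ^ 'n::finite) set \<Rightarrow> real"
  assumes \<mu>: "\<mu> \<in> nonneg_measures flat_torus"
  shows "sets (upper_variation flat_torus \<mu>) = sets (manifold_borel flat_torus)"
    and "A \<in> sets (manifold_borel flat_torus) \<Longrightarrow> emeasure (upper_variation flat_torus \<mu>) A = ennreal (\<mu> A)"
proof -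
  let ?X = "sets (manifold_borel flat_torus) :: (complex ^ 'n) set set"
  have sp: "?X \<subseteq> Pow torus" using sets.space_closed[of "manifold_borel flat_torus"] by simp
  have sig: "sigma_algebra (torus :: (complex ^ 'n) set) ?X"
    using sets.sigma_algebra_axioms[of "manifold_borel flat_torus"] by simp
  have sigX: "sigma_sets torus ?X = ?X"
    using sig by (rule sigma_algebra.sigma_sets_eq)
  have nonneg: "0 \<le> \<mu> A" if "A \<in> ?X" for A
    using \<mu> that by (simp add: nonneg_measures_def)
  have sums: "(\<lambda>i. \<mu> (A i)) sums \<mu> (\<Union>i. A i)" if "range A \<subseteq> ?X" "disjoint_family A" for A :: "nat \<Rightarrow> _ set"
    using \<mu> that unfolding nonneg_measures_def signed_measures_def by blast
  have zero: "\<mu> {} = 0"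
  proof -
    \<comment> \<open>A constant sequence is summable only if it is zero.\<close>
    have "(\<lambda>i :: nat. \<mu> {}) sums \<mu> {}"
      using sums[of "\<lambda>_. {}"] unfolding disjoint_family_on_def by simp
    then have "summable (\<lambda>i :: nat. \<mu> {})" by (rule sums_summable)
    then show ?thesis by (rule summable_const_iff[THEN iffD1])
  qed
  have mono: "\<mu> B \<le> \<mu> A" if AB: "A \<in> ?X" "B \<in> ?X" "B \<subseteq> A" for A B
  proof -
    have AB': "A - B \<in> ?X" using AB(1,2) by (rule sets.Diff)
    \<comment> \<open>Finite additivity, by padding the two sets with empty ones.\<close>
    have "range (binaryset B (A - B)) \<subseteq> ?X"
      using AB(2) AB' sets.empty_sets[of "manifold_borel flat_torus"]
      unfolding range_binaryset_eq by blast
    moreover have "disjoint_family (binaryset B (A - B))"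
      unfolding disjoint_family_on_def binaryset_def by auto
    ultimately have "(\<lambda>i. \<mu> (binaryset B (A - B) i)) sums \<mu> (\<Union>i. binaryset B (A - B) i)"
      by (rule sums)
    moreover have "(\<lambda>i. \<mu> (binaryset B (A - B) i)) sums (\<mu> B + \<mu> (A - B))"
      using zero by (rule binaryset_sums)
    ultimately have eq: "\<mu> (\<Union>i. binaryset B (A - B) i) = \<mu> B + \<mu> (A - B)"
      by (rule sums_unique2)
    have un: "(\<Union>i. binaryset B (A - B) i) = A"
      unfolding UN_binaryset_eq using AB(3) by blast
    show ?thesis
      using nonneg[OF AB'] eq[unfolded un] by linarith
  qed
  have eq: "upper_variation flat_torus \<mu> = measure_of torus ?X (\<lambda>A. ennreal (\<mu> A))"
    unfolding upper_variation_def flat_torus_simps topspace_euclidean_subtopology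
  proof (rule measure_of_eq[OF sp])
    fix A assume "A \<in> sigma_sets torus ?X"
    then have A: "A \<in> ?X" unfolding sigX .
    show "(SUP B \<in> {B \<in> ?X. B \<subseteq> A}. ennreal (\<mu> B)) = ennreal (\<mu> A)"
    proof (rule antisym)
      show "(SUP B \<in> {B \<in> ?X. B \<subseteq> A}. ennreal (\<mu> B)) \<le> ennreal (\<mu> A)"
        by (intro SUP_least ennreal_leI mono A) simp_all
      show "ennreal (\<mu> A) \<le> (SUP B \<in> {B \<in> ?X. B \<subseteq> A}. ennreal (\<mu> B))"
        using A by (intro SUP_upper) simp
    qed
  qed
  show "sets (upper_variation flat_torus \<mu>) = ?X"
    unfolding eq by (rule trans[OF sets_measure_of[OF sp] sigX])
  show "emeasure (upper_variation flat_torus \<mu>) A = ennreal (\<mu> A)" if "A \<in> ?X"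
    unfolding eq
  proof (rule emeasure_measure_of_sigma[OF sig _ _ that])
    show "positive ?X (\<lambda>A. ennreal (\<mu> A))" unfolding positive_def zero by simp
    show "countably_additive ?X (\<lambda>A. ennreal (\<mu> A))"
      unfolding countably_additive_def
    proof (intro allI impI)
      fix A :: "nat \<Rightarrow> _ set"
      assume A: "range A \<subseteq> ?X" "disjoint_family A"
      have "(\<lambda>i. \<mu> (A i)) sums \<mu> (\<Union>i. A i)" by (rule sums[OF A])
      moreover have "0 \<le> \<mu> (A i)" for i using A(1) by (intro nonneg) blast
      ultimately show "(\<Sum>i. ennreal (\<mu> (A i))) = ennreal (\<mu> (\<Union>i. A i))"
        by (intro suminf_ennreal_eq)
    qed
  qed
qed

text \<open>All values of \<open>- \<mu>\<close> are nonpositive and are cut off at 0 by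
  \<open>ennreal\<close>: the negative part is the null measure.\<close>

lemma integral_upper_variation_uminus:
  fixes \<mu> :: "(complex ^ 'n::finite) set \<Rightarrow> real" and g :: "_ \<Rightarrow> 'b::{banach, second_countable_topology}"
  assumes \<mu>: "\<mu> \<in> nonneg_measures flat_torus"
  shows "integral\<^sup>L (upper_variation flat_torus (\<lambda>A. - \<mu> A)) g = 0"
proof -
  let ?X = "sets (manifold_borel flat_torus) :: (complex ^ 'n) set set"
  let ?U = "upper_variation flat_torus (\<lambda>A. - \<mu> A)"
  have sp: "?X \<subseteq> Pow torus" using sets.space_closed[of "manifold_borel flat_torus"] by simp
  have "?U = sigma torus ?X"
    unfolding upper_variation_def flat_torus_simps topspace_euclidean_subtopology
  proof (rule measure_of_eq[OF sp])
    fix A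
    have "ennreal (- \<mu> B) = 0" if "B \<in> ?X" for B
      using \<mu> that by (simp add: nonneg_measures_def ennreal_neg)
    then show "(SUP B \<in> {B \<in> ?X. B \<subseteq> A}. ennreal (- \<mu> B)) = 0"
      by (auto intro!: antisym SUP_least)
  qed
  then have "emeasure ?U (space ?U) = 0" by (simp add: emeasure_sigma)
  then have "AE x in ?U. False" by (auto simp: AE_iff_null null_sets_def)
  then have "AE x in ?U. g x = 0" by eventually_elim simp
  then show ?thesis by (rule integral_eq_zero_AE)
qed

lemma signed_integral_nonneg:
  fixes \<mu> :: "(complex ^ 'n::finite) set \<Rightarrow> real" and g :: "_ \<Rightarrow> 'b::{banach, second_countable_topology}"
  assumes \<mu>: "\<mu> \<in> nonneg_measures flat_torus"
    and N: "finite_measure N" "sets N = sets (manifold_borel flat_torus)"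
    and \<mu>N: "\<And>A. A \<in> sets (manifold_borel flat_torus) \<Longrightarrow> \<mu> A = measure N A"
  shows "signed_integral flat_torus \<mu> g = integral\<^sup>L N g"
proof -
  interpret finite_measure N by fact
  have "upper_variation flat_torus \<mu> = N"
    by (rule measure_eqI)
      (auto simp: upper_variation_nonneg[OF \<mu>] N(2) \<mu>N emeasure_eq_measure)
  then show ?thesis
    by (simp add: signed_integral_def integral_upper_variation_uminus[OF \<mu>])
qed

text \<open>Makes \<open>objective_prob\<close> applicable to every element of
  \<open>prob_measures\<close>, as the infimum over all signed measures requires.\<close>

lemma prob_measures_representation:
  fixes \<mu> :: "(complex ^ 'n::finite) set \<Rightarrow> real"
  assumes "\<mu> \<in> prob_measures flat_torus"
  obtains N where "finite_measure N" "sets N = sets (manifold_borel flat_torus)" "measure N torus = 1"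
    "\<And>A. A \<in> sets (manifold_borel flat_torus) \<Longrightarrow> \<mu> A = measure N A"
proof
  let ?U = "upper_variation flat_torus \<mu>"
  have \<mu>: "\<mu> \<in> nonneg_measures flat_torus" and one: "\<mu> torus = 1"
    using assms by (auto simp: prob_measures_def)
  show sets: "sets ?U = sets (manifold_borel flat_torus)"
    by (rule upper_variation_nonneg[OF \<mu>])
  show meas: "\<mu> A = measure ?U A" if "A \<in> sets (manifold_borel flat_torus)" for A
    using upper_variation_nonneg(2)[OF \<mu> that] \<mu> that
    by (simp add: measure_def nonneg_measures_def)
  show "measure ?U torus = 1" using meas[of torus] one by simp
  have "space ?U = torus" using sets_eq_imp_space_eq[OF sets] by simp
  then show "finite_measure ?U"
    using upper_variation_nonneg(2)[OF \<mu>, of torus] by (intro finite_measureI) simp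
qed

lemma integral_feature:
  fixes N :: "(complex ^ 'n::finite) measure"
  shows "integral\<^sup>L N (feature k) = (\<integral>z. norm (z - 1) ^ k \<partial>N) *\<^sub>R unit_ell2"
  unfolding feature_def
  \<comment> \<open>The inner product with \<open>unit_ell2\<close> is a left inverse of scaling
    that vector, so the scalar can be pulled out whether or not the integrals exist.\<close>
  by (rule integral_bounded_linear'[OF bounded_linear_scaleR_left bounded_linear_inner_right[of unit_ell2]])
    (simp add: inner_unit_ell2)

lemma objective_prob:
  fixes N :: "(complex ^ 'n::finite) measure"
  assumes N: "finite_measure N" "sets N = sets (manifold_borel flat_torus)" "measure N torus = 1"
    and \<mu>: "\<And>A. A \<in> sets (manifold_borel flat_torus) \<Longrightarrow> \<mu> A = measure N A"
  shows "objective flat_torus (feature k) (loss m) prob_indicator \<mu> = ereal ((\<integral>z. norm (z - 1) ^ k \<partial>N) ^ m)"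
proof -
  have P: "\<mu> \<in> prob_measures flat_torus" using N \<mu> by (rule finite_measure_in_prob_measures)
  then have "\<mu> \<in> nonneg_measures flat_torus" by (simp add: prob_measures_def)
  then have "signed_integral flat_torus \<mu> (feature k) = integral\<^sup>L N (feature k)"
    using N \<mu> by (intro signed_integral_nonneg)
  then show ?thesis using P
    by (simp add: objective_def smooth_part_def prob_indicator_def convex_indicator_def
        integral_feature loss_def inner_unit_ell2)
qed

lemma objective_not_prob:
  assumes "\<mu> \<notin> prob_measures flat_torus"
  shows "objective flat_torus (feature k) (loss m) prob_indicator \<mu> = \<infinity>"
  using assms by (simp add: objective_def prob_indicator_def convex_indicator_def)

lemma objective_nonneg: "0 \<le> objective flat_torus (feature k) (loss m) prob_indicator \<mu>"
proof (cases "\<mu> \<in> prob_measures flat_torus")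
  case True
  then obtain N where "finite_measure N" "sets N = sets (manifold_borel flat_torus)" "measure N torus = 1"
    "\<And>A. A \<in> sets (manifold_borel flat_torus) \<Longrightarrow> \<mu> A = measure N A"
    by (rule prob_measures_representation) blast
  then have "objective flat_torus (feature k) (loss m) prob_indicator \<mu> = ereal ((\<integral>z. norm (z - 1) ^ k \<partial>N) ^ m)"
    by (rule objective_prob)
  then show ?thesis by (simp add: integral_nonneg)
qed (simp add: objective_not_prob)

lemma finite_torus_measure: "finite_measure torus_measure"
  by (rule finite_measureI) (simp add: emeasure_torus)

lemma one_in_torus [simp]: "1 \<in> torus"
  by (simp add: torus_def)

text \<open>The Dirac mass is realised as the push-forward of a probability measure under a constant
  map; its integrals are then those of constants.\<close>

lemma dirac_one_measure:
  fixes A :: "(complex ^ 'n::finite) set"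
  defines "N \<equiv> distr torus_measure (manifold_borel flat_torus) (\<lambda>_ :: complex ^ 'n. 1 :: complex ^ 'n)"
  shows "finite_measure N" "sets N = sets (manifold_borel flat_torus)" "measure N torus = 1"
    and "A \<in> sets (manifold_borel flat_torus) \<Longrightarrow> dirac_one A = measure N A"
    and "0 < k \<Longrightarrow> (\<integral>z. norm (z - 1) ^ k \<partial>N) = 0"
proof -
  have m: "(\<lambda>_ :: complex ^ 'n. 1) \<in> torus_measure \<rightarrow>\<^sub>M manifold_borel (flat_torus :: (complex ^ 'n, 'n) riemannian)"
    by (rule measurable_const) simp
  have one: "measure torus_measure (torus :: (complex ^ 'n) set) = 1"
    by (simp add: measure_def emeasure_torus)
  show "finite_measure N" unfolding N_def
    by (rule finite_measure.finite_measure_distr[OF finite_torus_measure m])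
  show "sets N = sets (manifold_borel flat_torus)" by (simp add: N_def)
  have eq: "measure N B = indicator B 1" if "B \<in> sets (manifold_borel flat_torus)" for B
    unfolding N_def measure_distr[OF m that] by (simp add: one indicator_def vimage_def)
  show "measure N torus = 1" by (simp add: eq)
  show "dirac_one A = measure N A" if "A \<in> sets (manifold_borel flat_torus)"
    using eq[OF that] by (simp add: dirac_one_def)
  have "(\<lambda>z :: complex ^ 'n. norm (z - 1) ^ k) \<in> borel_measurable (manifold_borel flat_torus)"
    by (intro borel_measurable_continuous_on_torus continuous_intros)
  then show "(\<integral>z. norm (z - 1) ^ k \<partial>N) = 0" if "0 < k"
    using that unfolding N_def by (subst integral_distr[OF m]) simp_all
qed

lemma dirac_one_in_prob_measures: "dirac_one \<in> prob_measures flat_torus"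
  by (rule finite_measure_in_prob_measures[OF dirac_one_measure(1-3) dirac_one_measure(4)])

lemma objective_dirac_one:
  assumes "0 < k" "0 < m"
  shows "objective flat_torus (feature k) (loss m) prob_indicator
    (dirac_one :: (complex ^ 'n::finite) set \<Rightarrow> real) = 0"
proof -
  show ?thesis
    using assms by (subst objective_prob[OF dirac_one_measure(1-3) dirac_one_measure(4)])
      (simp_all add: dirac_one_measure(5))
qed

lemma signed_integral_dirac_one:
  assumes "0 < k"
  shows "signed_integral flat_torus (dirac_one :: (complex ^ 'n::finite) set \<Rightarrow> real) (feature k) = 0"
proof -
  have "(dirac_one :: (complex ^ 'n) set \<Rightarrow> real) \<in> nonneg_measures flat_torus"
    using dirac_one_in_prob_measures unfolding prob_measures_def by blast
  then show ?thesis
    using assms by (subst signed_integral_nonneg[OF _ dirac_one_measure(1,2) dirac_one_measure(4)])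
      (simp_all add: integral_feature dirac_one_measure(5))
qed

lemma assumption_A1_torus:
  assumes "m = 1 \<or> m = 2"
  shows "assumption_A1 flat_torus (feature k) (loss m) prob_indicator"
  unfolding assumption_A1_def
proof (intro conjI)
  show "continuous_map (man_top flat_torus) euclidean (feature k)"
    by (simp add: continuous_on_feature)
  show "convex_on UNIV (loss m)" by (rule convex_on_loss[OF assms])
  show "\<forall>x. \<exists>D. GDERIV (loss m) x :> D" using GDERIV_loss by blast
  show "\<exists>L. L-lipschitz_on UNIV (gradient (loss m))" using lipschitz_gradient_loss[OF assms] by blast
  show "\<exists>hs. set hs \<subseteq> basic_regularizers flat_torus \<and> prob_indicator = (\<lambda>\<mu>. \<Sum>h\<leftarrow>hs. h \<mu>)"
    by (rule exI[of _ "[prob_indicator]"]) (simp add: basic_regularizers_def prob_indicator_def)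
  show "\<exists>\<mu>\<in>signed_measures flat_torus. prob_indicator \<mu> \<noteq> \<infinity>"
    using dirac_one_in_prob_measures
    by (intro bexI[of _ dirac_one])
      (auto simp: prob_indicator_def convex_indicator_def prob_measures_def nonneg_measures_def)
qed

section \<open>Regularity of the features\<close>

lemma lipschitz_map_feature:
  "lipschitz_map flat_torus (feature 1 :: complex ^ 'n::finite \<Rightarrow> ell2)"
  unfolding lipschitz_map_def
proof (intro exI ballI)
  fix x y :: "complex ^ 'n"
  assume xy: "x \<in> topspace (man_top flat_torus)" "y \<in> topspace (man_top flat_torus)"
  have "norm (feature 1 x - feature 1 y) = \<bar>norm (x - 1) - norm (y - 1)\<bar>"
    by (simp add: feature_def norm_unit_ell2 flip: scaleR_diff_left)
  also have "\<dots> \<le> norm (x - y)"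
    using norm_triangle_ineq3[of "x - 1" "y - 1"] by simp
  also have "\<dots> \<le> 2 * pi * geodesic_dist flat_torus x y"
    using xy by (intro norm_le_geodesic_dist) simp_all
  finally show "norm (feature 1 x - feature 1 y) \<le> 2 * pi * geodesic_dist flat_torus x y" .
qed

text \<open>Squaring removes the kink of the norm at the point 1 and leaves a trigonometric
  polynomial; hence the exponent 2 in the settings with Lipschitz derivative.\<close>

lemma norm_wind_minus_one: "(norm (wind x - 1))\<^sup>2 = (\<Sum>i\<in>UNIV. 2 - 2 * cos (2 * pi * x $ i))"
proof -
  have "(norm (wind x - 1))\<^sup>2 = (\<Sum>i\<in>UNIV. (norm (cis (2 * pi * x $ i) - 1))\<^sup>2)"
    by (simp add: norm_vec_def L2_set_def sum_nonneg wind_def)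
  moreover have "(norm (cis y - 1))\<^sup>2 = 2 - 2 * cos y" for y
    using sin_cos_squared_add[of y] by (simp add: cmod_power2 power2_diff)
  ultimately show ?thesis by simp
qed

text \<open>The gradient of the squared distance to 1, in the coordinates given by
  \<open>wind\<close>.\<close>

definition feature_grad :: "real ^ 'n::finite \<Rightarrow> real ^ 'n" where
  "feature_grad x = (\<chi> i. 4 * pi * sin (2 * pi * x $ i))"

lemma has_derivative_feature_wind:
  fixes x :: "real ^ 'n::finite"
  shows "((\<lambda>x. feature 2 (wind x)) has_derivative (\<lambda>h. (h \<bullet> feature_grad x) *\<^sub>R unit_ell2)) (at x)"
proof -
  have "((\<lambda>x. \<Sum>i\<in>UNIV. 2 - 2 * cos (2 * pi * x $ i)) has_derivative
      (\<lambda>h. \<Sum>i\<in>UNIV. h $ i * (4 * pi * sin (2 * pi * x $ i)))) (at x)"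
  proof (rule has_derivative_sum)
    fix i :: 'n
    have "((\<lambda>y :: real ^ 'n. y $ i) has_derivative (\<lambda>h. h $ i)) (at x)"
      by (rule bounded_linear_imp_has_derivative[OF bounded_linear_vec_nth])
    then show "((\<lambda>x. 2 - 2 * cos (2 * pi * x $ i)) has_derivative
        (\<lambda>h. h $ i * (4 * pi * sin (2 * pi * x $ i)))) (at x)"
      by (auto intro!: derivative_eq_intros simp: fun_eq_iff)
  qed
  from has_derivative_scaleR_left[OF this, of unit_ell2] show ?thesis
    by (simp add: feature_def norm_wind_minus_one inner_vec_def feature_grad_def)
qed

lemma abs_sin_diff_le: "\<bar>sin u - sin v\<bar> \<le> \<bar>u - v\<bar>" for u v :: real
proof -
  have "\<bar>sin u - sin v\<bar> = 2 * \<bar>sin ((u - v) / 2)\<bar> * \<bar>cos ((u + v) / 2)\<bar>"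
    by (simp add: sin_diff_sin abs_mult)
  also have "\<dots> \<le> 2 * \<bar>(u - v) / 2\<bar> * 1"
    by (intro mult_mono abs_sin_x_le_abs_x) auto
  finally show ?thesis by simp
qed

lemma feature_grad_lipschitz: "norm (feature_grad x - feature_grad y) \<le> 8 * pi\<^sup>2 * norm (x - y)"
proof -
  have "norm (feature_grad x - feature_grad y) \<le> norm ((8 * pi\<^sup>2) *\<^sub>R (x - y))"
  proof (rule norm_le_componentwise_cart)
    fix i
    have "\<bar>sin (2 * pi * x $ i) - sin (2 * pi * y $ i)\<bar> \<le> \<bar>2 * pi * x $ i - 2 * pi * y $ i\<bar>"
      by (rule abs_sin_diff_le)
    then have "4 * pi * \<bar>sin (2 * pi * x $ i) - sin (2 * pi * y $ i)\<bar> \<le> 4 * pi * \<bar>2 * pi * (x $ i - y $ i)\<bar>"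
      by (intro mult_left_mono) (simp_all add: right_diff_distrib)
    then show "norm ((feature_grad x - feature_grad y) $ i) \<le> norm (((8 * pi\<^sup>2) *\<^sub>R (x - y)) $ i)"
      by (simp add: feature_grad_def abs_mult power2_eq_square mult.assoc flip: right_diff_distrib)
  qed
  then show ?thesis by simp
qed

text \<open>On each cube the inverse chart is \<open>wind\<close>, so one globally Lipschitz
  derivative \<open>D\<close> serves all charts.\<close>

lemma lipschitz_derivative_feature:
  "lipschitz_derivative flat_torus (feature 2 :: complex ^ 'n::finite \<Rightarrow> ell2)"
proof -
  define D :: "real ^ 'n \<Rightarrow> (real ^ 'n) \<Rightarrow>\<^sub>L ell2" where
    "D x = blinfun_scaleR_left unit_ell2 o\<^sub>L blinfun_inner_left (feature_grad x)" for x
  have app: "blinfun_apply (D x) h = (h \<bullet> feature_grad x) *\<^sub>R unit_ell2" for x h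
    by (simp add: D_def)
  have lip: "(8 * pi\<^sup>2)-lipschitz_on K D" for K
  proof (rule lipschitz_onI)
    fix x y
    have "norm (D x - D y) \<le> norm (feature_grad x - feature_grad y)"
    proof (rule norm_blinfun_bound)
      fix h
      have "norm (blinfun_apply (D x - D y) h) = \<bar>h \<bullet> (feature_grad x - feature_grad y)\<bar>"
        by (simp add: blinfun.diff_left app norm_unit_ell2 inner_diff_right flip: scaleR_diff_left)
      also have "\<dots> \<le> norm (feature_grad x - feature_grad y) * norm h"
        using Cauchy_Schwarz_ineq2[of h "feature_grad x - feature_grad y"] by (simp add: mult.commute)
      finally show "norm (blinfun_apply (D x - D y) h) \<le> norm (feature_grad x - feature_grad y) * norm h" .
    qed simp
    also have "\<dots> \<le> 8 * pi\<^sup>2 * norm (x - y)" by (rule feature_grad_lipschitz)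
    finally show "dist (D x) (D y) \<le> 8 * pi\<^sup>2 * dist x y" by (simp add: dist_norm)
  qed simp
  have "((feature 2 \<circ> inv_into (patch a) (coord a)) has_derivative blinfun_apply (D x)) (at x)"
    if "x \<in> cube a" for a x :: "real ^ 'n"
  proof (rule has_derivative_transform_within_open[OF _ open_cube that])
    show "((\<lambda>x. feature 2 (wind x)) has_derivative blinfun_apply (D x)) (at x)"
      using has_derivative_feature_wind[of x] by (simp add: app[abs_def])
  qed (simp add: inv_into_coord)
  then show ?thesis
    using lip unfolding lipschitz_derivative_def flat_torus_simps
    by (intro ballI) (clarsimp simp only: image_coord_patch, blast)
qed

subsection \<open>Densities\<close>

lemma density_measure_eq_measure:
  fixes f :: "complex ^ 'n::finite \<Rightarrow> real"
  assumes f: "integrable torus_measure f" "AE z in torus_measure. 0 \<le> f z"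
    and A: "A \<in> sets (manifold_borel flat_torus)"
  shows "density_measure flat_torus f A = measure (density torus_measure (\<lambda>z. ennreal (f z))) A"
proof -
  have m: "f \<in> borel_measurable torus_measure" using f(1) by (rule borel_measurable_integrable)
  have A': "A \<in> sets torus_measure" using A by simp
  have i: "integrable torus_measure (\<lambda>z. indicator A z * f z)"
    using integrable_real_mult_indicator[OF A' f(1)] by (simp add: mult.commute)
  have ge0: "AE z in torus_measure. 0 \<le> indicator A z * f z"
    using f(2) by eventually_elim simp
  have "emeasure (density torus_measure (\<lambda>z. ennreal (f z))) A
      = (\<integral>\<^sup>+ z. ennreal (f z) * indicator A z \<partial>torus_measure)"
    using m A' by (intro emeasure_density) auto
  also have "\<dots> = (\<integral>\<^sup>+ z. ennreal (indicator A z * f z) \<partial>torus_measure)"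
    by (intro nn_integral_cong) (simp add: indicator_def)
  also have "\<dots> = ennreal (\<integral>z. indicator A z * f z \<partial>torus_measure)"
    using i ge0 by (rule nn_integral_eq_integral)
  finally have e: "emeasure (density torus_measure (\<lambda>z. ennreal (f z))) A
      = ennreal (\<integral>z. indicator A z * f z \<partial>torus_measure)" .
  have "0 \<le> (\<integral>z. indicator A z * f z \<partial>torus_measure)"
    using ge0 by (rule integral_nonneg_AE)
  then show ?thesis
    by (simp add: density_measure_def set_lebesgue_integral_def tau_flat_torus measure_def e)
qed

lemma objective_density:
  fixes f :: "complex ^ 'n::finite \<Rightarrow> real"
  assumes f: "integrable torus_measure f" "AE z in torus_measure. 0 \<le> f z" "integral\<^sup>L torus_measure f = 1"
  shows "objective flat_torus (feature k) (loss m) prob_indicator (density_measure flat_torus f)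
    = ereal ((\<integral>z. norm (z - 1) ^ k * f z \<partial>torus_measure) ^ m)"
proof -
  let ?N = "density torus_measure (\<lambda>z. ennreal (f z))"
  have m: "f \<in> borel_measurable torus_measure" using f(1) by (rule borel_measurable_integrable)
  have mk: "(\<lambda>z :: complex ^ 'n. norm (z - 1) ^ k) \<in> borel_measurable torus_measure"
    unfolding measurable_cong_sets[OF sets_torus_measure refl]
    by (intro borel_measurable_continuous_on_torus continuous_intros)
  have "emeasure ?N (space ?N) = (\<integral>\<^sup>+ z. ennreal (f z) \<partial>torus_measure)"
  proof -
    have "emeasure ?N (space ?N) = (\<integral>\<^sup>+ z. ennreal (f z) * indicator (space ?N) z \<partial>torus_measure)"
      using m by (intro emeasure_density) auto
    also have "\<dots> = (\<integral>\<^sup>+ z. ennreal (f z) \<partial>torus_measure)"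
      by (intro nn_integral_cong) simp
    finally show ?thesis .
  qed
  also have "\<dots> = ennreal 1"
    using f nn_integral_eq_integral[OF f(1,2)] by simp
  finally have e: "emeasure ?N (space ?N) = 1" by simp
  then have fin: "finite_measure ?N" by (intro finite_measureI) simp
  have one: "measure ?N torus = 1" using e by (simp add: measure_def)
  have s: "sets ?N = sets (manifold_borel flat_torus)" by simp
  have "objective flat_torus (feature k) (loss m) prob_indicator (density_measure flat_torus f)
    = ereal ((\<integral>z. norm (z - 1) ^ k \<partial>?N) ^ m)"
    by (rule objective_prob[OF fin s one density_measure_eq_measure[OF f(1,2)]])
  also have "(\<integral>z. norm (z - 1) ^ k \<partial>?N) = (\<integral>z. norm (z - 1) ^ k * f z \<partial>torus_measure)"
    using mk m f(2) by (subst integral_density) (simp_all add: mult.commute)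
  finally show ?thesis .
qed

text \<open>Testing the measure on the set where \<open>f\<close> is negative shows that this set is
  null.\<close>

lemma density_measure_probD:
  fixes f :: "complex ^ 'n::finite \<Rightarrow> real"
  assumes f: "integrable torus_measure f" and P: "density_measure flat_torus f \<in> prob_measures flat_torus"
  shows "AE z in torus_measure. 0 \<le> f z" "integral\<^sup>L torus_measure f = 1"
proof -
  have m: "f \<in> borel_measurable torus_measure" using f by (rule borel_measurable_integrable)
  define A where "A = {z \<in> space torus_measure. f z < 0}"
  have A: "A \<in> sets torus_measure" unfolding A_def using m by measurable
  have i: "integrable torus_measure (\<lambda>z. - (indicator A z * f z))"
    using integrable_real_mult_indicator[OF A f] by (simp add: mult.commute)
  have "0 \<le> density_measure flat_torus f A"
    using P A unfolding prob_measures_def nonneg_measures_def by simp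
  then have "(\<integral>z. - (indicator A z * f z) \<partial>torus_measure) \<le> 0"
    by (simp add: density_measure_def set_lebesgue_integral_def tau_flat_torus)
  moreover have nonneg: "0 \<le> - (indicator A z * f z)" for z by (simp add: A_def indicator_def)
  then have "0 \<le> (\<integral>z. - (indicator A z * f z) \<partial>torus_measure)" by (intro Bochner_Integration.integral_nonneg)
  ultimately have "(\<integral>z. - (indicator A z * f z) \<partial>torus_measure) = 0" by linarith
  then have "AE z in torus_measure. - (indicator A z * f z) = 0"
    using integral_nonneg_eq_0_iff_AE[OF i] nonneg by simp
  moreover have "AE z in torus_measure. z \<in> space torus_measure" by (rule AE_space)
  ultimately show "AE z in torus_measure. 0 \<le> f z"
  proof eventually_elim
    case (elim z)
    then show ?case by (cases "f z < 0") (simp_all add: A_def)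
  qed
  have "density_measure flat_torus f torus = 1"
    using P unfolding prob_measures_def by simp
  moreover have "density_measure flat_torus f torus = integral\<^sup>L torus_measure f"
    unfolding density_measure_def set_lebesgue_integral_def tau_flat_torus
    by (intro Bochner_Integration.integral_cong) simp_all
  ultimately show "integral\<^sup>L torus_measure f = 1" by simp
qed

section \<open>Moments and concentration near 1\<close>

lemma integrable_norm_minus_one_mult:
  fixes f :: "complex ^ 'n::finite \<Rightarrow> real"
  assumes f: "integrable torus_measure f"
  shows "integrable torus_measure (\<lambda>z. norm (z - 1) ^ k * f z)"
proof -
  have "continuous_on torus (\<lambda>z :: complex ^ 'n. norm (z - 1) ^ k)"
    by (intro continuous_intros)
  then have "bounded ((\<lambda>z :: complex ^ 'n. norm (z - 1) ^ k) ` torus)"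
    using compact_torus by (intro compact_imp_bounded compact_continuous_image)
  then obtain K where "\<forall>x\<in>(\<lambda>z :: complex ^ 'n. norm (z - 1) ^ k) ` torus. norm x \<le> K"
    unfolding bounded_iff by blast
  then have K: "norm (norm (z - 1) ^ k) \<le> K" if "z \<in> torus" for z :: "complex ^ 'n"
    using that by blast
  have mk: "(\<lambda>z :: complex ^ 'n. norm (z - 1) ^ k) \<in> borel_measurable torus_measure"
    unfolding measurable_cong_sets[OF sets_torus_measure refl]
    by (intro borel_measurable_continuous_on_torus continuous_intros)
  have m: "f \<in> borel_measurable torus_measure" using f by (rule borel_measurable_integrable)
  show ?thesis
  proof (rule Bochner_Integration.integrable_bound)
    show "integrable torus_measure (\<lambda>z. K * f z)" using f by (rule integrable_mult_right)
    show "(\<lambda>z. norm (z - 1) ^ k * f z) \<in> borel_measurable torus_measure"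
      using mk m by (rule borel_measurable_times)
    have "AE z :: complex ^ 'n in torus_measure. z \<in> space torus_measure" by (rule AE_space)
    then show "AE z in torus_measure. norm (norm (z - 1) ^ k * f z) \<le> norm (K * f z)"
    proof eventually_elim
      case (elim z)
      then have "norm (norm (z - 1) ^ k) \<le> K" using K[of z] unfolding space_torus_measure by blast
      also have "K \<le> norm K" by simp
      finally have "norm (norm (z - 1) ^ k) \<le> norm K" .
      then show ?case unfolding norm_mult by (rule mult_right_mono) simp
    qed
  qed
qed

lemma AE_not_one: "AE z in torus_measure. z \<noteq> (1 :: complex ^ 'n::finite)"
proof -
  have sub: "{1 :: complex ^ 'n} \<subseteq> patch 0"
    by (simp add: patch_def)
  have "{1 :: complex ^ 'n} = torus - (torus - {1})" by auto
  moreover have "openin (top_of_set torus) (torus - {1 :: complex ^ 'n})"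
    unfolding openin_open by (rule exI[of _ "- {1}"]) auto
  ultimately have s: "{1 :: complex ^ 'n} \<in> sets (manifold_borel flat_torus)"
    using sets.Diff[OF torus_in_sets openin_in_sets] by metis
  have "emeasure torus_measure {1 :: complex ^ 'n} = emeasure lborel (coord 0 ` {1 :: complex ^ 'n})"
    by (rule emeasure_torus_measure_patch[OF s sub])
  also have "\<dots> = 0" by simp
  finally have "{1 :: complex ^ 'n} \<in> null_sets torus_measure" using s by auto
  then show ?thesis using AE_not_in by force
qed

text \<open>A vanishing moment would force \<open>f\<close> to vanish away from 1, hence almost
  everywhere, against its mass 1. Positivity yields a genuine radius \<open>\<epsilon>\<close> in
  the final estimate.\<close>

lemma moment_pos:
  fixes f :: "complex ^ 'n::finite \<Rightarrow> real"
  assumes f: "integrable torus_measure f" "AE z in torus_measure. 0 \<le> f z" "integral\<^sup>L torus_measure f = 1"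
  shows "0 < (\<integral>z. norm (z - 1) ^ k * f z \<partial>torus_measure)"
proof -
  let ?g = "\<lambda>z. norm (z - 1) ^ k * f z"
  have g: "AE z in torus_measure. 0 \<le> ?g z" using f(2) by eventually_elim simp
  have "(\<integral>z. ?g z \<partial>torus_measure) \<noteq> 0"
  proof
    assume "(\<integral>z. ?g z \<partial>torus_measure) = 0"
    then have "AE z in torus_measure. ?g z = 0"
      using integral_nonneg_eq_0_iff_AE[OF integrable_norm_minus_one_mult[OF f(1)] g] by simp
    then have "AE z in torus_measure. f z = 0"
      using AE_not_one by eventually_elim simp
    then have "integral\<^sup>L torus_measure f = 0" by (rule integral_eq_zero_AE)
    then show False using f(3) by simp
  qed
  moreover have "0 \<le> (\<integral>z. ?g z \<partial>torus_measure)" using g by (rule integral_nonneg_AE)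
  ultimately show ?thesis by simp
qed

lemma mass_near_one:
  fixes f :: "complex ^ 'n::finite \<Rightarrow> real"
  assumes f: "integrable torus_measure f" "AE z in torus_measure. 0 \<le> f z" "integral\<^sup>L torus_measure f = 1"
    and \<epsilon>: "0 < \<epsilon>" "\<epsilon> ^ k = 2 * (\<integral>z. norm (z - 1) ^ k * f z \<partial>torus_measure)"
  defines "A \<equiv> {z \<in> torus. norm (z - 1) < \<epsilon>}"
  shows "1 / 2 \<le> (\<integral>z. indicator A z * f z \<partial>torus_measure)"
proof -
  let ?g = "\<lambda>z. norm (z - 1) ^ k * f z"
  have A: "A \<in> sets torus_measure" unfolding A_def by (simp add: norm_minus_one_ball_in_sets)
  have iA: "integrable torus_measure (\<lambda>z. indicator A z * f z)"
    using integrable_real_mult_indicator[OF A f(1)] by (simp add: mult.commute)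
  have ig: "integrable torus_measure ?g" by (rule integrable_norm_minus_one_mult[OF f(1)])
  have "1 - (\<integral>z. indicator A z * f z \<partial>torus_measure) = (\<integral>z. f z - indicator A z * f z \<partial>torus_measure)"
    using f(1,3) iA by simp
  \<comment> \<open>On \<open>A\<close> the left integrand vanishes; off \<open>A\<close> the weight
    \<open>norm (z - 1) ^ k / \<epsilon> ^ k\<close> is at least 1.\<close>
  also have "\<dots> \<le> (\<integral>z. ?g z / \<epsilon> ^ k \<partial>torus_measure)"
  proof (rule integral_mono_AE)
    have "AE z :: complex ^ 'n in torus_measure. z \<in> space torus_measure" by (rule AE_space)
    with f(2) show "AE z in torus_measure. f z - indicator A z * f z \<le> ?g z / \<epsilon> ^ k"
    proof eventually_elim
      case (elim z)
      show ?case
      proof (cases "z \<in> A")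
        case False
        then have "\<epsilon> ^ k \<le> norm (z - 1) ^ k"
          using elim \<epsilon>(1) by (intro power_mono) (auto simp: A_def)
        then have "f z * \<epsilon> ^ k \<le> f z * norm (z - 1) ^ k" using elim by (intro mult_left_mono)
        then show ?thesis using False \<epsilon>(1) by (simp add: le_divide_eq mult.commute)
      qed (use elim \<epsilon>(1) in simp)
    qed
  qed (use f(1) iA ig in simp_all)
  also have "\<dots> = 1 / 2" using \<epsilon> moment_pos[OF f, of k] by simp
  finally show ?thesis by simp
qed

text \<open>The term subtracted in \<open>psi\<close> is an infimum over densities, among which the
  Dirac mass is missing; uniform densities on shrinking balls approach its value 0. Radii
  \<open>s \<le> 1\<close> give \<open>s ^ k \<le> s\<close> and
  \<open>s ^ m \<le> s\<close>.\<close>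

lemma INF_objective_density:
  assumes "0 < k" "0 < m"
  shows "(INF g \<in> {g :: complex ^ 'n::finite \<Rightarrow> real. integrable (tau flat_torus) g}.
    objective flat_torus (feature k) (loss m) prob_indicator (density_measure flat_torus g)) = (0 :: ereal)"
    (is "?I = 0")
proof (rule antisym)
  show "0 \<le> ?I" by (intro INF_greatest objective_nonneg)
  have small: "?I \<le> ereal s" if s: "0 < s" "s \<le> 1" for s
  proof -
    define A where "A = {z :: complex ^ 'n \<in> torus. norm (z - 1) < s}"
    interpret finite_measure "torus_measure :: (complex ^ 'n) measure" by (rule finite_torus_measure)
    have A: "A \<in> sets torus_measure" unfolding A_def by (simp add: norm_minus_one_ball_in_sets)
    have pos: "0 < measure torus_measure A"
      using emeasure_ball_pos[OF s(1), where 'n = 'n] by (simp add: emeasure_eq_measure A_def)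
    define f where "f z = indicator A z / measure torus_measure A" for z
    have f: "integrable torus_measure f"
      using A by (simp add: f_def[abs_def] less_top[symmetric])
    have f0: "AE z in torus_measure. 0 \<le> f z" by (simp add: f_def)
    have "A \<inter> torus = A" by (auto simp: A_def)
    then have f1: "integral\<^sup>L torus_measure f = 1" using A pos by (simp add: f_def[abs_def])
    have "(\<integral>z. norm (z - 1) ^ k * f z \<partial>torus_measure) \<le> (\<integral>z. s * f z \<partial>torus_measure)"
    proof (rule integral_mono[OF integrable_norm_minus_one_mult[OF f]])
      show "integrable torus_measure (\<lambda>z. s * f z)" using f by simp
      fix z
      show "norm (z - 1) ^ k * f z \<le> s * f z"
      proof (cases "z \<in> A")
        case True
        then have "norm (z - 1) ^ k \<le> s ^ k" by (intro power_mono) (auto simp: A_def)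
        also have "\<dots> \<le> s ^ 1" using s assms by (intro power_decreasing) auto
        finally show ?thesis by (intro mult_right_mono) (auto simp: f_def)
      qed (simp add: f_def)
    qed
    also have "\<dots> = s" using f1 by simp
    finally have t: "(\<integral>z. norm (z - 1) ^ k * f z \<partial>torus_measure) \<le> s" .
    have t0: "0 < (\<integral>z. norm (z - 1) ^ k * f z \<partial>torus_measure)" by (rule moment_pos[OF f f0 f1])
    have "?I \<le> objective flat_torus (feature k) (loss m) prob_indicator (density_measure flat_torus f)"
      using f by (intro INF_lower) (simp add: tau_flat_torus)
    also have "\<dots> = ereal ((\<integral>z. norm (z - 1) ^ k * f z \<partial>torus_measure) ^ m)"
      by (rule objective_density[OF f f0 f1])
    also have "\<dots> \<le> ereal (s ^ m)" using t t0 by (simp add: power_mono)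
    also have "\<dots> \<le> ereal (s ^ 1)" using s assms by (intro ereal_less_eq(3)[THEN iffD2] power_decreasing) auto
    finally show ?thesis by simp
  qed
  show "?I \<le> 0"
  proof (rule ereal_le_epsilon2)
    fix e :: real assume "0 < e"
    then have "?I \<le> ereal (min 1 e)" by (intro small) auto
    also have "\<dots> \<le> 0 + ereal e" by simp
    finally show "?I \<le> 0 + ereal e" .
  qed
qed

lemma psi_lower_bound:
  fixes f0 :: "complex ^ 'n::finite \<Rightarrow> real"
  assumes k: "0 < k" and m: "0 < m" and \<eta>: "assumption_A2 \<eta>" and f0: "admissible_init flat_torus \<eta> f0"
  shows "\<exists>c>0. \<exists>\<alpha>0>0. \<forall>\<alpha>\<in>{0<..\<alpha>0}.
    psi flat_torus (objective flat_torus (feature k) (loss m) prob_indicator) \<eta> f0 \<alpha> \<ge>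
      ereal c * (INF \<epsilon> \<in> {0<..}. ereal (\<epsilon> ^ (k * m))
        + ereal \<alpha> * ereal (\<epsilon> ^ CARD('n)) * \<eta> (1 / \<epsilon> ^ CARD('n)))"
proof -
  let ?F = "objective flat_torus (feature k) (loss m) prob_indicator :: ((complex ^ 'n) set \<Rightarrow> real) \<Rightarrow> ereal"
  let ?D = "\<lambda>f. \<integral>\<^sup>+ z. e2ennreal (bregman \<eta> (f z) (f0 z)) \<partial>torus_measure"
  obtain B where B: "AE z in torus_measure. \<bar>eta_deriv \<eta> (f0 z)\<bar> \<le> B"
    and int: "AE z in torus_measure. f0 z \<in> interior (eff_dom \<eta>)"
    using f0 unfolding admissible_init_def tau_flat_torus by blast
  \<comment> \<open>The given bound comes without a sign, while the estimates require
    \<open>0 \<le> B\<close>.\<close>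
  have B': "AE z in torus_measure. \<bar>eta_deriv \<eta> (f0 z)\<bar> \<le> max 0 B"
    using B by eventually_elim simp
  obtain c where c: "0 < c" and bound: "\<forall>\<alpha>\<in>{0<..1}. \<forall>\<epsilon>. \<forall>A\<in>sets (torus_measure :: (complex ^ 'n) measure).
     \<forall>f. 0 < \<epsilon> \<longrightarrow> integrable torus_measure f \<longrightarrow> (AE z in torus_measure. 0 \<le> f z) \<longrightarrow>
     measure torus_measure A \<le> (2 * \<epsilon>) ^ CARD('n) \<longrightarrow> 1 / 2 \<le> (\<integral>z. indicator A z * f z \<partial>torus_measure) \<longrightarrow>
     ereal c * (INF \<epsilon> \<in> {0<..}. ereal (\<epsilon> ^ (k * m)) + ereal \<alpha> * ereal (\<epsilon> ^ CARD('n)) * \<eta> (1 / \<epsilon> ^ CARD('n)))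
       \<le> ereal (\<epsilon> ^ (k * m) / 2 ^ m) + ereal \<alpha> * enn2ereal (?D f)"
    using rate_lower_bound[OF \<eta> finite_torus_measure zero_less_card_finite int B', of "k * m" m] by auto
  show ?thesis
  proof (rule exI[of _ c], intro conjI c exI[of _ 1] ballI)
    fix \<alpha> :: real assume \<alpha>: "\<alpha> \<in> {0<..1}"
    let ?L = "ereal c * (INF \<epsilon> \<in> {0<..}. ereal (\<epsilon> ^ (k * m))
        + ereal \<alpha> * ereal (\<epsilon> ^ CARD('n)) * \<eta> (1 / \<epsilon> ^ CARD('n)))"
    have "?L \<le> ?F (density_measure flat_torus f) - 0 + ereal \<alpha> * enn2ereal (bregman_int flat_torus \<eta> f f0)"
      if f: "integrable torus_measure f" for f
    proof (cases "density_measure flat_torus f \<in> prob_measures flat_torus")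
      case False
      then show ?thesis using \<alpha> by (simp add: objective_not_prob)
    next
      case True
      note f = f density_measure_probD[OF f True]
      define t where "t = (\<integral>z. norm (z - 1) ^ k * f z \<partial>torus_measure)"
      have t: "0 < t" unfolding t_def by (rule moment_pos[OF f])
      \<comment> \<open>Then \<open>t ^ m = \<epsilon> ^ (k * m) / 2 ^ m\<close>, the form of the
        objective value in \<open>rate_lower_bound\<close>; the factor 2 leaves half of the mass in
        Markov's inequality.\<close>
      define \<epsilon> where "\<epsilon> = root k (2 * t)"
      have \<epsilon>: "0 < \<epsilon>" "\<epsilon> ^ k = 2 * t" using t k by (simp_all add: \<epsilon>_def)
      define A where "A = {z :: complex ^ 'n \<in> torus. norm (z - 1) < \<epsilon>}"
      have A: "A \<in> sets torus_measure" unfolding A_def by (simp add: norm_minus_one_ball_in_sets)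
      have mA: "measure torus_measure A \<le> (2 * \<epsilon>) ^ CARD('n)"
        unfolding measure_def A_def using emeasure_ball_le[OF \<epsilon>(1), where 'n = 'n] \<epsilon>(1)
        by (intro enn2real_leI) simp_all
      have fA: "1 / 2 \<le> (\<integral>z. indicator A z * f z \<partial>torus_measure)"
        unfolding A_def using \<epsilon> by (intro mass_near_one[OF f]) (simp_all add: t_def)
      have "?L \<le> ereal (\<epsilon> ^ (k * m) / 2 ^ m) + ereal \<alpha> * enn2ereal (?D f)"
        using bound[rule_format, OF \<alpha> A \<epsilon>(1) f(1,2) mA fA] .
      also have "\<epsilon> ^ (k * m) / 2 ^ m = t ^ m"
        by (simp add: power_mult \<epsilon>(2) power_mult_distrib)
      also have "ereal (t ^ m) = ?F (density_measure flat_torus f)"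
        unfolding t_def by (rule objective_density[OF f, symmetric])
      finally show ?thesis by (simp add: bregman_int_def tau_flat_torus)
    qed
    then show "psi flat_torus ?F \<eta> f0 \<alpha> \<ge> ?L"
      unfolding psi_def INF_objective_density[OF k m]
      by (intro INF_greatest) (simp add: tau_flat_torus)
  qed simp
qed

theorem proposition5p1:
  fixes s :: setting
  shows "\<exists>(\<Theta> :: (complex ^ 'n, 'n::finite) riemannian) (\<Phi> :: complex ^ 'n \<Rightarrow> ell2)
           (R :: ell2 \<Rightarrow> real) (H :: ((complex ^ 'n) set \<Rightarrow> real) \<Rightarrow> ereal)
           (\<mu>s :: (complex ^ 'n) set \<Rightarrow> real).
    compact_riemannian_manifold \<Theta> \<and>
    assumption_A1 \<Theta> \<Phi> R H \<and>
    \<mu>s \<in> nonneg_measures \<Theta> \<and>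
    objective \<Theta> \<Phi> R H \<mu>s = (INF \<mu> \<in> signed_measures \<Theta>. objective \<Theta> \<Phi> R H \<mu>) \<and>
    setting_holds s \<Theta> \<Phi> R \<mu>s \<and>
    (\<forall>\<eta> f0. assumption_A2 \<eta> \<longrightarrow> admissible_init \<Theta> \<eta> f0 \<longrightarrow>
       (\<exists>c>0. \<exists>\<alpha>0>0. \<forall>\<alpha>\<in>{0<..\<alpha>0}.
          psi \<Theta> (objective \<Theta> \<Phi> R H) \<eta> f0 \<alpha> \<ge>
            ereal c * (INF \<epsilon> \<in> {0<..}. ereal (\<epsilon> ^ rate_exponent s)
              + ereal \<alpha> * ereal (\<epsilon> ^ CARD('n)) * \<eta> (1 / \<epsilon> ^ CARD('n)))))"
proof -
  define k :: nat where "k = (case s of Setting_I \<Rightarrow> 1 | Setting_I_star \<Rightarrow> 1 | Setting_II \<Rightarrow> 2 | Setting_II_star \<Rightarrow> 2)"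
  define m :: nat where "m = (case s of Setting_I \<Rightarrow> 1 | Setting_I_star \<Rightarrow> 2 | Setting_II \<Rightarrow> 1 | Setting_II_star \<Rightarrow> 2)"
  have k: "0 < k" and m: "0 < m" "m = 1 \<or> m = 2" and q: "rate_exponent s = k * m"
    by (cases s; simp add: k_def m_def)+
  let ?\<Theta> = "flat_torus :: (complex ^ 'n, 'n) riemannian"
  let ?F = "objective ?\<Theta> (feature k) (loss m) prob_indicator"
  have dirac: "dirac_one \<in> nonneg_measures ?\<Theta>" "dirac_one \<in> signed_measures ?\<Theta>"
    using dirac_one_in_prob_measures unfolding prob_measures_def nonneg_measures_def by blast+
  have "?F dirac_one = (INF \<mu> \<in> signed_measures ?\<Theta>. ?F \<mu>)"
    unfolding objective_dirac_one[OF k m(1)]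
  proof (rule antisym)
    show "0 \<le> (INF \<mu> \<in> signed_measures ?\<Theta>. ?F \<mu>)" by (intro INF_greatest objective_nonneg)
    show "(INF \<mu> \<in> signed_measures ?\<Theta>. ?F \<mu>) \<le> 0"
      using INF_lower[OF dirac(2), of ?F] by (simp add: objective_dirac_one[OF k m(1)])
  qed
  \<comment> \<open>For \<open>m = 2\<close> the gradient of the loss carries the integral of the
    feature as a factor, and this is zero for the Dirac mass.\<close>
  moreover have "smooth_part_diff ?\<Theta> (feature k) (loss m) dirac_one \<theta> = 0" if "m = 2" for \<theta>
    using that by (simp add: smooth_part_diff_def signed_integral_dirac_one[OF k] gradient_loss)
  then have "setting_holds s ?\<Theta> (feature k) (loss m) dirac_one"
    using lipschitz_map_feature lipschitz_derivative_feature
    by (cases s) (simp_all add: setting_holds_def k_def m_def)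
  moreover have "\<forall>\<eta> f0. assumption_A2 \<eta> \<longrightarrow> admissible_init ?\<Theta> \<eta> f0 \<longrightarrow>
       (\<exists>c>0. \<exists>\<alpha>0>0. \<forall>\<alpha>\<in>{0<..\<alpha>0}. psi ?\<Theta> ?F \<eta> f0 \<alpha> \<ge>
            ereal c * (INF \<epsilon> \<in> {0<..}. ereal (\<epsilon> ^ rate_exponent s)
              + ereal \<alpha> * ereal (\<epsilon> ^ CARD('n)) * \<eta> (1 / \<epsilon> ^ CARD('n))))"
    unfolding q using psi_lower_bound[OF k m(1)] by blast
  ultimately show ?thesis
    using compact_riemannian_flat_torus assumption_A1_torus[OF m(2), of k] dirac(1) by blast
qed

end
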